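(* Let $G$ be a microlinear groupoid over a microlinear base $M$ (in the setting of synthetic differential geometry). Then the $\mathbb{R}$-module $\Gamma(\mathcal{A}G)$ (equivalently, the tangent space at $\mathrm{id}$ of the group $\mathfrak{B}(G)$ of bisections of $G$) is a Lie algebra over $\mathbb{R}$ with respect to the bracket $[\cdot,\cdot]$, where for $X,Y\in\Gamma(\mathcal{A}G)$ the element $[X,Y]\in\Gamma(\mathcal{A}G)$ is the unique one such that $$[X,Y]_{d_1d_2}=Y_{-d_2}\ast X_{-d_1}\ast Y_{d_2}\ast X_{d_1}\qquad\text{for all } d_1,d_2\in D .$$ That is, $[\cdot,\cdot]$ is $\mathbb{R}$-bilinear, satisfies $[X,Y]=-[Y,X]$, and satisfies $[X,[Y,Z]]+[Y,[Z,X]]+[Z,[X,Y]]=0$ for all $X,Y,Z\in\Gamma(\mathcal{A}G)$.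
   Context: Setting: synthetic differential geometry; everything is carried out internally (with intuitionistic logic) in a Grothendieck topos with a commutative ring object $\mathbb{R}$ satisfying the general Kock-Lawvere axiom: for each Weil algebra $W$ over $\mathbb{R}$ with infinitesimal object $D(W)=\mathrm{Spec}_{\mathbb{R}}(W)$, the canonical map $W\to\mathbb{R}^{D(W)}$ is an isomorphism. $D=\{d\in\mathbb{R}\mid d^2=0\}$ and $D(2)=\{(d,d')\in D^2\mid dd'=0\}$. An object $N$ is microlinear if for every finite cocone of infinitesimal objects $D(W)$ that is turned into a limit cone by $\mathbb{R}^{(-)}$, it is also turned into a limit cone by $N^{(-)}$. $\mathbb{R}$, $M$ and $G$ are microlinear. Groupoid: $G$ is a groupoid over the base $M$ with object inclusion $\mathrm{id}:M\to G$, $x\mapsto \mathrm{id}_x$, source $\alpha:G\to M$ and target $\beta:G\to M$; the product $gh$ is defined when $\alpha(g)=\beta(h)$. $\mathfrak{S}(G)$ is the monoid of maps $\sigma:M\to G$ with $\alpha\circ\sigma$ the identity of $M$, with product $(\sigma\ast\rho)(x)=\sigma((\beta\circ\rho)(x))\,\rho(x)$ and unit $\mathrm{id}$. A bisection is a $\sigma\in\mathfrak{S}(G)$ such that $\beta\circ\sigma$ is a bijection of $M$ onto $M$; bisections form a group $\mathfrak{B}(G)$ under $\ast$. $\Gamma(\mathcal{A}G)$: $\mathcal{A}_xG$ is the set of maps $t:D\to G$ with $t(0)=\mathrm{id}_x$ and $\alpha(t(d))=x$ for all $d\in D$; $\mathcal{A}G$ is the union of the $\mathcal{A}_xG$ over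 $x\in M$; $\Gamma(\mathcal{A}G)$ is the set of sections of $\mathcal{A}G\to M$. An element $X\in\Gamma(\mathcal{A}G)$ is identified with the map $X:D\to\mathfrak{S}(G)$, $d\mapsto X_d$, $X_d(x)=X(x)(d)$, so $X_0=\mathrm{id}$; each $X_d$ in fact lies in $\mathfrak{B}(G)$, so $X$ is a tangent vector to $\mathfrak{B}(G)$ at $\mathrm{id}$. The $\mathbb{R}$-module structure is the usual one of a tangent space: $(aX)_d=X_{ad}$, and $(X+Y)_d=\ell(d,d)$ where $\ell:D(2)\to\mathfrak{B}(G)$ is the unique map with $\ell(d,0)=X_d$, $\ell(0,d)=Y_d$. The element $[X,Y]$ of the claim exists and is unique by microlinearity. *)

theory Defs
  imports "HOL-Library.FuncSet" "HOL-Algebra.Module" "HOL-Algebra.Ideal"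
begin

text \<open>
  The Kock-Lawvere axiom has only degenerate models in classical set theory, so the internal
  statements are interpreted in the topos of sheaves on an arbitrary small site, by
  Kripke-Joyal semantics: a formula is evaluated at a stage \<open>c\<close> (an object of the site), and
  \<open>\<forall>\<close> and \<open>\<Longrightarrow>\<close> range over all arrows into \<open>c\<close>.  All formulas
  needed are built from \<open>=\<close>, \<open>\<and>\<close>, \<open>\<Longrightarrow>\<close>, \<open>\<forall>\<close> and
  \<open>\<exists>!\<close>; for sheaves, locally unique existence is the same as unique existence
  at the stage itself, so covering sieves occur only in the sheaf condition.
\<close>

section \<open>Sites and sheaves\<close>

record ('o, 'm) cat =
  Ob :: "'o set"
  Arr :: "'m set"
  Dom :: "'m \<Rightarrow> 'o"
  Cod :: "'m \<Rightarrow> 'o"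
  Id :: "'o \<Rightarrow> 'm"
  Comp :: "'m \<Rightarrow> 'm \<Rightarrow> 'm" (infixl "\<cdot>\<index>" 75)

definition into :: "('o, 'm) cat \<Rightarrow> 'o \<Rightarrow> 'm set" where
  "into C c = {f \<in> Arr C. Cod C f = c}"

locale small_category =
  fixes C :: "('o, 'm) cat" (structure)
  assumes Dom_Ob: "f \<in> Arr C \<Longrightarrow> Dom C f \<in> Ob C"
    and Cod_Ob: "f \<in> Arr C \<Longrightarrow> Cod C f \<in> Ob C"
    and Id_Arr: "c \<in> Ob C \<Longrightarrow> Id C c \<in> Arr C"
    and Id_Dom: "c \<in> Ob C \<Longrightarrow> Dom C (Id C c) = c"
    and Id_Cod: "c \<in> Ob C \<Longrightarrow> Cod C (Id C c) = c"
    and Comp_Arr: "\<lbrakk>f \<in> Arr C; g \<in> Arr C; Dom C f = Cod C g\<rbrakk> \<Longrightarrow> f \<cdot> g \<in> Arr C"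
    and Comp_Dom: "\<lbrakk>f \<in> Arr C; g \<in> Arr C; Dom C f = Cod C g\<rbrakk> \<Longrightarrow> Dom C (f \<cdot> g) = Dom C g"
    and Comp_Cod: "\<lbrakk>f \<in> Arr C; g \<in> Arr C; Dom C f = Cod C g\<rbrakk> \<Longrightarrow> Cod C (f \<cdot> g) = Cod C f"
    and Id_left: "f \<in> Arr C \<Longrightarrow> Id C (Cod C f) \<cdot> f = f"
    and Id_right: "f \<in> Arr C \<Longrightarrow> f \<cdot> Id C (Dom C f) = f"
    and Comp_assoc: "\<lbrakk>f \<in> Arr C; g \<in> Arr C; h \<in> Arr C; Dom C f = Cod C g; Dom C g = Cod C h\<rbrakk>
      \<Longrightarrow> (f \<cdot> g) \<cdot> h = f \<cdot> (g \<cdot> h)"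

definition sieve :: "('o, 'm) cat \<Rightarrow> 'o \<Rightarrow> 'm set \<Rightarrow> bool" where
  "sieve C c S \<longleftrightarrow>
     S \<subseteq> into C c \<and> (\<forall>f\<in>S. \<forall>g\<in>into C (Dom C f). f \<cdot>\<^bsub>C\<^esub> g \<in> S)"

definition pull_sieve :: "('o, 'm) cat \<Rightarrow> 'm set \<Rightarrow> 'm \<Rightarrow> 'm set" where
  "pull_sieve C S f = {g \<in> into C (Dom C f). f \<cdot>\<^bsub>C\<^esub> g \<in> S}"

locale grothendieck_site = small_category C for C :: "('o, 'm) cat" (structure) +
  fixes J :: "'o \<Rightarrow> 'm set set"
  assumes cover_sieve: "\<lbrakk>c \<in> Ob C; S \<in> J c\<rbrakk> \<Longrightarrow> sieve C c S"
    and cover_maximal: "c \<in> Ob C \<Longrightarrow> into C c \<in> J c"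
    and cover_stable: "\<lbrakk>f \<in> Arr C; S \<in> J (Cod C f)\<rbrakk> \<Longrightarrow> pull_sieve C S f \<in> J (Dom C f)"
    and cover_transitive: "\<lbrakk>c \<in> Ob C; S \<in> J c; sieve C c T;
      \<And>f. f \<in> S \<Longrightarrow> pull_sieve C T f \<in> J (Dom C f)\<rbrakk> \<Longrightarrow> T \<in> J c"

record ('o, 'm, 'a) psh =
  Sec :: "'o \<Rightarrow> 'a set"
  Res :: "'m \<Rightarrow> 'a \<Rightarrow> 'a"

locale presheaf = small_category C for C :: "('o, 'm) cat" (structure) +
  fixes F :: "('o, 'm, 'a) psh"
  assumes Res_closed: "\<lbrakk>f \<in> Arr C; x \<in> Sec F (Cod C f)\<rbrakk> \<Longrightarrow> Res F f x \<in> Sec F (Dom C f)"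
    and Res_Id: "\<lbrakk>c \<in> Ob C; x \<in> Sec F c\<rbrakk> \<Longrightarrow> Res F (Id C c) x = x"
    and Res_Comp: "\<lbrakk>f \<in> Arr C; g \<in> Arr C; Dom C f = Cod C g; x \<in> Sec F (Cod C f)\<rbrakk>
      \<Longrightarrow> Res F (f \<cdot> g) x = Res F g (Res F f x)"

locale sheaf = grothendieck_site C J + presheaf C F
  for C :: "('o, 'm) cat" (structure) and J :: "'o \<Rightarrow> 'm set set" and F :: "('o, 'm, 'a) psh" +
  assumes glue: "\<lbrakk>c \<in> Ob C; S \<in> J c; \<And>f. f \<in> S \<Longrightarrow> s f \<in> Sec F (Dom C f);
      \<And>f g. \<lbrakk>f \<in> S; g \<in> into C (Dom C f)\<rbrakk> \<Longrightarrow> s (f \<cdot> g) = Res F g (s f)\<rbrakk>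
      \<Longrightarrow> \<exists>!x. x \<in> Sec F c \<and> (\<forall>f\<in>S. Res F f x = s f)"

section \<open>Internal function spaces\<close>

text \<open>
  A set \<open>A\<close> in the internal language at stage \<open>c\<close> is a presheaf on the
  slice over \<open>c\<close>: \<open>El A f\<close> is its set of elements at \<open>f \<in> into C c\<close>, and
  \<open>Rs A g\<close> takes \<open>El A f\<close> to \<open>El A (f \<cdot> g)\<close>.
\<close>

record ('m, 'a) vset =
  El :: "'m \<Rightarrow> 'a set"
  Rs :: "'m \<Rightarrow> 'a \<Rightarrow> 'a"

definition loc :: "('o, 'm) cat \<Rightarrow> ('o, 'm, 'a) psh \<Rightarrow> ('m, 'a) vset" where
  "loc C F = \<lparr>El = (\<lambda>f. Sec F (Dom C f)), Rs = Res F\<rparr>"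

definition pullback :: "('o, 'm) cat \<Rightarrow> ('m, 'a) vset \<Rightarrow> 'm \<Rightarrow> ('m, 'a) vset" where
  "pullback C A f = \<lparr>El = (\<lambda>g. El A (f \<cdot>\<^bsub>C\<^esub> g)), Rs = Rs A\<rparr>"

text \<open>
  The elements at stage \<open>c\<close> of the function space from \<open>A\<close> to \<open>B\<close>: natural
  families of functions indexed by the arrows into \<open>c\<close>.
\<close>

definition maps :: "('o, 'm) cat \<Rightarrow> 'o \<Rightarrow> ('m, 'a) vset \<Rightarrow> ('m, 'b) vset \<Rightarrow> ('m \<Rightarrow> 'a \<Rightarrow> 'b) set"
  where
  "maps C c A B =
     {\<phi> \<in> (\<Pi>\<^sub>E f\<in>into C c. El A f \<rightarrow>\<^sub>E El B f).
        \<forall>f\<in>into C c. \<forall>g\<in>into C (Dom C f). \<forall>x\<in>El A f.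
          Rs B g (\<phi> f x) = \<phi> (f \<cdot>\<^bsub>C\<^esub> g) (Rs A g x)}"

definition maps_res :: "('o, 'm) cat \<Rightarrow> 'm \<Rightarrow> ('m \<Rightarrow> 'a) \<Rightarrow> 'm \<Rightarrow> 'a" where
  "maps_res C f \<phi> = (\<lambda>g\<in>into C (Dom C f). \<phi> (f \<cdot>\<^bsub>C\<^esub> g))"

definition maps_comp ::
  "('o, 'm) cat \<Rightarrow> 'o \<Rightarrow> ('m, 'a) vset \<Rightarrow> ('m \<Rightarrow> 'b \<Rightarrow> 'd) \<Rightarrow> ('m \<Rightarrow> 'a \<Rightarrow> 'b) \<Rightarrow> 'm \<Rightarrow> 'a \<Rightarrow> 'd"
  where
  "maps_comp C c A \<psi> \<phi> = (\<lambda>f\<in>into C c. \<lambda>x\<in>El A f. \<psi> f (\<phi> f x))"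

definition exp_psh ::
  "('o, 'm) cat \<Rightarrow> ('o, 'm, 'a) psh \<Rightarrow> ('o, 'm, 'b) psh \<Rightarrow> ('o, 'm, 'm \<Rightarrow> 'a \<Rightarrow> 'b) psh" where
  "exp_psh C F H = \<lparr>Sec = (\<lambda>c. maps C c (loc C F) (loc C H)), Res = maps_res C\<rparr>"

section \<open>The ring of the line and the Kock-Lawvere axiom\<close>

record ('o, 'm, 'r) rng_psh =
  Rng :: "'o \<Rightarrow> 'r ring"
  RRes :: "'m \<Rightarrow> 'r \<Rightarrow> 'r"

definition line :: "('o, 'm, 'r) rng_psh \<Rightarrow> ('o, 'm, 'r) psh" where
  "line R = \<lparr>Sec = (\<lambda>c. carrier (Rng R c)), Res = RRes R\<rparr>"

locale cring_sheaf = sheaf C J "line R"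
  for C :: "('o, 'm) cat" (structure) and J :: "'o \<Rightarrow> 'm set set"
    and R :: "('o, 'm, 'r) rng_psh" +
  assumes cring_Rng: "c \<in> Ob C \<Longrightarrow> cring (Rng R c)"
    and RRes_hom: "f \<in> Arr C \<Longrightarrow> RRes R f \<in> ring_hom (Rng R (Cod C f)) (Rng R (Dom C f))"

text \<open>
  A Weil algebra over \<open>K\<close> is a commutative \<open>K\<close>-algebra structure on some \<open>K\<^sup>n\<^sup>+\<^sup>1\<close>
  with unit \<open>(1, 0, \<dots>, 0)\<close> in which the vectors with vanishing zeroth coordinate form
  a nilpotent ideal.
\<close>

definition aug_ideal :: "('r, 'x) ring_scheme \<Rightarrow> ('r, nat \<Rightarrow> 'r) module \<Rightarrow> (nat \<Rightarrow> 'r) set" where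
  "aug_ideal K W = {w \<in> carrier W. w 0 = \<zero>\<^bsub>K\<^esub>}"

definition weil_algebra :: "('r, 'x) ring_scheme \<Rightarrow> ('r, nat \<Rightarrow> 'r) module \<Rightarrow> bool" where
  "weil_algebra K W \<longleftrightarrow> algebra K W \<and>
     (\<exists>n::nat. carrier W = ({..n} \<rightarrow>\<^sub>E carrier K) \<and>
        (\<forall>v\<in>carrier W. \<forall>w\<in>carrier W. v \<oplus>\<^bsub>W\<^esub> w = (\<lambda>i\<in>{..n}. v i \<oplus>\<^bsub>K\<^esub> w i)) \<and>
        (\<forall>a\<in>carrier K. \<forall>w\<in>carrier W. a \<odot>\<^bsub>W\<^esub> w = (\<lambda>i\<in>{..n}. a \<otimes>\<^bsub>K\<^esub> w i)) \<and>
        \<one>\<^bsub>W\<^esub> = (\<lambda>i\<in>{..n}. if i = 0 then \<one>\<^bsub>K\<^esub> else \<zero>\<^bsub>K\<^esub>)) \<and>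
     ideal (aug_ideal K W) W \<and>
     (\<exists>k::nat. \<forall>ws. length ws = k \<and> set ws \<subseteq> aug_ideal K W
        \<longrightarrow> foldr (\<lambda>v w. v \<otimes>\<^bsub>W\<^esub> w) ws \<one>\<^bsub>W\<^esub> = \<zero>\<^bsub>W\<^esub>)"

text \<open>
  For a Weil algebra \<open>W\<close> given at stage \<open>c\<close>, the elements of \<open>D(W)\<close> at
  \<open>f : d \<rightarrow> c\<close> are the algebra homomorphisms to \<open>R(d)\<close> from the base change of \<open>W\<close>
  along \<open>R(c) \<rightarrow> R(d)\<close>, that is, the \<open>R(c)\<close>-algebra homomorphisms from \<open>W\<close> to \<open>R(d)\<close>.
\<close>

definition Spec ::
  "('o, 'm) cat \<Rightarrow> ('o, 'm, 'r) rng_psh \<Rightarrow> 'o \<Rightarrow> ('r, nat \<Rightarrow> 'r) module \<Rightarrow> ('m, (nat \<Rightarrow> 'r) \<Rightarrow> 'r) vset"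
  where
  "Spec C R c W =
     \<lparr>El = (\<lambda>f. {h \<in> ring_hom W (Rng R (Dom C f)) \<inter> extensional (carrier W).
        \<forall>a\<in>carrier (Rng R c). \<forall>w\<in>carrier W.
          h (a \<odot>\<^bsub>W\<^esub> w) = RRes R f a \<otimes>\<^bsub>Rng R (Dom C f)\<^esub> h w}),
      Rs = (\<lambda>g h. \<lambda>w\<in>carrier W. RRes R g (h w))\<rparr>"

text \<open>
  Since the base changes of a Weil algebra are again Weil algebras, bijectivity of the
  canonical map at each stage \<open>c\<close>, for all Weil algebras given at \<open>c\<close>, says that it is an
  isomorphism internally.
\<close>

definition kock_lawvere :: "('o, 'm) cat \<Rightarrow> ('o, 'm, 'r) rng_psh \<Rightarrow> bool" where
  "kock_lawvere C R \<longleftrightarrow>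
     (\<forall>c\<in>Ob C. \<forall>W. weil_algebra (Rng R c) W \<longrightarrow>
        bij_betw (\<lambda>w. \<lambda>f\<in>into C c. \<lambda>h\<in>El (Spec C R c W) f. h w)
          (carrier W) (maps C c (Spec C R c W) (loc C (line R))))"

section \<open>Microlinearity\<close>

text \<open>
  A finite diagram at stage \<open>c\<close> has vertices \<open>A i\<close> for \<open>i < m\<close> and a finite set \<open>E\<close> of
  edges \<open>(i, j, \<phi>)\<close> with \<open>\<phi> : A i \<rightarrow> A j\<close>; \<open>p i : A i \<rightarrow> V\<close> are the legs of a cocone.
\<close>

definition cocone ::
  "('o, 'm) cat \<Rightarrow> 'o \<Rightarrow> nat \<Rightarrow> (nat \<Rightarrow> ('m, 'a) vset) \<Rightarrow> (nat \<times> nat \<times> ('m \<Rightarrow> 'a \<Rightarrow> 'a)) set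
    \<Rightarrow> ('m, 'a) vset \<Rightarrow> (nat \<Rightarrow> 'm \<Rightarrow> 'a \<Rightarrow> 'a) \<Rightarrow> bool" where
  "cocone C c m A E V p \<longleftrightarrow>
     finite E \<and>
     (\<forall>(i, j, \<phi>)\<in>E. i < m \<and> j < m \<and> \<phi> \<in> maps C c (A i) (A j)) \<and>
     (\<forall>i<m. p i \<in> maps C c (A i) V) \<and>
     (\<forall>(i, j, \<phi>)\<in>E. maps_comp C c (A i) (p j) \<phi> = p i)"

definition exp_is_limit ::
  "('o, 'm) cat \<Rightarrow> ('o, 'm, 'n) psh \<Rightarrow> 'o \<Rightarrow> nat \<Rightarrow> (nat \<Rightarrow> ('m, 'a) vset)
    \<Rightarrow> (nat \<times> nat \<times> ('m \<Rightarrow> 'a \<Rightarrow> 'a)) set \<Rightarrow> ('m, 'a) vset \<Rightarrow> (nat \<Rightarrow> 'm \<Rightarrow> 'a \<Rightarrow> 'a) \<Rightarrow> bool" where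
  "exp_is_limit C N c m A E V p \<longleftrightarrow>
     (\<forall>f\<in>into C c. \<forall>\<psi>.
        (\<forall>i<m. \<psi> i \<in> maps C (Dom C f) (pullback C (A i) f) (loc C N)) \<and>
        (\<forall>(i, j, \<phi>)\<in>E.
           maps_comp C (Dom C f) (pullback C (A i) f) (\<psi> j) (maps_res C f \<phi>) = \<psi> i)
        \<longrightarrow> (\<exists>!\<chi>. \<chi> \<in> maps C (Dom C f) (pullback C V f) (loc C N) \<and>
              (\<forall>i<m. maps_comp C (Dom C f) (pullback C (A i) f) \<chi> (maps_res C f (p i)) = \<psi> i)))"

definition microlinear :: "('o, 'm) cat \<Rightarrow> ('o, 'm, 'r) rng_psh \<Rightarrow> ('o, 'm, 'n) psh \<Rightarrow> bool" where
  "microlinear C R N \<longleftrightarrow>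
     (\<forall>c\<in>Ob C. \<forall>m W E V p.
        (\<forall>i<m. weil_algebra (Rng R c) (W i)) \<and> weil_algebra (Rng R c) V \<and>
        cocone C c m (\<lambda>i. Spec C R c (W i)) E (Spec C R c V) p \<and>
        exp_is_limit C (line R) c m (\<lambda>i. Spec C R c (W i)) E (Spec C R c V) p
        \<longrightarrow> exp_is_limit C N c m (\<lambda>i. Spec C R c (W i)) E (Spec C R c V) p)"

section \<open>Groupoids and bisections\<close>

record ('o, 'm, 'x, 'g) gpd =
  Base :: "('o, 'm, 'x) psh"
  Tot :: "('o, 'm, 'g) psh"
  gid :: "'o \<Rightarrow> 'x \<Rightarrow> 'g"
  gsrc :: "'o \<Rightarrow> 'g \<Rightarrow> 'x"
  gtgt :: "'o \<Rightarrow> 'g \<Rightarrow> 'x"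
  gmul :: "'o \<Rightarrow> 'g \<Rightarrow> 'g \<Rightarrow> 'g"

locale groupoid_sheaf = base: sheaf C J "Base G" + tot: sheaf C J "Tot G"
  for C :: "('o, 'm) cat" (structure) and J :: "'o \<Rightarrow> 'm set set"
    and G :: "('o, 'm, 'x, 'g) gpd" +
  assumes gid_closed: "\<lbrakk>c \<in> Ob C; x \<in> Sec (Base G) c\<rbrakk> \<Longrightarrow> gid G c x \<in> Sec (Tot G) c"
    and gsrc_closed: "\<lbrakk>c \<in> Ob C; g \<in> Sec (Tot G) c\<rbrakk> \<Longrightarrow> gsrc G c g \<in> Sec (Base G) c"
    and gtgt_closed: "\<lbrakk>c \<in> Ob C; g \<in> Sec (Tot G) c\<rbrakk> \<Longrightarrow> gtgt G c g \<in> Sec (Base G) c"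
    and gmul_closed: "\<lbrakk>c \<in> Ob C; g \<in> Sec (Tot G) c; h \<in> Sec (Tot G) c; gsrc G c g = gtgt G c h\<rbrakk>
      \<Longrightarrow> gmul G c g h \<in> Sec (Tot G) c"
    and gid_natural: "\<lbrakk>f \<in> Arr C; x \<in> Sec (Base G) (Cod C f)\<rbrakk>
      \<Longrightarrow> Res (Tot G) f (gid G (Cod C f) x) = gid G (Dom C f) (Res (Base G) f x)"
    and gsrc_natural: "\<lbrakk>f \<in> Arr C; g \<in> Sec (Tot G) (Cod C f)\<rbrakk>
      \<Longrightarrow> Res (Base G) f (gsrc G (Cod C f) g) = gsrc G (Dom C f) (Res (Tot G) f g)"
    and gtgt_natural: "\<lbrakk>f \<in> Arr C; g \<in> Sec (Tot G) (Cod C f)\<rbrakk>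
      \<Longrightarrow> Res (Base G) f (gtgt G (Cod C f) g) = gtgt G (Dom C f) (Res (Tot G) f g)"
    and gmul_natural: "\<lbrakk>f \<in> Arr C; g \<in> Sec (Tot G) (Cod C f); h \<in> Sec (Tot G) (Cod C f);
        gsrc G (Cod C f) g = gtgt G (Cod C f) h\<rbrakk>
      \<Longrightarrow> Res (Tot G) f (gmul G (Cod C f) g h)
          = gmul G (Dom C f) (Res (Tot G) f g) (Res (Tot G) f h)"
    and gsrc_gid: "\<lbrakk>c \<in> Ob C; x \<in> Sec (Base G) c\<rbrakk> \<Longrightarrow> gsrc G c (gid G c x) = x"
    and gtgt_gid: "\<lbrakk>c \<in> Ob C; x \<in> Sec (Base G) c\<rbrakk> \<Longrightarrow> gtgt G c (gid G c x) = x"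
    and gsrc_gmul: "\<lbrakk>c \<in> Ob C; g \<in> Sec (Tot G) c; h \<in> Sec (Tot G) c; gsrc G c g = gtgt G c h\<rbrakk>
      \<Longrightarrow> gsrc G c (gmul G c g h) = gsrc G c h"
    and gtgt_gmul: "\<lbrakk>c \<in> Ob C; g \<in> Sec (Tot G) c; h \<in> Sec (Tot G) c; gsrc G c g = gtgt G c h\<rbrakk>
      \<Longrightarrow> gtgt G c (gmul G c g h) = gtgt G c g"
    and gmul_assoc: "\<lbrakk>c \<in> Ob C; g \<in> Sec (Tot G) c; h \<in> Sec (Tot G) c; k \<in> Sec (Tot G) c;
        gsrc G c g = gtgt G c h; gsrc G c h = gtgt G c k\<rbrakk>
      \<Longrightarrow> gmul G c (gmul G c g h) k = gmul G c g (gmul G c h k)"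
    and gmul_gid_left: "\<lbrakk>c \<in> Ob C; g \<in> Sec (Tot G) c\<rbrakk>
      \<Longrightarrow> gmul G c (gid G c (gtgt G c g)) g = g"
    and gmul_gid_right: "\<lbrakk>c \<in> Ob C; g \<in> Sec (Tot G) c\<rbrakk>
      \<Longrightarrow> gmul G c g (gid G c (gsrc G c g)) = g"
    and ginv: "\<lbrakk>c \<in> Ob C; g \<in> Sec (Tot G) c\<rbrakk>
      \<Longrightarrow> \<exists>h\<in>Sec (Tot G) c. gsrc G c h = gtgt G c g \<and> gtgt G c h = gsrc G c g \<and>
            gmul G c h g = gid G c (gsrc G c g) \<and> gmul G c g h = gid G c (gtgt G c g)"

definition Sect ::
  "('o, 'm) cat \<Rightarrow> ('o, 'm, 'x, 'g) gpd \<Rightarrow> ('o, 'm, 'm \<Rightarrow> 'x \<Rightarrow> 'g) psh" where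
  "Sect C G =
     \<lparr>Sec = (\<lambda>c. {\<sigma> \<in> Sec (exp_psh C (Base G) (Tot G)) c.
        \<forall>f\<in>into C c. \<forall>x\<in>Sec (Base G) (Dom C f). gsrc G (Dom C f) (\<sigma> f x) = x}),
      Res = maps_res C\<rparr>"

definition Bisect ::
  "('o, 'm) cat \<Rightarrow> ('o, 'm, 'x, 'g) gpd \<Rightarrow> ('o, 'm, 'm \<Rightarrow> 'x \<Rightarrow> 'g) psh" where
  "Bisect C G =
     \<lparr>Sec = (\<lambda>c. {\<sigma> \<in> Sec (Sect C G) c.
        \<forall>f\<in>into C c. bij_betw (\<lambda>x. gtgt G (Dom C f) (\<sigma> f x))
          (Sec (Base G) (Dom C f)) (Sec (Base G) (Dom C f))}),
      Res = maps_res C\<rparr>"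

definition sect_unit :: "('o, 'm) cat \<Rightarrow> ('o, 'm, 'x, 'g) gpd \<Rightarrow> 'o \<Rightarrow> 'm \<Rightarrow> 'x \<Rightarrow> 'g" where
  "sect_unit C G c = (\<lambda>f\<in>into C c. \<lambda>x\<in>Sec (Base G) (Dom C f). gid G (Dom C f) x)"

definition sect_mult ::
  "('o, 'm) cat \<Rightarrow> ('o, 'm, 'x, 'g) gpd \<Rightarrow> 'o \<Rightarrow> ('m \<Rightarrow> 'x \<Rightarrow> 'g) \<Rightarrow> ('m \<Rightarrow> 'x \<Rightarrow> 'g) \<Rightarrow> 'm \<Rightarrow> 'x \<Rightarrow> 'g"
  where
  "sect_mult C G c \<sigma> \<rho> =
     (\<lambda>f\<in>into C c. \<lambda>x\<in>Sec (Base G) (Dom C f).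
        gmul G (Dom C f) (\<sigma> f (gtgt G (Dom C f) (\<rho> f x))) (\<rho> f x))"

section \<open>The Lie algebroid and its sections\<close>

definition inf_D :: "('o, 'm, 'r) rng_psh \<Rightarrow> ('o, 'm, 'r) psh" where
  "inf_D R =
     \<lparr>Sec = (\<lambda>c. {d \<in> carrier (Rng R c). d \<otimes>\<^bsub>Rng R c\<^esub> d = \<zero>\<^bsub>Rng R c\<^esub>}), Res = RRes R\<rparr>"

definition inf_D2 :: "('o, 'm, 'r) rng_psh \<Rightarrow> ('o, 'm, 'r \<times> 'r) psh" where
  "inf_D2 R =
     \<lparr>Sec = (\<lambda>c. {(d, e). d \<in> Sec (inf_D R) c \<and> e \<in> Sec (inf_D R) c \<and>
        d \<otimes>\<^bsub>Rng R c\<^esub> e = \<zero>\<^bsub>Rng R c\<^esub>}),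
      Res = (\<lambda>f. map_prod (RRes R f) (RRes R f))\<rparr>"

definition AG_at ::
  "('o, 'm) cat \<Rightarrow> ('o, 'm, 'r) rng_psh \<Rightarrow> ('o, 'm, 'x, 'g) gpd \<Rightarrow> 'o \<Rightarrow> 'x \<Rightarrow> ('m \<Rightarrow> 'r \<Rightarrow> 'g) set"
  where
  "AG_at C R G c x =
     {t \<in> Sec (exp_psh C (inf_D R) (Tot G)) c.
        t (Id C c) \<zero>\<^bsub>Rng R c\<^esub> = gid G c x \<and>
        (\<forall>f\<in>into C c. \<forall>d\<in>Sec (inf_D R) (Dom C f).
           gsrc G (Dom C f) (t f d) = Res (Base G) f x)}"

definition AG ::
  "('o, 'm) cat \<Rightarrow> ('o, 'm, 'r) rng_psh \<Rightarrow> ('o, 'm, 'x, 'g) gpd \<Rightarrow> ('o, 'm, 'm \<Rightarrow> 'r \<Rightarrow> 'g) psh" where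
  "AG C R G =
     \<lparr>Sec = (\<lambda>c. \<Union>x\<in>Sec (Base G) c. AG_at C R G c x), Res = maps_res C\<rparr>"

definition GammaAG ::
  "('o, 'm) cat \<Rightarrow> ('o, 'm, 'r) rng_psh \<Rightarrow> ('o, 'm, 'x, 'g) gpd
    \<Rightarrow> ('o, 'm, 'm \<Rightarrow> 'x \<Rightarrow> 'm \<Rightarrow> 'r \<Rightarrow> 'g) psh" where
  "GammaAG C R G =
     \<lparr>Sec = (\<lambda>c. {X \<in> Sec (exp_psh C (Base G) (AG C R G)) c.
        \<forall>f\<in>into C c. \<forall>x\<in>Sec (Base G) (Dom C f). X f x \<in> AG_at C R G (Dom C f) x}),
      Res = maps_res C\<rparr>"

text \<open>\<open>flow C R G c X d\<close> is \<open>X\<^sub>d\<close>, for \<open>X\<close> and \<open>d \<in> D\<close> given at stage \<open>c\<close>.\<close>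

definition flow ::
  "('o, 'm) cat \<Rightarrow> ('o, 'm, 'r) rng_psh \<Rightarrow> ('o, 'm, 'x, 'g) gpd \<Rightarrow> 'o
    \<Rightarrow> ('m \<Rightarrow> 'x \<Rightarrow> 'm \<Rightarrow> 'r \<Rightarrow> 'g) \<Rightarrow> 'r \<Rightarrow> 'm \<Rightarrow> 'x \<Rightarrow> 'g" where
  "flow C R G c X d =
     (\<lambda>f\<in>into C c. \<lambda>x\<in>Sec (Base G) (Dom C f). X f x (Id C (Dom C f)) (RRes R f d))"

text \<open>The identification of \<open>X\<close> with \<open>d \<mapsto> X\<^sub>d\<close>, and its inverse.\<close>

definition to_curve ::
  "('o, 'm) cat \<Rightarrow> ('o, 'm, 'r) rng_psh \<Rightarrow> ('o, 'm, 'x, 'g) gpd \<Rightarrow> 'o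
    \<Rightarrow> ('m \<Rightarrow> 'x \<Rightarrow> 'm \<Rightarrow> 'r \<Rightarrow> 'g) \<Rightarrow> 'm \<Rightarrow> 'r \<Rightarrow> 'm \<Rightarrow> 'x \<Rightarrow> 'g" where
  "to_curve C R G c X =
     (\<lambda>f\<in>into C c. \<lambda>d\<in>Sec (inf_D R) (Dom C f). flow C R G (Dom C f) (maps_res C f X) d)"

definition of_curve ::
  "('o, 'm) cat \<Rightarrow> ('o, 'm, 'r) rng_psh \<Rightarrow> ('o, 'm, 'x, 'g) gpd \<Rightarrow> 'o
    \<Rightarrow> ('m \<Rightarrow> 'r \<Rightarrow> 'm \<Rightarrow> 'x \<Rightarrow> 'g) \<Rightarrow> 'm \<Rightarrow> 'x \<Rightarrow> 'm \<Rightarrow> 'r \<Rightarrow> 'g" where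
  "of_curve C R G c \<tau> =
     (\<lambda>f\<in>into C c. \<lambda>x\<in>Sec (Base G) (Dom C f).
        \<lambda>g\<in>into C (Dom C f). \<lambda>d\<in>Sec (inf_D R) (Dom C g).
          \<tau> (f \<cdot>\<^bsub>C\<^esub> g) d (Id C (Dom C g)) (Res (Base G) g x))"

definition tangent_Bisect ::
  "('o, 'm) cat \<Rightarrow> ('o, 'm, 'r) rng_psh \<Rightarrow> ('o, 'm, 'x, 'g) gpd \<Rightarrow> 'o
    \<Rightarrow> ('m \<Rightarrow> 'r \<Rightarrow> 'm \<Rightarrow> 'x \<Rightarrow> 'g) set" where
  "tangent_Bisect C R G c =
     {\<tau> \<in> Sec (exp_psh C (inf_D R) (Bisect C G)) c.
        \<tau> (Id C c) \<zero>\<^bsub>Rng R c\<^esub> = sect_unit C G c}"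

definition is_plus_map ::
  "('o, 'm) cat \<Rightarrow> ('o, 'm, 'r) rng_psh \<Rightarrow> ('o, 'm, 'x, 'g) gpd \<Rightarrow> 'o
    \<Rightarrow> ('m \<Rightarrow> 'x \<Rightarrow> 'm \<Rightarrow> 'r \<Rightarrow> 'g) \<Rightarrow> ('m \<Rightarrow> 'x \<Rightarrow> 'm \<Rightarrow> 'r \<Rightarrow> 'g)
    \<Rightarrow> ('m \<Rightarrow> 'r \<times> 'r \<Rightarrow> 'm \<Rightarrow> 'x \<Rightarrow> 'g) \<Rightarrow> bool" where
  "is_plus_map C R G c X Y l \<longleftrightarrow>
     l \<in> Sec (exp_psh C (inf_D2 R) (Bisect C G)) c \<and>
     (\<forall>f\<in>into C c. \<forall>d\<in>Sec (inf_D R) (Dom C f).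
        l f (d, \<zero>\<^bsub>Rng R (Dom C f)\<^esub>) = flow C R G (Dom C f) (maps_res C f X) d \<and>
        l f (\<zero>\<^bsub>Rng R (Dom C f)\<^esub>, d) = flow C R G (Dom C f) (maps_res C f Y) d)"

text \<open>
  Note that \<open>(d, d) \<in> D(2)\<close> for \<open>d \<in> D\<close>.  The ring operations of the record type
  \<open>module\<close> play no role here and are left undefined.
\<close>

definition Gamma_module ::
  "('o, 'm) cat \<Rightarrow> ('o, 'm, 'r) rng_psh \<Rightarrow> ('o, 'm, 'x, 'g) gpd \<Rightarrow> 'o
    \<Rightarrow> ('r, 'm \<Rightarrow> 'x \<Rightarrow> 'm \<Rightarrow> 'r \<Rightarrow> 'g) module" where
  "Gamma_module C R G c =
     \<lparr>carrier = Sec (GammaAG C R G) c,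
      mult = undefined,
      one = undefined,
      zero = of_curve C R G c (\<lambda>f d. sect_unit C G (Dom C f)),
      add = (\<lambda>X Y. of_curve C R G c (\<lambda>f d. (THE l. is_plus_map C R G c X Y l) f (d, d))),
      smult = (\<lambda>a X. of_curve C R G c (\<lambda>f d.
        flow C R G (Dom C f) (maps_res C f X) (RRes R f a \<otimes>\<^bsub>Rng R (Dom C f)\<^esub> d)))\<rparr>"

definition is_bracket ::
  "('o, 'm) cat \<Rightarrow> ('o, 'm, 'r) rng_psh \<Rightarrow> ('o, 'm, 'x, 'g) gpd \<Rightarrow> 'o
    \<Rightarrow> ('m \<Rightarrow> 'x \<Rightarrow> 'm \<Rightarrow> 'r \<Rightarrow> 'g) \<Rightarrow> ('m \<Rightarrow> 'x \<Rightarrow> 'm \<Rightarrow> 'r \<Rightarrow> 'g)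
    \<Rightarrow> ('m \<Rightarrow> 'x \<Rightarrow> 'm \<Rightarrow> 'r \<Rightarrow> 'g) \<Rightarrow> bool" where
  "is_bracket C R G c X Y Z \<longleftrightarrow>
     Z \<in> Sec (GammaAG C R G) c \<and>
     (\<forall>f\<in>into C c. \<forall>d1\<in>Sec (inf_D R) (Dom C f). \<forall>d2\<in>Sec (inf_D R) (Dom C f).
        let e = Dom C f; K = Rng R e; mul = sect_mult C G e;
            X' = flow C R G e (maps_res C f X);
            Y' = flow C R G e (maps_res C f Y);
            Z' = flow C R G e (maps_res C f Z)
        in Z' (d1 \<otimes>\<^bsub>K\<^esub> d2)
           = mul (mul (mul (Y' (\<ominus>\<^bsub>K\<^esub> d2)) (X' (\<ominus>\<^bsub>K\<^esub> d1))) (Y' d2)) (X' d1))"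

definition bracket ::
  "('o, 'm) cat \<Rightarrow> ('o, 'm, 'r) rng_psh \<Rightarrow> ('o, 'm, 'x, 'g) gpd \<Rightarrow> 'o
    \<Rightarrow> ('m \<Rightarrow> 'x \<Rightarrow> 'm \<Rightarrow> 'r \<Rightarrow> 'g) \<Rightarrow> ('m \<Rightarrow> 'x \<Rightarrow> 'm \<Rightarrow> 'r \<Rightarrow> 'g)
    \<Rightarrow> 'm \<Rightarrow> 'x \<Rightarrow> 'm \<Rightarrow> 'r \<Rightarrow> 'g" where
  "bracket C R G c X Y = (THE Z. is_bracket C R G c X Y Z)"

section \<open>Lie algebras\<close>

locale lie_algebra = module K L
  for K :: "'r ring" and L :: "('r, 'v) module" +
  fixes br :: "'v \<Rightarrow> 'v \<Rightarrow> 'v"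
  assumes br_closed: "\<lbrakk>x \<in> carrier L; y \<in> carrier L\<rbrakk> \<Longrightarrow> br x y \<in> carrier L"
    and br_add_left: "\<lbrakk>x \<in> carrier L; y \<in> carrier L; z \<in> carrier L\<rbrakk>
      \<Longrightarrow> br (x \<oplus>\<^bsub>L\<^esub> y) z = br x z \<oplus>\<^bsub>L\<^esub> br y z"
    and br_add_right: "\<lbrakk>x \<in> carrier L; y \<in> carrier L; z \<in> carrier L\<rbrakk>
      \<Longrightarrow> br x (y \<oplus>\<^bsub>L\<^esub> z) = br x y \<oplus>\<^bsub>L\<^esub> br x z"
    and br_smult_left: "\<lbrakk>a \<in> carrier K; x \<in> carrier L; y \<in> carrier L\<rbrakk>
      \<Longrightarrow> br (a \<odot>\<^bsub>L\<^esub> x) y = a \<odot>\<^bsub>L\<^esub> br x y"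
    and br_smult_right: "\<lbrakk>a \<in> carrier K; x \<in> carrier L; y \<in> carrier L\<rbrakk>
      \<Longrightarrow> br x (a \<odot>\<^bsub>L\<^esub> y) = a \<odot>\<^bsub>L\<^esub> br x y"
    and br_antisym: "\<lbrakk>x \<in> carrier L; y \<in> carrier L\<rbrakk> \<Longrightarrow> br x y = \<ominus>\<^bsub>L\<^esub> br y x"
    and jacobi: "\<lbrakk>x \<in> carrier L; y \<in> carrier L; z \<in> carrier L\<rbrakk>
      \<Longrightarrow> br x (br y z) \<oplus>\<^bsub>L\<^esub> br y (br z x) \<oplus>\<^bsub>L\<^esub> br z (br x y) = \<zero>\<^bsub>L\<^esub>"

text \<open>
  A Lie algebra over the ring object \<open>R\<close>: a Lie algebra at each stage, with operations
  natural in the stage.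
\<close>

definition internal_lie_algebra ::
  "('o, 'm) cat \<Rightarrow> ('o, 'm, 'r) rng_psh \<Rightarrow> ('o \<Rightarrow> ('r, 'v) module) \<Rightarrow> ('m \<Rightarrow> 'v \<Rightarrow> 'v)
    \<Rightarrow> ('o \<Rightarrow> 'v \<Rightarrow> 'v \<Rightarrow> 'v) \<Rightarrow> bool" where
  "internal_lie_algebra C R L res br \<longleftrightarrow>
     (\<forall>c\<in>Ob C. lie_algebra (Rng R c) (L c) (br c)) \<and>
     presheaf C \<lparr>Sec = (\<lambda>c. carrier (L c)), Res = res\<rparr> \<and>
     (\<forall>f\<in>Arr C. \<forall>x\<in>carrier (L (Cod C f)). \<forall>y\<in>carrier (L (Cod C f)).
        res f (x \<oplus>\<^bsub>L (Cod C f)\<^esub> y) = res f x \<oplus>\<^bsub>L (Dom C f)\<^esub> res f y \<and>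
        res f (br (Cod C f) x y) = br (Dom C f) (res f x) (res f y)) \<and>
     (\<forall>f\<in>Arr C. \<forall>a\<in>carrier (Rng R (Cod C f)). \<forall>x\<in>carrier (L (Cod C f)).
        res f (a \<odot>\<^bsub>L (Cod C f)\<^esub> x) = RRes R f a \<odot>\<^bsub>L (Dom C f)\<^esub> res f x)"

end

theory Submission
  imports Defs
begin

text \<open>
  At a stage \<open>e\<close>, the elements \<open>X\<^sub>d\<close> (\<open>X \<in> \<Gamma>(AG)\<close>, \<open>d \<in> D\<close>) live in the monoid of sections of \<open>G\<close>, and
  every identity to be shown is a computation in that monoid, based on two consequences of
  microlinearity, which pass pointwise from \<open>G\<close> and \<open>M\<close> to sections:
  \<^item> maps out of \<open>D(2)\<close> that agree on both axes are equal;
  \<^item> a map out of \<open>D \<times> D\<close> that is constant on the axes factors uniquely through the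
    multiplication \<open>D \<times> D \<rightarrow> D\<close>.

  The first gives \<open>(X + Y)\<^sub>d = X\<^sub>d * Y\<^sub>d\<close>, that \<open>X\<^sub>d\<close> is invertible with inverse \<open>X\<^sub>-\<^sub>d\<close>, and
  that \<open>X\<^sub>d\<close> and \<open>Y\<^sub>e\<close> commute if \<open>d e = 0\<close>.  The second gives the bracket, as the commutator
  \<open>[X, Y]\<^sub>d\<^sub>e\<close> of \<open>X\<^sub>d\<close> and \<open>Y\<^sub>e\<close>, and reduces its laws to commutator identities; the Jacobi
  identity is the Hall-Witt identity, in which all conjugations act trivially.
\<close>

section \<open>Weil algebras of first order infinitesimals\<close>

text \<open>Two gaps separate the hypotheses from these consequences: microlinearity speaks of
  spectra of Weil algebras rather than of infinitesimals, and it is given for G and M but not for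
  sections. The first is closed by replacing an algebra homomorphism by the pair (d, e) of its
  values on the generators. The Kock-Lawvere axiom then says that a function on D x D is a unique
  polynomial a + b d + c e + k d e. On D(2), where d e = 0, such a polynomial is determined by its
  restrictions to the axes; on D x D, constancy on the axes forces b = c = 0 and leaves a + k t at t
  = d e. The second is closed by evaluating at a point of the base. A factorization found at each
  point is natural in that point because it is unique, and it has the right source because maps from
  D into the microlinear base are equal once they agree at all products d e. Brackets of brackets
  require that already the products of three elements of D determine an element of \<Gamma>(AG);
  scaling by one of the three factors reduces this to products of two.\<close>

text \<open>
  The coordinates 0, 1, 2, 3 belong to the basis \<open>1, x, y, x y\<close> with \<open>x\<^sup>2 = y\<^sup>2 = 0\<close>.  No coordinate of
  a product involves later coordinates, so truncation makes sense, and \<open>n = 1, 2, 3\<close> give the Weil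
  algebras of \<open>D\<close>, \<open>D(2)\<close> and \<open>D \<times> D\<close>.
\<close>

definition truncated_weil :: "('r, 'x) ring_scheme \<Rightarrow> nat \<Rightarrow> ('r, nat \<Rightarrow> 'r) module" where
  "truncated_weil K n =
     \<lparr>carrier = {..n} \<rightarrow>\<^sub>E carrier K,
      monoid.mult = (\<lambda>v w. \<lambda>i\<in>{..n}.
        if i = 0 then v 0 \<otimes>\<^bsub>K\<^esub> w 0
        else if i = 3 then v 0 \<otimes>\<^bsub>K\<^esub> w 3 \<oplus>\<^bsub>K\<^esub> v 3 \<otimes>\<^bsub>K\<^esub> w 0 \<oplus>\<^bsub>K\<^esub> (v 1 \<otimes>\<^bsub>K\<^esub> w 2 \<oplus>\<^bsub>K\<^esub> v 2 \<otimes>\<^bsub>K\<^esub> w 1)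
        else v 0 \<otimes>\<^bsub>K\<^esub> w i \<oplus>\<^bsub>K\<^esub> v i \<otimes>\<^bsub>K\<^esub> w 0),
      one = (\<lambda>i\<in>{..n}. if i = 0 then \<one>\<^bsub>K\<^esub> else \<zero>\<^bsub>K\<^esub>),
      zero = (\<lambda>i\<in>{..n}. \<zero>\<^bsub>K\<^esub>),
      add = (\<lambda>v w. \<lambda>i\<in>{..n}. v i \<oplus>\<^bsub>K\<^esub> w i),
      smult = (\<lambda>a w. \<lambda>i\<in>{..n}. a \<otimes>\<^bsub>K\<^esub> w i)\<rparr>"

text \<open>An index \<open>j > n\<close> gives the zero vector. This is how truncation produces the
  relation x y = 0 of D(2) and the relation y = 0 of D.\<close>

definition weil_basis :: "('r, 'x) ring_scheme \<Rightarrow> nat \<Rightarrow> nat \<Rightarrow> nat \<Rightarrow> 'r" where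
  "weil_basis K n j = (\<lambda>i\<in>{..n}. if i = j then \<one>\<^bsub>K\<^esub> else \<zero>\<^bsub>K\<^esub>)"

lemma tw_carrier: "carrier (truncated_weil K n) = ({..n} \<rightarrow>\<^sub>E carrier K)"
  by (simp add: truncated_weil_def)

lemma tw_nth: "\<lbrakk>v \<in> carrier (truncated_weil K n); i \<le> n\<rbrakk> \<Longrightarrow> v i \<in> carrier K"
  by (auto simp: tw_carrier)

lemma tw_eqI:
  assumes "v \<in> carrier (truncated_weil K n)" "w \<in> carrier (truncated_weil K n)"
    and "\<And>i. i \<le> n \<Longrightarrow> v i = w i"
  shows "v = w"
  using assms unfolding tw_carrier by (auto intro: PiE_ext)

context cring
begin

abbreviation W where "W n \<equiv> truncated_weil R n"

lemma tw_mult: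
  "i \<le> n \<Longrightarrow> (v \<otimes>\<^bsub>W n\<^esub> w) i =
     (if i = 0 then v 0 \<otimes> w 0
      else if i = 3 then v 0 \<otimes> w 3 \<oplus> v 3 \<otimes> w 0 \<oplus> (v 1 \<otimes> w 2 \<oplus> v 2 \<otimes> w 1)
      else v 0 \<otimes> w i \<oplus> v i \<otimes> w 0)"
  by (simp add: truncated_weil_def)

lemma tw_add: "i \<le> n \<Longrightarrow> (v \<oplus>\<^bsub>W n\<^esub> w) i = v i \<oplus> w i"
  by (simp add: truncated_weil_def)

lemma tw_smult: "i \<le> n \<Longrightarrow> (a \<odot>\<^bsub>W n\<^esub> w) i = a \<otimes> w i"
  by (simp add: truncated_weil_def)

lemma tw_one: "i \<le> n \<Longrightarrow> \<one>\<^bsub>W n\<^esub> i = (if i = 0 then \<one> else \<zero>)"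
  by (simp add: truncated_weil_def)

lemma tw_zero: "i \<le> n \<Longrightarrow> \<zero>\<^bsub>W n\<^esub> i = \<zero>"
  by (simp add: truncated_weil_def)

lemma tw_basis: "i \<le> n \<Longrightarrow> weil_basis R n j i = (if i = j then \<one> else \<zero>)"
  by (simp add: weil_basis_def)

lemma tw_mult_closed:
  assumes "v \<in> carrier (W n)" "w \<in> carrier (W n)"
  shows "v \<otimes>\<^bsub>W n\<^esub> w \<in> carrier (W n)"
  using tw_nth[OF assms(1)] tw_nth[OF assms(2)]
  by (auto simp: truncated_weil_def intro!: a_closed m_closed)

lemma tw_add_closed:
  assumes "v \<in> carrier (W n)" "w \<in> carrier (W n)"
  shows "v \<oplus>\<^bsub>W n\<^esub> w \<in> carrier (W n)"
  using tw_nth[OF assms(1)] tw_nth[OF assms(2)] by (auto simp: truncated_weil_def)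

lemma tw_smult_closed:
  assumes "a \<in> carrier R" "w \<in> carrier (W n)"
  shows "a \<odot>\<^bsub>W n\<^esub> w \<in> carrier (W n)"
  using assms(1) tw_nth[OF assms(2)] by (auto simp: truncated_weil_def)

lemma tw_one_closed: "\<one>\<^bsub>W n\<^esub> \<in> carrier (W n)"
  and tw_zero_closed: "\<zero>\<^bsub>W n\<^esub> \<in> carrier (W n)"
  and tw_basis_closed: "weil_basis R n j \<in> carrier (W n)"
  by (auto simp: truncated_weil_def weil_basis_def)

lemmas tw_closed =
  tw_mult_closed tw_add_closed tw_smult_closed tw_one_closed tw_zero_closed tw_basis_closed

lemma tw_mult_assoc:
  assumes u: "u \<in> carrier (W n)" and v: "v \<in> carrier (W n)"
    and w: "w \<in> carrier (W n)"
  shows "(u \<otimes>\<^bsub>W n\<^esub> v) \<otimes>\<^bsub>W n\<^esub> w =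
    u \<otimes>\<^bsub>W n\<^esub> (v \<otimes>\<^bsub>W n\<^esub> w)"
proof (rule tw_eqI[of _ R n])
  fix i assume i: "i \<le> n"
  have c: "u j \<in> carrier R" "v j \<in> carrier R" "w j \<in> carrier R" if "j \<le> n" for j
    using tw_nth[OF u that] tw_nth[OF v that] tw_nth[OF w that] .
  note c0 = c[OF le0] and ci = c[OF i]
  show "(u \<otimes>\<^bsub>W n\<^esub> v \<otimes>\<^bsub>W n\<^esub> w) i =
      (u \<otimes>\<^bsub>W n\<^esub> (v \<otimes>\<^bsub>W n\<^esub> w)) i"
  \<comment> \<open>Only the x y coordinate mixes several others, and it exists only for
    \<open>n \<ge> 3\<close>, when all four coordinates are available. Every other coordinate
    involves just itself and coordinate 0.\<close>
  proof (cases "i = 3")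
    case True
    then have n: "1 \<le> n" "2 \<le> n" "3 \<le> n" using i by auto
    note c0 n c[OF n(1)] c[OF n(2)] c[OF n(3)]
    then show ?thesis
      by (simp add: True tw_mult l_distr r_distr a_ac m_ac)
  next
    case False
    with i c0 ci show ?thesis
      by (simp add: tw_mult l_distr r_distr a_ac m_ac)
  qed
qed (simp_all add: tw_closed u v w)

lemma cring_truncated_weil: "cring (W n)"
proof (rule cringI)
  show "abelian_group (W n)"
  proof (rule abelian_groupI)
    fix x assume x: "x \<in> carrier (W n)"
    have "(\<lambda>i\<in>{..n}. \<ominus> x i) \<in> carrier (W n)"
      using tw_nth[OF x] by (auto simp: truncated_weil_def)
    moreover have "(\<lambda>i\<in>{..n}. \<ominus> x i) \<oplus>\<^bsub>W n\<^esub> x = \<zero>\<^bsub>W n\<^esub>"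
      by (rule tw_eqI[of _ R n]) (use x calculation tw_nth[OF x] in
          \<open>simp_all add: tw_closed tw_zero_closed tw_add tw_zero l_neg\<close>)
    ultimately show "\<exists>y\<in>carrier (W n). y \<oplus>\<^bsub>W n\<^esub> x = \<zero>\<^bsub>W n\<^esub>"
      by blast
  next
    fix x y assume "x \<in> carrier (W n)" "y \<in> carrier (W n)"
    then show "x \<oplus>\<^bsub>W n\<^esub> y = y \<oplus>\<^bsub>W n\<^esub> x"
      by (intro tw_eqI[of _ R n]) (simp_all add: tw_closed tw_add tw_nth[of _ R n] a_comm)
  next
    fix x y z assume "x \<in> carrier (W n)" "y \<in> carrier (W n)"
      "z \<in> carrier (W n)"
    then show "x \<oplus>\<^bsub>W n\<^esub> y \<oplus>\<^bsub>W n\<^esub> z =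
        x \<oplus>\<^bsub>W n\<^esub> (y \<oplus>\<^bsub>W n\<^esub> z)"
      by (intro tw_eqI[of _ R n]) (simp_all add: tw_closed tw_add tw_nth[of _ R n] a_assoc)
  next
    fix x assume "x \<in> carrier (W n)"
    then show "\<zero>\<^bsub>W n\<^esub> \<oplus>\<^bsub>W n\<^esub> x = x"
      by (intro tw_eqI[of _ R n])
        (simp_all add: tw_closed tw_zero_closed tw_add tw_zero tw_nth[of _ R n])
  qed (simp_all add: tw_closed tw_zero_closed)
  show "Group.comm_monoid (W n)"
  proof (rule comm_monoidI)
    fix x y assume xy: "x \<in> carrier (W n)" "y \<in> carrier (W n)"
    show "x \<otimes>\<^bsub>W n\<^esub> y = y \<otimes>\<^bsub>W n\<^esub> x"
      by (rule tw_eqI[of _ R n])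
        (use xy in \<open>simp_all add: tw_closed tw_mult tw_nth[of _ R n] a_ac m_ac\<close>)
  next
    fix x assume "x \<in> carrier (W n)"
    then show "\<one>\<^bsub>W n\<^esub> \<otimes>\<^bsub>W n\<^esub> x = x"
      by (intro tw_eqI[of _ R n])
        (simp_all add: tw_closed tw_one_closed tw_mult tw_one tw_nth[of _ R n])
  qed (simp_all add: tw_closed tw_one_closed tw_mult_assoc)
  fix x y z assume xyz: "x \<in> carrier (W n)" "y \<in> carrier (W n)"
    "z \<in> carrier (W n)"
  show "(x \<oplus>\<^bsub>W n\<^esub> y) \<otimes>\<^bsub>W n\<^esub> z =
    x \<otimes>\<^bsub>W n\<^esub> z \<oplus>\<^bsub>W n\<^esub> y \<otimes>\<^bsub>W n\<^esub> z"
    by (rule tw_eqI[of _ R n]) (use xyz in \<open>auto simp: tw_closed tw_mult tw_add tw_nth l_distr a_ac\<close>)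
qed

lemma algebra_truncated_weil: "algebra R (W n)"
proof (rule algebraI[OF is_cring cring_truncated_weil])
  fix a b x y
  assume ab: "a \<in> carrier R" "b \<in> carrier R"
    and xy: "x \<in> carrier (W n)" "y \<in> carrier (W n)"
  show "(a \<oplus> b) \<odot>\<^bsub>W n\<^esub> x =
      a \<odot>\<^bsub>W n\<^esub> x \<oplus>\<^bsub>W n\<^esub> b \<odot>\<^bsub>W n\<^esub> x"
    by (rule tw_eqI[of _ R n])
      (use ab xy in \<open>simp_all add: tw_closed tw_add tw_smult tw_nth[of _ R n] l_distr\<close>)
  show "a \<odot>\<^bsub>W n\<^esub> (x \<oplus>\<^bsub>W n\<^esub> y) =
      a \<odot>\<^bsub>W n\<^esub> x \<oplus>\<^bsub>W n\<^esub> a \<odot>\<^bsub>W n\<^esub> y"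
    by (rule tw_eqI[of _ R n])
      (use ab xy in \<open>simp_all add: tw_closed tw_add tw_smult tw_nth[of _ R n] r_distr\<close>)
  show "(a \<otimes> b) \<odot>\<^bsub>W n\<^esub> x =
      a \<odot>\<^bsub>W n\<^esub> (b \<odot>\<^bsub>W n\<^esub> x)"
    by (rule tw_eqI[of _ R n])
      (use ab xy in \<open>simp_all add: tw_closed tw_smult tw_nth[of _ R n] m_assoc\<close>)
  show "(a \<odot>\<^bsub>W n\<^esub> x) \<otimes>\<^bsub>W n\<^esub> y =
      a \<odot>\<^bsub>W n\<^esub> (x \<otimes>\<^bsub>W n\<^esub> y)"
    by (rule tw_eqI[of _ R n])
      (use ab xy in \<open>simp_all add: tw_closed tw_mult tw_smult tw_nth[of _ R n] r_distr m_ac\<close>)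
next
  fix x assume xy: "x \<in> carrier (W n)"
  show "\<one> \<odot>\<^bsub>W n\<^esub> x = x"
    by (rule tw_eqI[of _ R n])
      (use xy in \<open>simp_all add: tw_closed tw_smult tw_nth[of _ R n]\<close>)
qed (simp add: tw_closed)

lemma weil_algebra_truncated_weil: "weil_algebra R (W n)"
proof -
  interpret W: cring "W n" by (rule cring_truncated_weil)
  let ?W = "W n" and ?I = "aug_ideal R (W n)"
  have IW: "v \<in> carrier ?W" "v 0 = \<zero>" if "v \<in> ?I" for v
    using that by (auto simp: aug_ideal_def)
  have ideal: "ideal ?I ?W"
  proof (rule idealI)
    show "ring ?W" by (rule W.ring_axioms)
    show "subgroup ?I (add_monoid ?W)"
    proof (rule W.add.subgroupI)
      show "?I \<subseteq> carrier ?W" by (auto simp: aug_ideal_def)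
      have "\<zero>\<^bsub>?W\<^esub> \<in> ?I" by (simp add: aug_ideal_def tw_zero)
      then show "?I \<noteq> {}" by blast
    next
      fix v assume v: "v \<in> ?I"
      have "(\<ominus>\<^bsub>?W\<^esub> v) 0 \<oplus> v 0 = \<zero>"
        unfolding tw_add[OF le0, symmetric, of _ v n] W.l_neg[OF IW(1)[OF v]] by (rule tw_zero[OF le0])
      moreover have "(\<ominus>\<^bsub>?W\<^esub> v) 0 \<in> carrier R"
        by (rule tw_nth[OF W.a_inv_closed[OF IW(1)[OF v]] le0])
      ultimately show "\<ominus>\<^bsub>?W\<^esub> v \<in> ?I"
        using IW[OF v] by (simp add: aug_ideal_def)
    next
      fix v w assume "v \<in> ?I" "w \<in> ?I"
      note v = IW[OF this(1)] and w = IW[OF this(2)]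
      show "v \<oplus>\<^bsub>?W\<^esub> w \<in> ?I"
        using tw_add_closed[OF v(1) w(1)] by (simp add: aug_ideal_def tw_add v w)
    qed
  next
    fix v x assume "v \<in> ?I" and x: "x \<in> carrier ?W"
    note v = IW[OF this(1)] and x0 = tw_nth[OF x le0]
    show "x \<otimes>\<^bsub>?W\<^esub> v \<in> ?I"
      using tw_mult_closed[OF x v(1)] by (simp add: aug_ideal_def tw_mult v x0)
    show "v \<otimes>\<^bsub>?W\<^esub> x \<in> ?I"
      using tw_mult_closed[OF v(1) x] by (simp add: aug_ideal_def tw_mult v x0)
  qed
  \<comment> \<open>Three factors suffice: a product of two elements of the ideal has at most an x y
    component, and a third factor without constant term kills that.\<close>
  have "foldr (\<lambda>v w. v \<otimes>\<^bsub>?W\<^esub> w) ws \<one>\<^bsub>?W\<^esub> = \<zero>\<^bsub>?W\<^esub>"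
    if ws: "length ws = 3 \<and> set ws \<subseteq> ?I" for ws
  proof -
    obtain u v w where uvw: "ws = [u, v, w]"
      using ws by (auto simp: length_Suc_conv numeral_3_eq_3)
    then have "u \<in> ?I" "v \<in> ?I" "w \<in> ?I" using ws by auto
    note I = this[THEN IW(1)] this[THEN IW(2)]
    have "u \<otimes>\<^bsub>?W\<^esub> (v \<otimes>\<^bsub>?W\<^esub> w) = \<zero>\<^bsub>?W\<^esub>"
      by (rule tw_eqI[of _ R n])
        (use I in \<open>simp_all add: tw_closed tw_mult tw_zero tw_nth[OF I(1)] tw_nth[OF I(2)] tw_nth[OF I(3)]\<close>)
    then show ?thesis using uvw I by simp
  qed
  then have "\<exists>k::nat. \<forall>ws. length ws = k \<and> set ws \<subseteq> ?I
      \<longrightarrow> foldr (\<lambda>v w. v \<otimes>\<^bsub>?W\<^esub> w) ws \<one>\<^bsub>?W\<^esub> = \<zero>\<^bsub>?W\<^esub>" by blast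
  moreover have "\<exists>m::nat. carrier ?W = ({..m} \<rightarrow>\<^sub>E carrier R) \<and>
        (\<forall>v\<in>carrier ?W. \<forall>w\<in>carrier ?W. v \<oplus>\<^bsub>?W\<^esub> w = (\<lambda>i\<in>{..m}. v i \<oplus> w i)) \<and>
        (\<forall>a\<in>carrier R. \<forall>w\<in>carrier ?W. a \<odot>\<^bsub>?W\<^esub> w = (\<lambda>i\<in>{..m}. a \<otimes> w i)) \<and>
        \<one>\<^bsub>?W\<^esub> = (\<lambda>i\<in>{..m}. if i = 0 then \<one> else \<zero>)"
    by (rule exI[of _ n]) (simp add: truncated_weil_def)
  ultimately show ?thesis
    unfolding weil_algebra_def using algebra_truncated_weil ideal by blast
qed

end

section \<open>Algebra homomorphisms out of these Weil algebras as points\<close>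

text \<open>
  \<open>inf_points K n\<close> is, for \<open>n = 1, 2, 3\<close>, the set of points of \<open>D\<close> (embedded in the first
  axis), \<open>D(2)\<close> and \<open>D \<times> D\<close>.
\<close>

definition inf_points :: "('r, 'x) ring_scheme \<Rightarrow> nat \<Rightarrow> ('r \<times> 'r) set" where
  "inf_points K n = {(d, e). d \<in> carrier K \<and> e \<in> carrier K \<and>
     d \<otimes>\<^bsub>K\<^esub> d = \<zero>\<^bsub>K\<^esub> \<and> e \<otimes>\<^bsub>K\<^esub> e = \<zero>\<^bsub>K\<^esub> \<and>
     (n \<le> 2 \<longrightarrow> d \<otimes>\<^bsub>K\<^esub> e = \<zero>\<^bsub>K\<^esub>) \<and> (n \<le> 1 \<longrightarrow> e = \<zero>\<^bsub>K\<^esub>)}"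

text \<open>The elements of \<open>Spec\<close>, with the restriction map along an arrow replaced by
  an arbitrary ring map \<open>r\<close>, so that the comparison with points is pure commutative
  algebra.\<close>

definition weil_homs ::
  "('r, 'x) ring_scheme \<Rightarrow> ('s, 'y) ring_scheme \<Rightarrow> ('r \<Rightarrow> 's) \<Rightarrow> ('r, nat \<Rightarrow> 'r) module
    \<Rightarrow> ((nat \<Rightarrow> 'r) \<Rightarrow> 's) set" where
  "weil_homs K L r W = {h \<in> ring_hom W L \<inter> extensional (carrier W).
     \<forall>a\<in>carrier K. \<forall>w\<in>carrier W. h (a \<odot>\<^bsub>W\<^esub> w) = r a \<otimes>\<^bsub>L\<^esub> h w}"

text \<open>The polynomial w0 + w1 d + w2 e + w3 d e, with coefficients carried over by
  \<open>r\<close>. The guards drop the coordinates beyond \<open>n\<close>, where \<open>w\<close>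
  is \<open>undefined\<close>; coordinate 1 has no guard because only \<open>n \<ge> 1\<close> is
  considered.\<close>

definition weil_eval ::
  "('s, 'x) ring_scheme \<Rightarrow> ('r \<Rightarrow> 's) \<Rightarrow> nat \<Rightarrow> (nat \<Rightarrow> 'r) \<Rightarrow> 's \<times> 's \<Rightarrow> 's" where
  "weil_eval L r n w = (\<lambda>(d, e). r (w 0) \<oplus>\<^bsub>L\<^esub> r (w 1) \<otimes>\<^bsub>L\<^esub> d \<oplus>\<^bsub>L\<^esub>
     ((if 2 \<le> n then r (w 2) \<otimes>\<^bsub>L\<^esub> e else \<zero>\<^bsub>L\<^esub>) \<oplus>\<^bsub>L\<^esub>
      (if 3 \<le> n then r (w 3) \<otimes>\<^bsub>L\<^esub> (d \<otimes>\<^bsub>L\<^esub> e) else \<zero>\<^bsub>L\<^esub>)))"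

definition weil_point ::
  "('r, 'x) ring_scheme \<Rightarrow> ('s, 'y) ring_scheme \<Rightarrow> ('r \<Rightarrow> 's) \<Rightarrow> nat \<Rightarrow> 's \<times> 's \<Rightarrow> (nat \<Rightarrow> 'r) \<Rightarrow> 's" where
  "weil_point K L r n x = (\<lambda>w\<in>carrier (truncated_weil K n). weil_eval L r n w x)"

text \<open>The images of the generators x and y. For \<open>n = 1\<close> the second is the image
  of the zero vector, in accordance with D as the first axis.\<close>

definition weil_coords ::
  "('r, 'x) ring_scheme \<Rightarrow> nat \<Rightarrow> ((nat \<Rightarrow> 'r) \<Rightarrow> 's) \<Rightarrow> 's \<times> 's" where
  "weil_coords K n h = (h (weil_basis K n 1), h (weil_basis K n 2))"

locale cring_hom = K: cring K + L: cring L for K (structure) and L (structure) +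
  fixes r
  assumes hom: "r \<in> ring_hom K L"
begin

lemma r_simps:
  "a \<in> carrier K \<Longrightarrow> r a \<in> carrier L"
  "\<lbrakk>a \<in> carrier K; b \<in> carrier K\<rbrakk> \<Longrightarrow> r (a \<otimes>\<^bsub>K\<^esub> b) = r a \<otimes>\<^bsub>L\<^esub> r b"
  "\<lbrakk>a \<in> carrier K; b \<in> carrier K\<rbrakk> \<Longrightarrow> r (a \<oplus>\<^bsub>K\<^esub> b) = r a \<oplus>\<^bsub>L\<^esub> r b"
  "r \<one>\<^bsub>K\<^esub> = \<one>\<^bsub>L\<^esub>" "r \<zero>\<^bsub>K\<^esub> = \<zero>\<^bsub>L\<^esub>"
  using hom by (auto simp: ring_hom_closed ring_hom_mult ring_hom_add ring_hom_one
      ring_hom_zero[OF hom K.ring_axioms L.ring_axioms])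

lemma r_minus: "a \<in> carrier K \<Longrightarrow> r (\<ominus>\<^bsub>K\<^esub> a) = \<ominus>\<^bsub>L\<^esub> r a"
  by (metis K.add.inv_closed K.l_neg L.minus_equality r_simps(1,3,5))

lemma weil_eval_closed:
  assumes "w \<in> carrier (truncated_weil K n)" "1 \<le> n" "x \<in> inf_points L n"
  shows "weil_eval L r n w x \<in> carrier L"
  using assms tw_nth[OF assms(1)] by (auto simp: weil_eval_def inf_points_def r_simps)

text \<open>Additivity and linearity hold for any pair. The relations of \<open>inf_points\<close>
  enter in multiplicativity, where they kill exactly the monomials that the multiplication of the
  truncated algebra drops.\<close>

lemma weil_point_in:
  assumes n: "1 \<le> n" "n \<le> 3" and x: "x \<in> inf_points L n"
  shows "weil_point K L r n x \<in> weil_homs K L r (truncated_weil K n)"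
proof -
  let ?W = "truncated_weil K n"
  obtain d e where xde: "x = (d, e)" by (cases x)
  have de: "d \<in> carrier L" "e \<in> carrier L" "d \<otimes>\<^bsub>L\<^esub> d = \<zero>\<^bsub>L\<^esub>" "e \<otimes>\<^bsub>L\<^esub> e = \<zero>\<^bsub>L\<^esub>"
    "n \<le> 2 \<Longrightarrow> d \<otimes>\<^bsub>L\<^esub> e = \<zero>\<^bsub>L\<^esub>" "n \<le> 1 \<Longrightarrow> e = \<zero>\<^bsub>L\<^esub>"
    using x by (auto simp: xde inf_points_def)
  \<comment> \<open>Sorting a product by associativity and commutativity can leave d d or d e in
    front of further factors; in this form the relations cancel there as well.\<close>
  have dd: "d \<otimes>\<^bsub>L\<^esub> (d \<otimes>\<^bsub>L\<^esub> a) = \<zero>\<^bsub>L\<^esub>" "e \<otimes>\<^bsub>L\<^esub> (e \<otimes>\<^bsub>L\<^esub> a) = \<zero>\<^bsub>L\<^esub>"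
    if "a \<in> carrier L" for a using that de
    by (metis L.l_null L.m_assoc)+
  have ed: "n \<le> 2 \<Longrightarrow> e \<otimes>\<^bsub>L\<^esub> d = \<zero>\<^bsub>L\<^esub>" using de by (simp add: L.m_comm)
  have de0: "d \<otimes>\<^bsub>L\<^esub> (e \<otimes>\<^bsub>L\<^esub> a) = \<zero>\<^bsub>L\<^esub>" "e \<otimes>\<^bsub>L\<^esub> (d \<otimes>\<^bsub>L\<^esub> a) = \<zero>\<^bsub>L\<^esub>"
    if "a \<in> carrier L" "n \<le> 2" for a using that de ed
    by (metis L.l_null L.m_assoc)+
  have n': "n = 1 \<or> n = 2 \<or> n = 3" using n by auto
  have mult: "weil_eval L r n (v \<otimes>\<^bsub>?W\<^esub> w) x = weil_eval L r n v x \<otimes>\<^bsub>L\<^esub> weil_eval L r n w x"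
    if v: "v \<in> carrier ?W" and w: "w \<in> carrier ?W" for v w
  proof -
    note c = tw_nth[OF v] tw_nth[OF w]
    have c01: "v 0 \<in> carrier K" "v 1 \<in> carrier K" "w 0 \<in> carrier K" "w 1 \<in> carrier K"
      using n c by auto
    have "v 2 \<in> carrier K" "w 2 \<in> carrier K" if "n \<ge> 2" using that n c by auto
    moreover have "v 3 \<in> carrier K" "w 3 \<in> carrier K" if "n \<ge> 3" using that n c by auto
    ultimately show ?thesis
      using n' de c01 by (elim disjE) (simp_all add: xde weil_eval_def K.tw_mult r_simps
          L.l_distr L.r_distr L.m_ac L.a_ac dd de0 ed)
  qed
  have add: "weil_eval L r n (v \<oplus>\<^bsub>?W\<^esub> w) x = weil_eval L r n v x \<oplus>\<^bsub>L\<^esub> weil_eval L r n w x"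
    if v: "v \<in> carrier ?W" and w: "w \<in> carrier ?W" for v w
    using n tw_nth[OF v] tw_nth[OF w] de
    by (simp add: xde weil_eval_def K.tw_add r_simps L.l_distr L.a_ac)
  have smult: "weil_eval L r n (a \<odot>\<^bsub>?W\<^esub> w) x = r a \<otimes>\<^bsub>L\<^esub> weil_eval L r n w x"
    if a: "a \<in> carrier K" and w: "w \<in> carrier ?W" for a w
    using n tw_nth[OF w] de a
    by (simp add: xde weil_eval_def K.tw_smult r_simps L.r_distr L.m_assoc)
  have one: "weil_eval L r n \<one>\<^bsub>?W\<^esub> x = \<one>\<^bsub>L\<^esub>"
    using n de by (simp add: xde weil_eval_def K.tw_one r_simps)
  have W: "v \<otimes>\<^bsub>?W\<^esub> w \<in> carrier ?W" "v \<oplus>\<^bsub>?W\<^esub> w \<in> carrier ?W" "\<one>\<^bsub>?W\<^esub> \<in> carrier ?W"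
    "a \<in> carrier K \<Longrightarrow> a \<odot>\<^bsub>?W\<^esub> w \<in> carrier ?W"
    if "v \<in> carrier ?W" "w \<in> carrier ?W" for v w a
    using that by (auto intro: K.tw_closed)
  show ?thesis
    using W by (auto simp: weil_homs_def weil_point_def mult add smult one K.tw_closed
        K.tw_one_closed intro!: ring_hom_memI weil_eval_closed n x)
qed

text \<open>A homomorphism carries the relations x x = y y = 0 and x y =
  \<open>weil_basis K n 3\<close> over to its values on the generators. Being linear, it is
  determined by them, since 1, x, y and x y span.\<close>

lemma weil_coords_in:
  assumes n: "1 \<le> n" "n \<le> 3" and h: "h \<in> weil_homs K L r (truncated_weil K n)"
  shows "weil_coords K n h \<in> inf_points L n"
    and "weil_point K L r n (weil_coords K n h) = h"
proof -
  let ?W = "truncated_weil K n" and ?E = "weil_basis K n"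
  interpret W: cring ?W by (rule K.cring_truncated_weil)
  interpret h: cring_hom ?W L h
    by unfold_locales (use h in \<open>auto simp: weil_homs_def\<close>)
  note E = K.tw_basis_closed
  have n': "n = 1 \<or> n = 2 \<or> n = 3" using n by auto
  have sq: "?E j \<otimes>\<^bsub>?W\<^esub> ?E j = \<zero>\<^bsub>?W\<^esub>" if "1 \<le> j" "j \<le> 2" for j
    by (rule tw_eqI[of _ K n]) (use that E n in \<open>auto simp: K.tw_mult K.tw_zero K.tw_basis\<close>)
  have E12: "?E 1 \<otimes>\<^bsub>?W\<^esub> ?E 2 = ?E 3"
    by (rule tw_eqI[of _ K n]) (use E n in \<open>auto simp: K.tw_mult K.tw_zero K.tw_basis\<close>)
  have E0: "?E j = \<zero>\<^bsub>?W\<^esub>" if "j > n" for j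
    by (rule tw_eqI[of _ K n]) (use E n that in \<open>auto simp: K.tw_zero K.tw_basis\<close>)
  have h0: "h \<zero>\<^bsub>?W\<^esub> = \<zero>\<^bsub>L\<^esub>" by (rule h.r_simps)
  have hE: "h (?E j) \<in> carrier L" for j using E by (rule h.r_simps)
  have h12: "h (?E 1) \<otimes>\<^bsub>L\<^esub> h (?E 2) = h (?E 3)" using E12 E h.r_simps(2) by metis
  have hsq: "h (?E j) \<otimes>\<^bsub>L\<^esub> h (?E j) = \<zero>\<^bsub>L\<^esub>" if "1 \<le> j" "j \<le> 2" for j
    using sq[OF that] E h.r_simps(2) h0 by metis
  have "h (?E 1) \<otimes>\<^bsub>L\<^esub> h (?E 2) = \<zero>\<^bsub>L\<^esub>" if "n \<le> 2"
    using h12 E0[of 3] that h0 by simp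
  moreover have "h (?E 2) = \<zero>\<^bsub>L\<^esub>" if "n \<le> 1"
    using E0[of 2] that h0 by simp
  ultimately show co: "weil_coords K n h \<in> inf_points L n"
    using hsq[of 1] hsq[of 2] by (auto simp: weil_coords_def inf_points_def hE)
  have ev: "weil_eval L r n w (weil_coords K n h) = h w" if w: "w \<in> carrier ?W" for w
  proof -
    have hs: "h (a \<odot>\<^bsub>?W\<^esub> v) = r a \<otimes>\<^bsub>L\<^esub> h v" if "a \<in> carrier K" "v \<in> carrier ?W" for a v
      using h that by (auto simp: weil_homs_def)
    have sm: "a \<odot>\<^bsub>?W\<^esub> v \<in> carrier ?W" if "a \<in> carrier K" "v \<in> carrier ?W" for a v
      using that by (intro K.tw_closed)
    have c: "w 0 \<in> carrier K" "w 1 \<in> carrier K" "n \<ge> 2 \<Longrightarrow> w 2 \<in> carrier K"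
      "n \<ge> 3 \<Longrightarrow> w 3 \<in> carrier K"
      using tw_nth[OF w] n by auto
    have "w = w 0 \<odot>\<^bsub>?W\<^esub> \<one>\<^bsub>?W\<^esub> \<oplus>\<^bsub>?W\<^esub> w 1 \<odot>\<^bsub>?W\<^esub> ?E 1 \<oplus>\<^bsub>?W\<^esub>
       ((if 2 \<le> n then w 2 \<odot>\<^bsub>?W\<^esub> ?E 2 else \<zero>\<^bsub>?W\<^esub>) \<oplus>\<^bsub>?W\<^esub>
        (if 3 \<le> n then w 3 \<odot>\<^bsub>?W\<^esub> ?E 3 else \<zero>\<^bsub>?W\<^esub>))" (is "_ = ?s")
    proof (rule tw_eqI[OF w])
      show "?s \<in> carrier ?W" using c E by (auto intro!: sm W.a_closed)
      fix i assume i: "i \<le> n"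
      then have "i = 0 \<or> i = 1 \<or> i = 2 \<or> i = 3" using n by auto
      then show "w i = ?s i"
        using i c by (elim disjE) (simp_all add: K.tw_add K.tw_smult K.tw_basis K.tw_one K.tw_zero)
    qed
    then have "h w = h ?s" by simp
    also have "\<dots> = weil_eval L r n w (weil_coords K n h)"
      using c E sm by (auto simp: h.r_simps hs weil_eval_def weil_coords_def h12[unfolded One_nat_def] r_simps hE)
    finally show ?thesis by simp
  qed
  show "weil_point K L r n (weil_coords K n h) = h"
    using ev h by (auto simp: weil_point_def weil_homs_def extensional_def)
qed

lemma weil_coords_point:
  assumes n: "1 \<le> n" "n \<le> 3" and x: "x \<in> inf_points L n"
  shows "weil_coords K n (weil_point K L r n x) = x"
proof -
  obtain d e where [simp]: "x = (d, e)" by (cases x)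
  have "d \<in> carrier L" "e \<in> carrier L" "n \<le> 1 \<Longrightarrow> e = \<zero>\<^bsub>L\<^esub>"
    using x by (auto simp: inf_points_def)
  with n show ?thesis
    by (auto simp: weil_coords_def weil_point_def K.tw_basis_closed weil_eval_def K.tw_basis r_simps)
qed

end

text \<open>A ring map respects polynomials. \<open>t\<close> has to be the composite of
  \<open>r\<close> and \<open>s\<close> on the carrier only, which is all that restriction maps
  provide.\<close>

lemma weil_eval_hom:
  assumes "cring_hom K L r" "cring_hom L M s" "w \<in> carrier (truncated_weil K n)" "1 \<le> n"
    "x \<in> carrier L \<times> carrier L" "\<And>a. a \<in> carrier K \<Longrightarrow> t a = s (r a)"
  shows "s (weil_eval L r n w x) = weil_eval M t n w (map_prod s s x)"
proof -
  interpret r: cring_hom K L r by fact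
  interpret s: cring_hom L M s by fact
  show ?thesis using assms(4-6) tw_nth[OF assms(3)]
    by (auto simp: weil_eval_def r.r_simps s.r_simps)
qed

lemma inf_points_hom:
  assumes "cring_hom K L r" "x \<in> inf_points K n"
  shows "map_prod r r x \<in> inf_points L n"
proof -
  interpret r: cring_hom K L r by fact
  obtain d e where x: "x = (d, e)" "d \<in> carrier K" "e \<in> carrier K"
    using assms(2) by (auto simp: inf_points_def)
  have "r a \<otimes>\<^bsub>L\<^esub> r b = \<zero>\<^bsub>L\<^esub>" if "a \<in> carrier K" "b \<in> carrier K" "a \<otimes>\<^bsub>K\<^esub> b = \<zero>\<^bsub>K\<^esub>" for a b
    using that r.r_simps(2)[of a b] by (simp add: r.r_simps)
  then show ?thesis using assms(2) x
    by (simp add: inf_points_def r.r_simps)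
qed

section \<open>Spectra, points and microlinearity\<close>

context small_category
begin

abbreviation over where "over f \<equiv> into C (Dom C f)"

abbreviation psh_maps where
  "psh_maps c F H \<equiv> maps C c (loc C F) (loc C H)"

lemma into_comp [simp, intro]: "\<lbrakk>f \<in> into C c; g \<in> over f\<rbrakk> \<Longrightarrow> f \<cdot> g \<in> into C c"
  by (auto simp: into_def Comp_Arr Comp_Cod)

lemma Dom_comp [simp]: "\<lbrakk>f \<in> into C c; g \<in> over f\<rbrakk> \<Longrightarrow> Dom C (f \<cdot> g) = Dom C g"
  by (auto simp: into_def Comp_Dom)

lemma into_Id [simp, intro]: "c \<in> Ob C \<Longrightarrow> Id C c \<in> into C c"
  by (simp add: into_def Id_Arr Id_Cod)

lemma into_Ob [simp]: "f \<in> into C c \<Longrightarrow> Dom C f \<in> Ob C"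
  by (auto simp: into_def Dom_Ob)

lemma comp_Id [simp]: "f \<in> into C c \<Longrightarrow> f \<cdot> Id C (Dom C f) = f"
  by (auto simp: into_def Id_right)

lemma Id_comp [simp]: "f \<in> into C c \<Longrightarrow> Id C c \<cdot> f = f"
  by (auto simp: into_def Id_left)

lemma comp_assoc:
  "\<lbrakk>f \<in> into C c; g \<in> over f; h \<in> over g\<rbrakk> \<Longrightarrow> (f \<cdot> g) \<cdot> h = f \<cdot> (g \<cdot> h)"
  by (auto simp: into_def Comp_assoc)

lemma maps_closed: "\<lbrakk>\<phi> \<in> maps C c A B; f \<in> into C c; x \<in> El A f\<rbrakk> \<Longrightarrow> \<phi> f x \<in> El B f"
  by (auto simp: maps_def PiE_def Pi_def)

lemma maps_natural:
  "\<lbrakk>\<phi> \<in> maps C c A B; f \<in> into C c; g \<in> over f; x \<in> El A f\<rbrakk>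
    \<Longrightarrow> Rs B g (\<phi> f x) = \<phi> (f \<cdot> g) (Rs A g x)"
  by (auto simp: maps_def)

lemma maps_eqI:
  assumes "\<phi> \<in> maps C c A B" "\<phi>' \<in> maps C c A B'"
    and "\<And>f x. \<lbrakk>f \<in> into C c; x \<in> El A f\<rbrakk> \<Longrightarrow> \<phi> f x = \<phi>' f x"
  shows "\<phi> = \<phi>'"
proof (rule ext, rule ext)
  fix f x
  have "\<phi> f x = \<phi>' f x" if "f \<notin> into C c \<or> x \<notin> El A f"
    using assms(1,2) that by (cases "f \<in> into C c") (auto simp: maps_def PiE_def Pi_def extensional_def)
  then show "\<phi> f x = \<phi>' f x" using assms(3) by metis
qed

text \<open>A \<open>vset\<close> carries no presheaf laws, so it must be supplied that
  \<open>Rs A\<close> preserves elements; otherwise the restricted function could be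
  \<open>undefined\<close> at \<open>Rs A g x\<close>.\<close>

lemma maps_memI:
  assumes "\<And>f x. \<lbrakk>f \<in> into C c; x \<in> El A f\<rbrakk> \<Longrightarrow> \<phi> f x \<in> El B f"
    and "\<And>f g x. \<lbrakk>f \<in> into C c; g \<in> over f; x \<in> El A f\<rbrakk> \<Longrightarrow> Rs A g x \<in> El A (f \<cdot> g)"
    and "\<And>f g x. \<lbrakk>f \<in> into C c; g \<in> over f; x \<in> El A f\<rbrakk>
      \<Longrightarrow> Rs B g (\<phi> f x) = \<phi> (f \<cdot> g) (Rs A g x)"
  shows "(\<lambda>f\<in>into C c. \<lambda>x\<in>El A f. \<phi> f x) \<in> maps C c A B"
  using assms by (auto simp: maps_def)

lemma maps_res_apply [simp]: "g \<in> over f \<Longrightarrow> maps_res C f \<phi> g = \<phi> (f \<cdot> g)"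
  by (simp add: maps_res_def)

lemma maps_pullback_Id: "c \<in> Ob C \<Longrightarrow> maps C c (pullback C A (Id C c)) B = maps C c A B"
  by (auto simp: maps_def pullback_def PiE_def Pi_def)

lemma El_loc [simp]: "El (loc C F) f = Sec F (Dom C f)"
  and Rs_loc [simp]: "Rs (loc C F) = Res F"
  and El_pullback [simp]: "El (pullback C A h) f = El A (h \<cdot> f)"
  and Rs_pullback [simp]: "Rs (pullback C A h) = Rs A"
  by (simp_all add: loc_def pullback_def)

end

text \<open>D is kept as the set of pairs (d, 0), so that all three objects have one type and can be
  vertices of the same diagram.\<close>

definition inf_psh :: "('o, 'm, 'r) rng_psh \<Rightarrow> nat \<Rightarrow> ('o, 'm, 'r \<times> 'r) psh" where
  "inf_psh R n =
     \<lparr>Sec = (\<lambda>c. inf_points (Rng R c) n), Res = (\<lambda>f. map_prod (RRes R f) (RRes R f))\<rparr>"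

lemma inf_psh_simps [simp]:
  "Sec (inf_psh R n) c = inf_points (Rng R c) n"
  "Res (inf_psh R n) f = map_prod (RRes R f) (RRes R f)"
  by (simp_all add: inf_psh_def)

lemma line_simps [simp]:
  "Sec (line R) c = carrier (Rng R c)" "Res (line R) f = RRes R f"
  by (simp_all add: line_def)

lemma inf_psh_2: "inf_psh R 2 = inf_D2 R"
  by (rule psh.equality) (auto simp: inf_psh_def inf_D2_def inf_D_def inf_points_def)

lemma inf_D_simps [simp]:
  "d \<in> Sec (inf_D R) c \<longleftrightarrow> d \<in> carrier (Rng R c) \<and> d \<otimes>\<^bsub>Rng R c\<^esub> d = \<zero>\<^bsub>Rng R c\<^esub>"
  "Res (inf_D R) f = RRes R f"
  by (simp_all add: inf_D_def)

section \<open>Points versus homomorphisms at the stages of the site\<close>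

context cring_sheaf
begin

abbreviation RD where "RD f \<equiv> Rng R (Dom C f)"

abbreviation res_pair where "res_pair f \<equiv> map_prod (RRes R f) (RRes R f)"

abbreviation eval_at where "eval_at f \<equiv> weil_eval (RD f) (RRes R f)"

abbreviation zero_at where "zero_at f \<equiv> \<zero>\<^bsub>RD f\<^esub>"

abbreviation DD where "DD f \<equiv> Sec (inf_D R) (Dom C f)"

lemma cring_hom_RRes: "f \<in> into C c \<Longrightarrow> cring_hom (Rng R c) (RD f) (RRes R f)"
  using RRes_hom[of f] cring_Rng Dom_Ob Cod_Ob
  by (auto simp: cring_hom_def cring_hom_axioms_def into_def)

lemmas RRes_simps = cring_hom.r_simps[OF cring_hom_RRes]

lemma RRes_comp:
  "\<lbrakk>f \<in> into C c; g \<in> over f; a \<in> carrier (Rng R c)\<rbrakk>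
    \<Longrightarrow> RRes R (f \<cdot> g) a = RRes R g (RRes R f a)"
  using Res_Comp[of f g a] by (auto simp: into_def)

lemma RRes_Id: "\<lbrakk>c \<in> Ob C; a \<in> carrier (Rng R c)\<rbrakk> \<Longrightarrow> RRes R (Id C c) a = a"
  using Res_Id[of c a] by simp

lemma inf_points_res:
  "\<lbrakk>f \<in> into C c; x \<in> inf_points (Rng R c) n\<rbrakk>
    \<Longrightarrow> res_pair f x \<in> inf_points (RD f) n"
  by (rule inf_points_hom[OF cring_hom_RRes])

text \<open>Two stages are in play: the Weil algebra has its coefficients at \<open>c\<close>, while
  its points are taken at the domain of an arrow \<open>f\<close> into \<open>c\<close>. The
  presheaf \<open>inf_psh\<close> depends on the latter stage only.\<close>

definition wspec :: "'o \<Rightarrow> nat \<Rightarrow> ('m, (nat \<Rightarrow> 'r) \<Rightarrow> 'r) vset" where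
  "wspec c n = Spec C R c (truncated_weil (Rng R c) n)"

definition wpt :: "'o \<Rightarrow> nat \<Rightarrow> 'm \<Rightarrow> 'r \<times> 'r \<Rightarrow> (nat \<Rightarrow> 'r) \<Rightarrow> 'r" where
  "wpt c n f = weil_point (Rng R c) (RD f) (RRes R f) n"

definition wco :: "'o \<Rightarrow> nat \<Rightarrow> ((nat \<Rightarrow> 'r) \<Rightarrow> 'r) \<Rightarrow> 'r \<times> 'r" where
  "wco c n = weil_coords (Rng R c) n"

lemma El_wspec: "El (wspec c n) f =
    weil_homs (Rng R c) (RD f) (RRes R f) (truncated_weil (Rng R c) n)"
  by (simp add: wspec_def Spec_def weil_homs_def)

lemma Rs_wspec: "Rs (wspec c n) g h = (\<lambda>w\<in>carrier (truncated_weil (Rng R c) n). RRes R g (h w))"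
  by (simp add: wspec_def Spec_def)

lemma wpt_in:
  "\<lbrakk>f \<in> into C c; 1 \<le> n; n \<le> 3; x \<in> inf_points (RD f) n\<rbrakk> \<Longrightarrow> wpt c n f x \<in> El (wspec c n) f"
  unfolding El_wspec wpt_def by (rule cring_hom.weil_point_in[OF cring_hom_RRes])

lemma wco_in:
  "\<lbrakk>f \<in> into C c; 1 \<le> n; n \<le> 3; h \<in> El (wspec c n) f\<rbrakk> \<Longrightarrow> wco c n h \<in> inf_points (RD f) n"
  unfolding El_wspec wco_def by (rule cring_hom.weil_coords_in(1)[OF cring_hom_RRes])

lemma wpt_wco:
  "\<lbrakk>f \<in> into C c; 1 \<le> n; n \<le> 3; h \<in> El (wspec c n) f\<rbrakk> \<Longrightarrow> wpt c n f (wco c n h) = h"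
  unfolding El_wspec wco_def wpt_def by (rule cring_hom.weil_coords_in(2)[OF cring_hom_RRes])

lemma wco_wpt:
  "\<lbrakk>f \<in> into C c; 1 \<le> n; n \<le> 3; x \<in> inf_points (RD f) n\<rbrakk> \<Longrightarrow> wco c n (wpt c n f x) = x"
  unfolding wco_def wpt_def by (rule cring_hom.weil_coords_point[OF cring_hom_RRes])

lemma wpt_res:
  assumes "f \<in> into C c" "g \<in> over f" "1 \<le> n" "x \<in> inf_points (RD f) n"
  shows "Rs (wspec c n) g (wpt c n f x) = wpt c n (f \<cdot> g) (res_pair g x)"
proof -
  have x: "x \<in> carrier (RD f) \<times> carrier (RD f)"
    using assms(4) by (auto simp: inf_points_def)
  show ?thesis
    unfolding Rs_wspec wpt_def weil_point_def Dom_comp[OF assms(1,2)]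
    by (rule restrict_ext, simp)
      (rule weil_eval_hom[OF cring_hom_RRes[OF assms(1)] cring_hom_RRes[OF assms(2)] _ assms(3) x
          RRes_comp[OF assms(1,2)]])
qed

lemma wco_res:
  assumes "f \<in> into C c"
  shows "wco c n (Rs (wspec c n) g h) = res_pair g (wco c n h)"
proof -
  interpret cring_hom "Rng R c" "RD f" "RRes R f" by (rule cring_hom_RRes[OF assms])
  show ?thesis by (simp add: wco_def weil_coords_def Rs_wspec K.tw_basis_closed)
qed

lemma Rs_wspec_in:
  assumes f: "f \<in> into C c" and g: "g \<in> over f" and n: "1 \<le> n" "n \<le> 3"
    and h: "h \<in> El (wspec c n) f"
  shows "Rs (wspec c n) g h \<in> El (wspec c n) (f \<cdot> g)"
  using wpt_res[OF f g n(1) wco_in[OF f n h]] wpt_wco[OF f n h]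
    wpt_in[OF into_comp[OF f g] n, of "res_pair g (wco c n h)"]
    inf_points_res[OF g wco_in[OF f n h]] Dom_comp[OF f g] by simp

lemma inf_maps_memI:
  assumes "\<And>f x. \<lbrakk>f \<in> into C c; x \<in> inf_points (RD f) n\<rbrakk> \<Longrightarrow> \<phi> f x \<in> Sec F (Dom C f)"
    and "\<And>f g x. \<lbrakk>f \<in> into C c; g \<in> over f; x \<in> inf_points (RD f) n\<rbrakk>
      \<Longrightarrow> Res F g (\<phi> f x) = \<phi> (f \<cdot> g) (res_pair g x)"
  shows "(\<lambda>f\<in>into C c. \<lambda>x\<in>inf_points (RD f) n. \<phi> f x) \<in> psh_maps c (inf_psh R n) F"
  using maps_memI[of c "loc C (inf_psh R n)" \<phi> "loc C F"] assms inf_points_res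
  by auto

lemma inf_maps_closed:
  "\<lbrakk>\<phi> \<in> psh_maps c (inf_psh R n) F; f \<in> into C c; x \<in> inf_points (RD f) n\<rbrakk>
    \<Longrightarrow> \<phi> f x \<in> Sec F (Dom C f)"
  by (drule maps_closed) auto

lemma inf_maps_natural:
  "\<lbrakk>\<phi> \<in> psh_maps c (inf_psh R n) F; f \<in> into C c; g \<in> over f;
     x \<in> inf_points (RD f) n\<rbrakk>
    \<Longrightarrow> Res F g (\<phi> f x) = \<phi> (f \<cdot> g) (res_pair g x)"
  by (drule maps_natural) auto

lemma inf_maps_eqI:
  assumes "\<phi> \<in> psh_maps c (inf_psh R n) F" "\<phi>' \<in> psh_maps c (inf_psh R n) F"
    and "\<And>f x. \<lbrakk>f \<in> into C c; x \<in> inf_points (RD f) n\<rbrakk> \<Longrightarrow> \<phi> f x = \<phi>' f x"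
  shows "\<phi> = \<phi>'"
  using assms(1,2) by (rule maps_eqI) (simp add: assms(3))

text \<open>Transport of a map out of the spectrum, pulled back along \<open>f\<close>, to a map out
  of the points over the domain of \<open>f\<close>; \<open>of_points\<close> is the way back. Only
  the side of the spectrum remembers \<open>f\<close>.\<close>

definition to_points :: "'o \<Rightarrow> nat \<Rightarrow> 'm \<Rightarrow> ('m \<Rightarrow> ((nat \<Rightarrow> 'r) \<Rightarrow> 'r) \<Rightarrow> 'b) \<Rightarrow> 'm \<Rightarrow> 'r \<times> 'r \<Rightarrow> 'b" where
  "to_points c n f \<psi> =
     (\<lambda>g\<in>over f. \<lambda>x\<in>inf_points (RD g) n. \<psi> g (wpt c n (f \<cdot> g) x))"

definition of_points :: "'o \<Rightarrow> nat \<Rightarrow> 'm \<Rightarrow> ('m \<Rightarrow> 'r \<times> 'r \<Rightarrow> 'b) \<Rightarrow> 'm \<Rightarrow> ((nat \<Rightarrow> 'r) \<Rightarrow> 'r) \<Rightarrow> 'b" where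
  "of_points c n f \<phi> =
     (\<lambda>g\<in>over f. \<lambda>h\<in>El (wspec c n) (f \<cdot> g). \<phi> g (wco c n h))"

lemma to_points_in:
  assumes f: "f \<in> into C c" and n: "1 \<le> n" "n \<le> 3"
    and \<psi>: "\<psi> \<in> maps C (Dom C f) (pullback C (wspec c n) f) (loc C F)"
  shows "to_points c n f \<psi> \<in> psh_maps (Dom C f) (inf_psh R n) F"
  unfolding to_points_def
proof (rule inf_maps_memI)
  fix g x assume g: "g \<in> over f" and x: "x \<in> inf_points (RD g) n"
  then have p: "wpt c n (f \<cdot> g) x \<in> El (wspec c n) (f \<cdot> g)"
    using wpt_in[OF into_comp[OF f g] n] f by simp
  then show "\<psi> g (wpt c n (f \<cdot> g) x) \<in> Sec F (Dom C g)"
    using maps_closed[OF \<psi> g] by simp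
  fix k assume k: "k \<in> over g"
  show "Res F k (\<psi> g (wpt c n (f \<cdot> g) x)) =
     \<psi> (g \<cdot> k) (wpt c n (f \<cdot> (g \<cdot> k)) (res_pair k x))"
    using maps_natural[OF \<psi> g k] p wpt_res[OF into_comp[OF f g] _ n(1), of k x] f g k x
    by (simp add: comp_assoc[OF f g k])
qed

lemma of_points_in:
  assumes f: "f \<in> into C c" and n: "1 \<le> n" "n \<le> 3"
    and \<phi>: "\<phi> \<in> psh_maps (Dom C f) (inf_psh R n) F"
  shows "of_points c n f \<phi> \<in> maps C (Dom C f) (pullback C (wspec c n) f) (loc C F)"
proof -
  have "(\<lambda>g\<in>over f. \<lambda>h\<in>El (pullback C (wspec c n) f) g. \<phi> g (wco c n h))
    \<in> maps C (Dom C f) (pullback C (wspec c n) f) (loc C F)"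
  proof (rule maps_memI)
    fix g h assume g: "g \<in> over f" and "h \<in> El (pullback C (wspec c n) f) g"
    then have h: "h \<in> El (wspec c n) (f \<cdot> g)" by simp
    have x: "wco c n h \<in> inf_points (RD g) n"
      using wco_in[OF into_comp[OF f g] n h] f g by simp
    then show "\<phi> g (wco c n h) \<in> El (loc C F) g"
      using inf_maps_closed[OF \<phi> g] by simp
    fix k assume k: "k \<in> over g"
    show "Rs (pullback C (wspec c n) f) k h \<in> El (pullback C (wspec c n) f) (g \<cdot> k)"
      using Rs_wspec_in[OF into_comp[OF f g] _ n h, of k] f g k by (simp add: comp_assoc[OF f g k, symmetric])
    show "Rs (loc C F) k (\<phi> g (wco c n h)) = \<phi> (g \<cdot> k) (wco c n (Rs (pullback C (wspec c n) f) k h))"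
      using inf_maps_natural[OF \<phi> g k x] wco_res[OF f, of n k h] by simp
  qed
  then show ?thesis by (simp add: of_points_def)
qed

lemma to_of_points:
  assumes f: "f \<in> into C c" and n: "1 \<le> n" "n \<le> 3"
    and \<phi>: "\<phi> \<in> psh_maps (Dom C f) (inf_psh R n) F"
  shows "to_points c n f (of_points c n f \<phi>) = \<phi>"
proof (rule inf_maps_eqI[OF to_points_in[OF f n of_points_in[OF f n \<phi>]] \<phi>])
  fix g x assume g: "g \<in> over f" and x: "x \<in> inf_points (RD g) n"
  then show "to_points c n f (of_points c n f \<phi>) g x = \<phi> g x"
    using wpt_in[OF into_comp[OF f g] n] wco_wpt[OF into_comp[OF f g] n] f
    by (simp add: to_points_def of_points_def)
qed

lemma of_to_points:
  assumes f: "f \<in> into C c" and n: "1 \<le> n" "n \<le> 3"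
    and \<psi>: "\<psi> \<in> maps C (Dom C f) (pullback C (wspec c n) f) (loc C F)"
  shows "of_points c n f (to_points c n f \<psi>) = \<psi>"
proof (rule maps_eqI[OF of_points_in[OF f n to_points_in[OF f n \<psi>]] \<psi>])
  fix g h assume g: "g \<in> over f" and h: "h \<in> El (pullback C (wspec c n) f) g"
  then show "of_points c n f (to_points c n f \<psi>) g h = \<psi> g h"
    using wco_in[OF into_comp[OF f g] n, of h] wpt_wco[OF into_comp[OF f g] n, of h] f
    by (simp add: to_points_def of_points_def)
qed

section \<open>Diagrams and limit cocones in terms of points\<close>

definition spec_map :: "'o \<Rightarrow> nat \<Rightarrow> nat \<Rightarrow> ('m \<Rightarrow> 'r \<times> 'r \<Rightarrow> 'r \<times> 'r)
    \<Rightarrow> 'm \<Rightarrow> ((nat \<Rightarrow> 'r) \<Rightarrow> 'r) \<Rightarrow> (nat \<Rightarrow> 'r) \<Rightarrow> 'r" where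
  "spec_map c n k u = (\<lambda>f\<in>into C c. \<lambda>h\<in>El (wspec c n) f. wpt c k f (u f (wco c n h)))"

text \<open>Naturality of \<open>wpt\<close> and \<open>wco\<close> is enough. The algebra
  homomorphism in the opposite direction that induces this map of spectra is never written
  down.\<close>

lemma spec_map_in:
  assumes n: "1 \<le> n" "n \<le> 3" and k: "1 \<le> k" "k \<le> 3"
    and u: "u \<in> psh_maps c (inf_psh R n) (inf_psh R k)"
  shows "spec_map c n k u \<in> maps C c (wspec c n) (wspec c k)"
  unfolding spec_map_def
proof (rule maps_memI)
  fix f h assume f: "f \<in> into C c" and h: "h \<in> El (wspec c n) f"
  note x = wco_in[OF f n h]
  have ux: "u f (wco c n h) \<in> inf_points (RD f) k"
    using inf_maps_closed[OF u f x] by simp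
  then show "wpt c k f (u f (wco c n h)) \<in> El (wspec c k) f"
    by (rule wpt_in[OF f k])
  fix g assume g: "g \<in> over f"
  show "Rs (wspec c n) g h \<in> El (wspec c n) (f \<cdot> g)" by (rule Rs_wspec_in[OF f g n h])
  show "Rs (wspec c k) g (wpt c k f (u f (wco c n h))) = wpt c k (f \<cdot> g) (u (f \<cdot> g) (wco c n (Rs (wspec c n) g h)))"
    using inf_maps_natural[OF u f g x] wpt_res[OF f g k(1) ux] wco_res[OF f, of n g h] by simp
qed

lemma spec_map_comp:
  assumes n: "1 \<le> n" "n \<le> 3" and k: "1 \<le> k" "k \<le> 3"
    and u: "u \<in> psh_maps c (inf_psh R n) (inf_psh R k)"
    and eq: "\<And>f x. \<lbrakk>f \<in> into C c; x \<in> inf_points (RD f) n\<rbrakk> \<Longrightarrow> v f (u f x) = w f x"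
  shows "maps_comp C c (wspec c n) (spec_map c k l v) (spec_map c n k u) = spec_map c n l w"
  unfolding maps_comp_def spec_map_def
proof (intro restrict_ext)
  fix f h assume f: "f \<in> into C c" and h: "h \<in> El (wspec c n) f"
  note x = wco_in[OF f n h]
  have ux: "u f (wco c n h) \<in> inf_points (RD f) k"
    using inf_maps_closed[OF u f x] by simp
  show "(\<lambda>f\<in>into C c. \<lambda>h\<in>El (wspec c k) f. wpt c l f (v f (wco c k h))) f
          ((\<lambda>f\<in>into C c. \<lambda>h\<in>El (wspec c n) f. wpt c k f (u f (wco c n h))) f h) =
         wpt c l f (w f (wco c n h))"
    using f h wpt_in[OF f k ux] wco_wpt[OF f k ux] eq[OF f x] by simp
qed

text \<open>Since \<open>wpt\<close> and \<open>wco\<close> are mutually inverse, a commuting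
  triangle of spectra is an equation at points. This serves for the edges of a diagram as well as
  for the legs of a cocone.\<close>

lemma maps_comp_spec_map_iff:
  assumes f: "f \<in> into C c" and n: "1 \<le> n" "n \<le> 3" and k: "1 \<le> k" "k \<le> 3"
    and u: "u \<in> psh_maps c (inf_psh R n) (inf_psh R k)"
    and \<psi>: "\<psi> \<in> maps C (Dom C f) (pullback C (wspec c n) f) (loc C F)"
  shows "maps_comp C (Dom C f) (pullback C (wspec c n) f) \<chi> (maps_res C f (spec_map c n k u)) = \<psi> \<longleftrightarrow>
    (\<forall>g\<in>over f. \<forall>x\<in>inf_points (RD g) n.
       to_points c k f \<chi> g (u (f \<cdot> g) x) = to_points c n f \<psi> g x)" (is "?l \<longleftrightarrow> ?r")
proof -
  have ux: "u (f \<cdot> g) x \<in> inf_points (RD g) k"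
    if g: "g \<in> over f" and x: "x \<in> inf_points (RD g) n" for g x
    using inf_maps_closed[OF u into_comp[OF f g]] f g x by simp
  show ?thesis
  proof
    assume l: ?l
    show ?r
    proof (intro ballI)
      fix g x assume g: "g \<in> over f" and x: "x \<in> inf_points (RD g) n"
      note fg = into_comp[OF f g]
      have p: "wpt c n (f \<cdot> g) x \<in> El (wspec c n) (f \<cdot> g)" "wco c n (wpt c n (f \<cdot> g) x) = x"
        using wpt_in[OF fg n] wco_wpt[OF fg n] f g x by simp_all
      have "\<psi> g (wpt c n (f \<cdot> g) x) = \<chi> g (wpt c k (f \<cdot> g) (u (f \<cdot> g) x))"
        unfolding l[symmetric] using p g fg by (simp add: maps_comp_def spec_map_def)
      then show "to_points c k f \<chi> g (u (f \<cdot> g) x) = to_points c n f \<psi> g x"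
        using g x ux[OF g x] by (simp add: to_points_def)
    qed
  next
    assume r: ?r
    show ?l
    proof (rule ext, rule ext)
      fix g h
      show "maps_comp C (Dom C f) (pullback C (wspec c n) f) \<chi> (maps_res C f (spec_map c n k u)) g h = \<psi> g h"
      proof (cases "g \<in> over f")
        case g: True
        note fg = into_comp[OF f g]
        show ?thesis
        proof (cases "h \<in> El (wspec c n) (f \<cdot> g)")
          case h: True
          then have x: "wco c n h \<in> inf_points (RD g) n" and p: "wpt c n (f \<cdot> g) (wco c n h) = h"
            using wco_in[OF fg n h] wpt_wco[OF fg n h] f g by simp_all
          have "\<chi> g (wpt c k (f \<cdot> g) (u (f \<cdot> g) (wco c n h))) = \<psi> g h"
            using r[rule_format, OF g x] g x ux[OF g x] p by (simp add: to_points_def)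
          then show ?thesis using g h fg by (simp add: maps_comp_def spec_map_def)
        next
          \<comment> \<open>Off the domain both sides are \<open>undefined\<close>, the composite by
            its restriction and \<open>\<psi>\<close> by extensionality.\<close>
          case False
          moreover have "\<psi> g \<in> extensional (El (wspec c n) (f \<cdot> g))"
            using \<psi> g by (auto simp: maps_def PiE_def Pi_def)
          ultimately show ?thesis
            using g by (simp add: maps_comp_def extensional_def)
        qed
      next
        case False
        moreover have "\<psi> \<in> extensional (over f)"
          using \<psi> by (auto simp: maps_def PiE_def)
        ultimately show ?thesis by (simp add: maps_comp_def extensional_def)
      qed
    qed
  qed
qed

text \<open>The condition of \<open>exp_is_limit\<close> at a single arrow \<open>f\<close>. With
  \<open>f\<close> kept apart, the limit can be verified on the line at every arrow and used for
  another object at the identity alone.\<close>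

definition points_limit :: "('o, 'm, 'n) psh \<Rightarrow> 'o \<Rightarrow> nat \<Rightarrow> (nat \<Rightarrow> nat)
    \<Rightarrow> (nat \<times> nat \<times> ('m \<Rightarrow> 'r \<times> 'r \<Rightarrow> 'r \<times> 'r)) set \<Rightarrow> nat \<Rightarrow> (nat \<Rightarrow> 'm \<Rightarrow> 'r \<times> 'r \<Rightarrow> 'r \<times> 'r) \<Rightarrow> 'm \<Rightarrow> bool" where
  "points_limit F c m n E k p f \<longleftrightarrow>
     (\<forall>\<psi>. (\<forall>i<m. \<psi> i \<in> psh_maps (Dom C f) (inf_psh R (n i)) F) \<and>
        (\<forall>(i, j, u)\<in>E. \<forall>g\<in>over f. \<forall>x\<in>inf_points (RD g) (n i).
           \<psi> j g (u (f \<cdot> g) x) = \<psi> i g x)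
      \<longrightarrow> (\<exists>!\<chi>. \<chi> \<in> psh_maps (Dom C f) (inf_psh R k) F \<and>
            (\<forall>i<m. \<forall>g\<in>over f. \<forall>x\<in>inf_points (RD g) (n i).
               \<chi> g (p i (f \<cdot> g) x) = \<psi> i g x)))"

definition points_cocone :: "'o \<Rightarrow> nat \<Rightarrow> (nat \<Rightarrow> nat)
    \<Rightarrow> (nat \<times> nat \<times> ('m \<Rightarrow> 'r \<times> 'r \<Rightarrow> 'r \<times> 'r)) set \<Rightarrow> nat \<Rightarrow> (nat \<Rightarrow> 'm \<Rightarrow> 'r \<times> 'r \<Rightarrow> 'r \<times> 'r) \<Rightarrow> bool" where
  "points_cocone c m n E k p \<longleftrightarrow> finite E \<and> 1 \<le> k \<and> k \<le> 3 \<and>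
     (\<forall>i<m. 1 \<le> n i \<and> n i \<le> 3 \<and> p i \<in> psh_maps c (inf_psh R (n i)) (inf_psh R k)) \<and>
     (\<forall>(i, j, u)\<in>E. i < m \<and> j < m \<and> u \<in> psh_maps c (inf_psh R (n i)) (inf_psh R (n j)) \<and>
        (\<forall>f\<in>into C c. \<forall>x\<in>inf_points (RD f) (n i). p j f (u f x) = p i f x))"

text \<open>The bijection between maps out of spectra and maps out of points carries a cocone over,
  and with it existence and uniqueness of the mediating map.\<close>

lemma exp_is_limit_of_points:
  assumes co: "points_cocone c m n E k p"
    and lim: "\<And>f. f \<in> into C c \<Longrightarrow> points_limit F c m n E k p f"
  shows "exp_is_limit C F c m (\<lambda>i. wspec c (n i)) ((\<lambda>(i, j, u). (i, j, spec_map c (n i) (n j) u)) ` E)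
    (wspec c k) (\<lambda>i. spec_map c (n i) k (p i))"
  unfolding exp_is_limit_def
proof (intro ballI allI impI)
  fix f \<psi>
  assume f: "f \<in> into C c"
    and "(\<forall>i<m. \<psi> i \<in> maps C (Dom C f) (pullback C (wspec c (n i)) f) (loc C F)) \<and>
      (\<forall>(i, j, \<phi>)\<in>(\<lambda>(i, j, u). (i, j, spec_map c (n i) (n j) u)) ` E.
        maps_comp C (Dom C f) (pullback C (wspec c (n i)) f) (\<psi> j) (maps_res C f \<phi>) = \<psi> i)"
  then have \<psi>: "\<And>i. i < m \<Longrightarrow> \<psi> i \<in> maps C (Dom C f) (pullback C (wspec c (n i)) f) (loc C F)"
    and edge: "\<And>i j u. (i, j, u) \<in> E \<Longrightarrow>
      maps_comp C (Dom C f) (pullback C (wspec c (n i)) f) (\<psi> j) (maps_res C f (spec_map c (n i) (n j) u)) = \<psi> i"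
    by auto
  have k: "1 \<le> k" "k \<le> 3" using co by (auto simp: points_cocone_def)
  have n: "1 \<le> n i" "n i \<le> 3" if "i < m" for i using co that by (auto simp: points_cocone_def)
  have p: "p i \<in> psh_maps c (inf_psh R (n i)) (inf_psh R k)" if "i < m" for i
    using co that by (auto simp: points_cocone_def)
  let ?\<psi> = "\<lambda>i. to_points c (n i) f (\<psi> i)"
  have 1: "\<forall>i<m. ?\<psi> i \<in> psh_maps (Dom C f) (inf_psh R (n i)) F"
    using to_points_in[OF f n \<psi>] by blast
  have 2: "\<forall>(i, j, u)\<in>E. \<forall>g\<in>over f. \<forall>x\<in>inf_points (RD g) (n i).
           ?\<psi> j g (u (f \<cdot> g) x) = ?\<psi> i g x"
  proof (clarify)
    fix i j u g a b assume e: "(i, j, u) \<in> E" and g: "g \<in> over f"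
      and x: "(a, b) \<in> inf_points (RD g) (n i)"
    then have ij: "i < m" "j < m" and u: "u \<in> psh_maps c (inf_psh R (n i)) (inf_psh R (n j))"
      using co by (auto simp: points_cocone_def)
    show "?\<psi> j g (u (f \<cdot> g) (a, b)) = ?\<psi> i g (a, b)"
      using iffD1[OF maps_comp_spec_map_iff[OF f n[OF ij(1)] n[OF ij(2)] u \<psi>[OF ij(1)]] edge[OF e]] g x
      by blast
  qed
  obtain \<chi> where \<chi>: "\<chi> \<in> psh_maps (Dom C f) (inf_psh R k) F"
    "\<And>i g x. \<lbrakk>i < m; g \<in> over f; x \<in> inf_points (RD g) (n i)\<rbrakk> \<Longrightarrow>
               \<chi> g (p i (f \<cdot> g) x) = ?\<psi> i g x"
    and uniq: "\<And>\<chi>'. \<lbrakk>\<chi>' \<in> psh_maps (Dom C f) (inf_psh R k) F;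
       \<forall>i<m. \<forall>g\<in>over f. \<forall>x\<in>inf_points (RD g) (n i).
               \<chi>' g (p i (f \<cdot> g) x) = ?\<psi> i g x\<rbrakk> \<Longrightarrow> \<chi>' = \<chi>"
    using lim[OF f, unfolded points_limit_def, rule_format, OF conjI[OF 1 2]] by blast
  show "\<exists>!\<chi>. \<chi> \<in> maps C (Dom C f) (pullback C (wspec c k) f) (loc C F) \<and>
         (\<forall>i<m. maps_comp C (Dom C f) (pullback C (wspec c (n i)) f) \<chi>
                   (maps_res C f (spec_map c (n i) k (p i))) = \<psi> i)"
  proof (rule ex1I[of _ "of_points c k f \<chi>"], intro conjI allI impI)
    show "of_points c k f \<chi> \<in> maps C (Dom C f) (pullback C (wspec c k) f) (loc C F)"
      by (rule of_points_in[OF f k \<chi>(1)])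
    show "maps_comp C (Dom C f) (pullback C (wspec c (n i)) f) (of_points c k f \<chi>)
                   (maps_res C f (spec_map c (n i) k (p i))) = \<psi> i" if i: "i < m" for i
      by (rule iffD2[OF maps_comp_spec_map_iff[OF f n[OF i] k p[OF i] \<psi>[OF i]]])
        (use \<chi>(2)[OF i] in \<open>simp add: to_of_points[OF f k \<chi>(1)]\<close>)
  next
    fix \<chi>' assume "\<chi>' \<in> maps C (Dom C f) (pullback C (wspec c k) f) (loc C F) \<and>
         (\<forall>i<m. maps_comp C (Dom C f) (pullback C (wspec c (n i)) f) \<chi>'
                   (maps_res C f (spec_map c (n i) k (p i))) = \<psi> i)"
    then have \<chi>': "\<chi>' \<in> maps C (Dom C f) (pullback C (wspec c k) f) (loc C F)"
      and e: "\<And>i. i < m \<Longrightarrow> maps_comp C (Dom C f) (pullback C (wspec c (n i)) f) \<chi>'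
                   (maps_res C f (spec_map c (n i) k (p i))) = \<psi> i" by auto
    have "to_points c k f \<chi>' = \<chi>"
    proof (rule uniq[OF to_points_in[OF f k \<chi>']], intro allI impI)
      fix i assume i: "i < m"
      show "\<forall>g\<in>over f. \<forall>x\<in>inf_points (RD g) (n i).
               to_points c k f \<chi>' g (p i (f \<cdot> g) x) = ?\<psi> i g x"
        by (rule iffD1[OF maps_comp_spec_map_iff[OF f n[OF i] k p[OF i] \<psi>[OF i]] e[OF i]])
    qed
    then show "\<chi>' = of_points c k f \<chi>" using of_to_points[OF f k \<chi>'] by simp
  qed
qed

lemma points_limit_of_exp:
  assumes co: "points_cocone c m n E k p" and f: "f \<in> into C c"
    and lim: "exp_is_limit C F c m (\<lambda>i. wspec c (n i))
      ((\<lambda>(i, j, u). (i, j, spec_map c (n i) (n j) u)) ` E) (wspec c k) (\<lambda>i. spec_map c (n i) k (p i))"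
  shows "points_limit F c m n E k p f"
  unfolding points_limit_def
proof (intro allI impI)
  fix \<psi>
  assume A: "(\<forall>i<m. \<psi> i \<in> psh_maps (Dom C f) (inf_psh R (n i)) F) \<and>
        (\<forall>(i, j, u)\<in>E. \<forall>g\<in>over f. \<forall>x\<in>inf_points (RD g) (n i).
           \<psi> j g (u (f \<cdot> g) x) = \<psi> i g x)"
  then have \<psi>: "\<And>i. i < m \<Longrightarrow> \<psi> i \<in> psh_maps (Dom C f) (inf_psh R (n i)) F"
    and edge: "\<And>i j u g x. \<lbrakk>(i, j, u) \<in> E; g \<in> over f; x \<in> inf_points (RD g) (n i)\<rbrakk>
      \<Longrightarrow> \<psi> j g (u (f \<cdot> g) x) = \<psi> i g x"
    using conjunct1[OF A] bspec[OF conjunct2[OF A]] by auto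
  have k: "1 \<le> k" "k \<le> 3" using co by (auto simp: points_cocone_def)
  have n: "1 \<le> n i" "n i \<le> 3" if "i < m" for i using co that by (auto simp: points_cocone_def)
  have p: "p i \<in> psh_maps c (inf_psh R (n i)) (inf_psh R k)" if "i < m" for i
    using co that by (auto simp: points_cocone_def)
  let ?\<psi> = "\<lambda>i. of_points c (n i) f (\<psi> i)"
  have \<psi>': "?\<psi> i \<in> maps C (Dom C f) (pullback C (wspec c (n i)) f) (loc C F)"
    and tp: "to_points c (n i) f (?\<psi> i) = \<psi> i" if "i < m" for i
    using of_points_in[OF f n[OF that] \<psi>[OF that]] to_of_points[OF f n[OF that] \<psi>[OF that]] by auto
  have 2: "maps_comp C (Dom C f) (pullback C (wspec c (n i)) f) (?\<psi> j)
      (maps_res C f (spec_map c (n i) (n j) u)) = ?\<psi> i" if e: "(i, j, u) \<in> E" for i j u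
  proof -
    from e have ij: "i < m" "j < m" and u: "u \<in> psh_maps c (inf_psh R (n i)) (inf_psh R (n j))"
      using co by (auto simp: points_cocone_def)
    show ?thesis
      by (rule iffD2[OF maps_comp_spec_map_iff[OF f n[OF ij(1)] n[OF ij(2)] u \<psi>'[OF ij(1)]]])
        (use edge[OF e] in \<open>simp add: tp ij\<close>)
  qed
  have "\<exists>!\<chi>. \<chi> \<in> maps C (Dom C f) (pullback C (wspec c k) f) (loc C F) \<and>
         (\<forall>i<m. maps_comp C (Dom C f) (pullback C (wspec c (n i)) f) \<chi>
                   (maps_res C f (spec_map c (n i) k (p i))) = ?\<psi> i)"
    by (rule lim[unfolded exp_is_limit_def, THEN bspec, OF f, THEN spec, THEN mp]) (use \<psi>' 2 in auto)
  then obtain \<chi> where \<chi>: "\<chi> \<in> maps C (Dom C f) (pullback C (wspec c k) f) (loc C F)"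
    "\<And>i. i < m \<Longrightarrow> maps_comp C (Dom C f) (pullback C (wspec c (n i)) f) \<chi>
                   (maps_res C f (spec_map c (n i) k (p i))) = ?\<psi> i"
    and uniq: "\<And>\<chi>'. \<lbrakk>\<chi>' \<in> maps C (Dom C f) (pullback C (wspec c k) f) (loc C F);
       \<forall>i<m. maps_comp C (Dom C f) (pullback C (wspec c (n i)) f) \<chi>'
                   (maps_res C f (spec_map c (n i) k (p i))) = ?\<psi> i\<rbrakk> \<Longrightarrow> \<chi>' = \<chi>"
    by blast
  show "\<exists>!\<chi>. \<chi> \<in> psh_maps (Dom C f) (inf_psh R k) F \<and>
            (\<forall>i<m. \<forall>g\<in>over f. \<forall>x\<in>inf_points (RD g) (n i).
               \<chi> g (p i (f \<cdot> g) x) = \<psi> i g x)"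
  proof (rule ex1I[of _ "to_points c k f \<chi>"], intro conjI allI impI)
    show "to_points c k f \<chi> \<in> psh_maps (Dom C f) (inf_psh R k) F"
      by (rule to_points_in[OF f k \<chi>(1)])
    show "\<forall>g\<in>over f. \<forall>x\<in>inf_points (RD g) (n i).
               to_points c k f \<chi> g (p i (f \<cdot> g) x) = \<psi> i g x" if i: "i < m" for i
      using iffD1[OF maps_comp_spec_map_iff[OF f n[OF i] k p[OF i] \<psi>'[OF i]] \<chi>(2)[OF i]]
      by (simp add: tp[OF i])
  next
    fix \<chi>' assume "\<chi>' \<in> psh_maps (Dom C f) (inf_psh R k) F \<and>
            (\<forall>i<m. \<forall>g\<in>over f. \<forall>x\<in>inf_points (RD g) (n i).
               \<chi>' g (p i (f \<cdot> g) x) = \<psi> i g x)"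
    then have \<chi>': "\<chi>' \<in> psh_maps (Dom C f) (inf_psh R k) F"
      and e: "\<And>i. i < m \<Longrightarrow> \<forall>g\<in>over f. \<forall>x\<in>inf_points (RD g) (n i).
               \<chi>' g (p i (f \<cdot> g) x) = \<psi> i g x" by auto
    have "of_points c k f \<chi>' = \<chi>"
    proof (rule uniq[OF of_points_in[OF f k \<chi>']], intro allI impI)
      fix i assume i: "i < m"
      show "maps_comp C (Dom C f) (pullback C (wspec c (n i)) f) (of_points c k f \<chi>')
                   (maps_res C f (spec_map c (n i) k (p i))) = ?\<psi> i"
        by (rule iffD2[OF maps_comp_spec_map_iff[OF f n[OF i] k p[OF i] \<psi>'[OF i]]])
          (use e[OF i] in \<open>simp add: to_of_points[OF f k \<chi>'] tp[OF i]\<close>)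
    qed
    then show "\<chi>' = to_points c k f \<chi>" using to_of_points[OF f k \<chi>'] by simp
  qed
qed

lemma weil_algebra_Rng: "c \<in> Ob C \<Longrightarrow> weil_algebra (Rng R c) (truncated_weil (Rng R c) n)"
  by (rule cring.weil_algebra_truncated_weil[OF cring_Rng])

text \<open>The one place where \<open>microlinear\<close> is unfolded. From here on it suffices to
  check that a diagram of points is a cocone and becomes a limit on the line.\<close>

lemma microlinear_points_limit:
  assumes c: "c \<in> Ob C" and F: "microlinear C R F" and co: "points_cocone c m n E k p"
    and lim: "\<And>f. f \<in> into C c \<Longrightarrow> points_limit (line R) c m n E k p f"
  shows "points_limit F c m n E k p (Id C c)"
proof (rule points_limit_of_exp[OF co into_Id[OF c]])
  let ?E = "(\<lambda>(i, j, u). (i, j, spec_map c (n i) (n j) u)) ` E"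
  have k: "1 \<le> k" "k \<le> 3" using co by (auto simp: points_cocone_def)
  have n: "1 \<le> n i" "n i \<le> 3" if "i < m" for i using co that by (auto simp: points_cocone_def)
  have "cocone C c m (\<lambda>i. wspec c (n i)) ?E (wspec c k) (\<lambda>i. spec_map c (n i) k (p i))"
    unfolding cocone_def
  proof (intro conjI)
    show "finite ?E" using co by (simp add: points_cocone_def)
    show "\<forall>i<m. spec_map c (n i) k (p i) \<in> maps C c (wspec c (n i)) (wspec c k)"
      using co spec_map_in[OF n k] by (auto simp: points_cocone_def)
    show "\<forall>(i, j, \<phi>)\<in>?E. i < m \<and> j < m \<and> \<phi> \<in> maps C c (wspec c (n i)) (wspec c (n j))"
      using co spec_map_in[OF n n] by (fastforce simp: points_cocone_def)
    have "maps_comp C c (wspec c (n i)) (spec_map c (n j) k (p j)) (spec_map c (n i) (n j) u) =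
         spec_map c (n i) k (p i)" if "(i, j, u) \<in> E" for i j u
      using co that by (intro spec_map_comp n) (auto simp: points_cocone_def)
    then show "\<forall>(i, j, \<phi>)\<in>?E. maps_comp C c (wspec c (n i)) (spec_map c (n j) k (p j)) \<phi> =
         spec_map c (n i) k (p i)" by auto
  qed
  then show "exp_is_limit C F c m (\<lambda>i. wspec c (n i)) ?E (wspec c k) (\<lambda>i. spec_map c (n i) k (p i))"
    using F[unfolded microlinear_def, rule_format, OF c, of m "\<lambda>i. truncated_weil (Rng R c) (n i)"
        "truncated_weil (Rng R c) k" ?E "\<lambda>i. spec_map c (n i) k (p i)"]
      exp_is_limit_of_points[OF co lim] weil_algebra_Rng[OF c]
    by (simp add: wspec_def)
qed

end

section \<open>Two limit diagrams on the line\<close>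

locale kl_line = cring_sheaf +
  assumes kock_lawvere: "kock_lawvere C R"
begin

text \<open>Surjectivity in the Kock-Lawvere axiom. The transport between points and spectra is
  formulated over an arrow into \<open>c\<close>; here that arrow is the identity.\<close>

lemma line_map_eval:
  assumes c: "c \<in> Ob C" and n: "1 \<le> n" "n \<le> 3"
    and \<phi>: "\<phi> \<in> psh_maps c (inf_psh R n) (line R)"
  obtains w where "w \<in> carrier (truncated_weil (Rng R c) n)"
    and "\<And>f x. \<lbrakk>f \<in> into C c; x \<in> inf_points (RD f) n\<rbrakk>
      \<Longrightarrow> \<phi> f x = eval_at f n w x"
proof -
  note I = into_Id[OF c]
  have D: "Dom C (Id C c) = c" using c by (rule Id_Dom)
  let ?\<psi> = "of_points c n (Id C c) \<phi>"
  have \<phi>': "\<phi> \<in> maps C (Dom C (Id C c)) (loc C (inf_psh R n)) (loc C (line R))"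
    using \<phi> by (simp add: D)
  have "?\<psi> \<in> maps C c (wspec c n) (loc C (line R))"
    using of_points_in[OF I n \<phi>'] by (simp add: D maps_pullback_Id c)
  moreover have "bij_betw (\<lambda>w. \<lambda>f\<in>into C c. \<lambda>h\<in>El (wspec c n) f. h w)
      (carrier (truncated_weil (Rng R c) n)) (maps C c (wspec c n) (loc C (line R)))"
    using kock_lawvere c weil_algebra_Rng[OF c] unfolding kock_lawvere_def wspec_def by blast
  ultimately obtain w where w: "w \<in> carrier (truncated_weil (Rng R c) n)"
    and \<psi>: "?\<psi> = (\<lambda>f\<in>into C c. \<lambda>h\<in>El (wspec c n) f. h w)"
    unfolding bij_betw_def by blast
  show thesis
  proof (rule that[OF w])
    fix f x assume f: "f \<in> into C c" and x: "x \<in> inf_points (RD f) n"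
    have "\<phi> f x = to_points c n (Id C c) ?\<psi> f x"
      using to_of_points[OF I n \<phi>'] by simp
    also have "\<dots> = ?\<psi> f (wpt c n f x)" using f x by (simp add: to_points_def D)
    also have "\<dots> = wpt c n f x w" unfolding \<psi> using f wpt_in[OF f n x] by simp
    also have "\<dots> = eval_at f n w x"
      using w by (simp add: wpt_def weil_point_def)
    finally show "\<phi> f x = eval_at f n w x" .
  qed
qed

text \<open>Injectivity in the Kock-Lawvere axiom: coefficients may be compared once two polynomials
  agree at the points of all stages over \<open>c\<close>.\<close>

lemma weil_eval_inj:
  assumes c: "c \<in> Ob C" and n: "1 \<le> n" "n \<le> 3"
    and w: "w \<in> carrier (truncated_weil (Rng R c) n)" "w' \<in> carrier (truncated_weil (Rng R c) n)"
    and eq: "\<And>f x. \<lbrakk>f \<in> into C c; x \<in> inf_points (RD f) n\<rbrakk>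
      \<Longrightarrow> eval_at f n w x = eval_at f n w' x"
  shows "w = w'"
proof -
  have "inj_on (\<lambda>w. \<lambda>f\<in>into C c. \<lambda>h\<in>El (wspec c n) f. h w) (carrier (truncated_weil (Rng R c) n))"
    using kock_lawvere c weil_algebra_Rng[OF c] unfolding kock_lawvere_def wspec_def
    by (blast intro: bij_betw_imp_inj_on)
  moreover have "(\<lambda>f\<in>into C c. \<lambda>h\<in>El (wspec c n) f. h w) = (\<lambda>f\<in>into C c. \<lambda>h\<in>El (wspec c n) f. h w')"
  proof (intro restrict_ext)
    fix f h assume f: "f \<in> into C c" and h: "h \<in> El (wspec c n) f"
    have "h v = eval_at f n v (wco c n h)"
      if "v \<in> carrier (truncated_weil (Rng R c) n)" for v
      using that fun_cong[OF wpt_wco[OF f n h], of v] by (simp add: wpt_def weil_point_def)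
    then show "h w = h w'" using w eq[OF f wco_in[OF f n h]] by simp
  qed
  ultimately show ?thesis using w by (rule inj_onD)
qed

lemma weil_eval_map:
  assumes c: "c \<in> Ob C" and n: "1 \<le> n" "n \<le> 3" and w: "w \<in> carrier (truncated_weil (Rng R c) n)"
  shows "(\<lambda>f\<in>into C c. \<lambda>x\<in>inf_points (RD f) n. eval_at f n w x)
    \<in> psh_maps c (inf_psh R n) (line R)"
proof (rule inf_maps_memI)
  fix f x assume f: "f \<in> into C c" and x: "x \<in> inf_points (RD f) n"
  show "eval_at f n w x \<in> Sec (line R) (Dom C f)"
    using cring_hom.weil_eval_closed[OF cring_hom_RRes[OF f] w n(1) x] by simp
  fix g assume g: "g \<in> over f"
  have "x \<in> carrier (RD f) \<times> carrier (RD f)"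
    using x by (auto simp: inf_points_def)
  then show "Res (line R) g (eval_at f n w x) =
      weil_eval (RD (f \<cdot> g)) (RRes R (f \<cdot> g)) n w (res_pair g x)"
    using weil_eval_hom[OF cring_hom_RRes[OF f] cring_hom_RRes[OF g] w n(1) _ RRes_comp[OF f g]]
      Dom_comp[OF f g] by simp
qed

text \<open>The familiar cancellation of a universally quantified d \<in> D, as the case
  \<open>n = 1\<close> of comparing coefficients.\<close>

lemma line_affine_eqD:
  assumes c: "c \<in> Ob C" and "a \<in> carrier (Rng R c)" "b \<in> carrier (Rng R c)"
      "a' \<in> carrier (Rng R c)" "b' \<in> carrier (Rng R c)"
    and eq: "\<And>f d. \<lbrakk>f \<in> into C c; d \<in> DD f\<rbrakk> \<Longrightarrow>
      RRes R f a \<oplus>\<^bsub>RD f\<^esub> RRes R f b \<otimes>\<^bsub>RD f\<^esub> d =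
      RRes R f a' \<oplus>\<^bsub>RD f\<^esub> RRes R f b' \<otimes>\<^bsub>RD f\<^esub> d"
  shows "a = a'" "b = b'"
proof -
  let ?v = "\<lambda>a b. \<lambda>i\<in>{..1::nat}. if i = 0 then a else b"
  have v: "?v a b \<in> carrier (truncated_weil (Rng R c) 1)" "?v a' b' \<in> carrier (truncated_weil (Rng R c) 1)"
    using assms by (auto simp: tw_carrier)
  have "?v a b = ?v a' b'"
  proof (rule weil_eval_inj[OF c _ _ v])
    fix f x assume f: "f \<in> into C c" and "x \<in> inf_points (RD f) 1"
    then obtain d e where x: "x = (d, e)" "d \<in> DD f" by (auto simp: inf_points_def)
    interpret K: cring "RD f" using f by (intro cring_Rng) simp
    show "eval_at f 1 (?v a b) x = eval_at f 1 (?v a' b') x"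
      using eq[OF f x(2)] by (simp add: weil_eval_def x(1))
  qed auto
  from fun_cong[OF this, of 0] fun_cong[OF this, of 1] show "a = a'" "b = b'" by simp_all
qed

end

section \<open>Maps between D, D(2) and D x D given by ring formulas, and two cocones of
  them\<close>

context cring_sheaf
begin

lemma inf_points_1: "c \<in> Ob C \<Longrightarrow> x \<in> inf_points (Rng R c) 1 \<longleftrightarrow> (\<exists>d\<in>Sec (inf_D R) c. x = (d, \<zero>\<^bsub>Rng R c\<^esub>))"
  using cring.cring_simprules(2,26,27)[OF cring_Rng, of c] by (auto simp: inf_points_def)

lemma inf_points_D: "c \<in> Ob C \<Longrightarrow> (d, e) \<in> inf_points (Rng R c) 3 \<longleftrightarrow> d \<in> Sec (inf_D R) c \<and> e \<in> Sec (inf_D R) c"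
  by (auto simp: inf_points_def)

lemma inf_origin: "c \<in> Ob C \<Longrightarrow> (\<zero>\<^bsub>Rng R c\<^esub>, \<zero>\<^bsub>Rng R c\<^esub>) \<in> inf_points (Rng R c) n"
  using cring.cring_simprules(2,26,27)[OF cring_Rng, of c] by (simp add: inf_points_def)

lemma inf_axes:
  assumes "c \<in> Ob C" "d \<in> Sec (inf_D R) c" "1 \<le> n"
  shows "(d, \<zero>\<^bsub>Rng R c\<^esub>) \<in> inf_points (Rng R c) n" "2 \<le> n \<Longrightarrow> (\<zero>\<^bsub>Rng R c\<^esub>, d) \<in> inf_points (Rng R c) n"
proof -
  interpret K: cring "Rng R c" using assms by (intro cring_Rng)
  show "(d, \<zero>\<^bsub>Rng R c\<^esub>) \<in> inf_points (Rng R c) n" "2 \<le> n \<Longrightarrow> (\<zero>\<^bsub>Rng R c\<^esub>, d) \<in> inf_points (Rng R c) n"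
    using assms by (auto simp: inf_points_def)
qed

lemma inf_D_mult:
  assumes "c \<in> Ob C" "a \<in> carrier (Rng R c)" "d \<in> Sec (inf_D R) c"
  shows "a \<otimes>\<^bsub>Rng R c\<^esub> d \<in> Sec (inf_D R) c"
proof -
  interpret K: cring "Rng R c" using assms by (intro cring_Rng)
  have "(a \<otimes>\<^bsub>Rng R c\<^esub> d) \<otimes>\<^bsub>Rng R c\<^esub> (a \<otimes>\<^bsub>Rng R c\<^esub> d) =
    a \<otimes>\<^bsub>Rng R c\<^esub> a \<otimes>\<^bsub>Rng R c\<^esub> (d \<otimes>\<^bsub>Rng R c\<^esub> d)"
    using assms by (simp add: K.m_ac)
  then show ?thesis using assms by simp
qed

lemma inf_D_res:
  "\<lbrakk>f \<in> into C c; d \<in> Sec (inf_D R) c\<rbrakk> \<Longrightarrow> RRes R f d \<in> DD f"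
  using RRes_simps(2)[of f c d d] by (auto simp: RRes_simps)

definition point_map where
  "point_map c n s = (\<lambda>f\<in>into C c. \<lambda>x\<in>inf_points (RD f) n. s (RD f) x)"

definition to_origin :: "'r ring \<Rightarrow> 'r \<times> 'r \<Rightarrow> 'r \<times> 'r" where
  "to_origin K = (\<lambda>x. (\<zero>\<^bsub>K\<^esub>, \<zero>\<^bsub>K\<^esub>))"

definition to_fst_axis :: "'r ring \<Rightarrow> 'r \<times> 'r \<Rightarrow> 'r \<times> 'r" where
  "to_fst_axis K = (\<lambda>(d, e). (d, \<zero>\<^bsub>K\<^esub>))"

text \<open>The second axis is entered with the first coordinate, since D consists of pairs (d,
  0).\<close>

definition to_snd_axis :: "'r ring \<Rightarrow> 'r \<times> 'r \<Rightarrow> 'r \<times> 'r" where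
  "to_snd_axis K = (\<lambda>(d, e). (\<zero>\<^bsub>K\<^esub>, d))"

definition to_product :: "'r ring \<Rightarrow> 'r \<times> 'r \<Rightarrow> 'r \<times> 'r" where
  "to_product K = (\<lambda>(d, e). (d \<otimes>\<^bsub>K\<^esub> e, \<zero>\<^bsub>K\<^esub>))"

lemmas point_fun_defs = to_origin_def to_fst_axis_def to_snd_axis_def to_product_def

lemma point_map_in:
  assumes "\<And>f x. \<lbrakk>f \<in> into C c; x \<in> inf_points (RD f) n\<rbrakk> \<Longrightarrow>
      s (RD f) x \<in> inf_points (RD f) k"
    and "\<And>f g x. \<lbrakk>f \<in> into C c; g \<in> over f; x \<in> inf_points (RD f) n\<rbrakk> \<Longrightarrow>
      res_pair g (s (RD f) x) =
      s (RD g) (res_pair g x)"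
  shows "point_map c n s \<in> psh_maps c (inf_psh R n) (inf_psh R k)"
  unfolding point_map_def using assms by (intro inf_maps_memI) auto

lemma to_origin_in: "1 \<le> k \<Longrightarrow> point_map c n to_origin \<in> psh_maps c (inf_psh R n) (inf_psh R k)"
  by (rule point_map_in) (auto simp: to_origin_def RRes_simps(5) intro!: inf_origin)

lemma to_fst_axis_in: "1 \<le> k \<Longrightarrow> point_map c n to_fst_axis \<in> psh_maps c (inf_psh R n) (inf_psh R k)"
  by (rule point_map_in) (auto simp: to_fst_axis_def RRes_simps(5) inf_points_def[of _ n] intro!: inf_axes(1))

lemma to_snd_axis_in: "2 \<le> k \<Longrightarrow> point_map c n to_snd_axis \<in> psh_maps c (inf_psh R n) (inf_psh R k)"
  by (rule point_map_in) (auto simp: to_snd_axis_def RRes_simps(5) inf_points_def[of _ n] intro!: inf_axes(2))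

lemma to_product_in: "1 \<le> k \<Longrightarrow> point_map c n to_product \<in> psh_maps c (inf_psh R n) (inf_psh R k)"
proof (rule point_map_in)
  fix f x assume "1 \<le> k" and f: "f \<in> into C c" and "x \<in> inf_points (RD f) n"
  moreover from this obtain d e where "x = (d, e)" "d \<in> carrier (RD f)"
      "e \<in> DD f"
    by (auto simp: inf_points_def)
  ultimately show "to_product (RD f) x \<in> inf_points (RD f) k"
    by (simp add: to_product_def inf_axes(1) inf_D_mult del: inf_D_simps)
next
  fix f g x assume "g \<in> over f" "x \<in> inf_points (RD f) n"
  moreover from this obtain d e where "x = (d, e)" "d \<in> carrier (RD f)"
      "e \<in> carrier (RD f)"
    by (auto simp: inf_points_def)
  ultimately show "res_pair g (to_product (RD f) x) =
      to_product (RD g) (res_pair g x)"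
    by (simp add: to_product_def RRes_simps(2,5))
qed

lemma point_map_apply:
  "\<lbrakk>f \<in> into C c; g \<in> over f; x \<in> inf_points (RD g) n\<rbrakk> \<Longrightarrow>
    point_map c n s (f \<cdot> g) x = s (RD g) x"
  by (simp add: point_map_def)

text \<open>
  Two cocones with vertices \<open>D\<close>, \<open>D(2)\<close> and \<open>D \<times> D\<close>: the two axes \<open>D \<rightarrow> D(2)\<close>, and the multiplication
  \<open>D \<times> D \<rightarrow> D\<close>.  Instead of a vertex \<open>D(0) = 1\<close> there is a copy of \<open>D\<close> on which the edges through the
  origin force a cocone to be constant.
\<close>

abbreviation axes_edges where
  "axes_edges c \<equiv> {(0, 1, point_map c 1 to_origin), (0, 2, point_map c 1 to_origin)}"

abbreviation axes_legs :: "'o \<Rightarrow> nat \<Rightarrow> 'm \<Rightarrow> 'r \<times> 'r \<Rightarrow> 'r \<times> 'r" where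
  "axes_legs c i \<equiv> point_map c 1 (if i = 0 then to_origin else if i = 1 then to_fst_axis else to_snd_axis)"

text \<open>Vertex 0 is D x D and vertex 1 is D. On each of the three maps D \<rightarrow> D x D the
  product of the coordinates vanishes; compatibility with them makes a function on D x D take one
  constant value on both axes.\<close>

abbreviation product_edges where
  "product_edges c \<equiv> {(1, 0, point_map c 1 to_origin), (1, 0, point_map c 1 to_fst_axis),
     (1, 0, point_map c 1 to_snd_axis)}"

abbreviation product_legs :: "'o \<Rightarrow> nat \<Rightarrow> 'm \<Rightarrow> 'r \<times> 'r \<Rightarrow> 'r \<times> 'r" where
  "product_legs c i \<equiv> (if i = 0 then point_map c 3 to_product else point_map c 1 to_origin)"

lemma point_map_point_map:
  assumes u: "point_map c n s \<in> psh_maps c (inf_psh R n) (inf_psh R k)"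
    and f: "f \<in> into C c" and x: "x \<in> inf_points (RD f) n"
  shows "point_map c k t f (point_map c n s f x) = t (RD f) (s (RD f) x)"
  using inf_maps_closed[OF u f x] f x by (simp add: point_map_def)

lemma axes_cocone: "points_cocone c 3 (\<lambda>_. 1) (axes_edges c) 2 (axes_legs c)"
proof -
  have "point_map c 1 t f (point_map c 1 to_origin f x) = point_map c 1 to_origin f x"
    if f: "f \<in> into C c" and x: "x \<in> inf_points (RD f) 1"
      and t: "t = to_fst_axis \<or> t = to_snd_axis" for t f x
    unfolding point_map_point_map[OF to_origin_in[OF order_refl] f x] using f x t
    by (auto simp: point_fun_defs point_map_def)
  moreover have "i = 0 \<or> i = 1 \<or> i = 2" if "i < 3" for i :: nat using that by auto
  ultimately show ?thesis
    using to_origin_in[of 2 c 1] to_origin_in[of 1 c 1] to_fst_axis_in[of 2 c 1] to_snd_axis_in[of 2 c 1]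
    unfolding points_cocone_def by auto
qed

lemma product_cocone: "points_cocone c 2 (\<lambda>i. if i = 0 then 3 else 1) (product_edges c) 1 (product_legs c)"
proof -
  have "point_map c 3 to_product f (point_map c 1 t f x) = point_map c 1 to_origin f x"
    if f: "f \<in> into C c" and x: "x \<in> inf_points (RD f) 1"
      and t: "t = to_origin \<or> t = to_fst_axis \<or> t = to_snd_axis" for t f x
  proof -
    interpret K: cring "RD f" using f by (intro cring_Rng) simp
    have "point_map c 1 t \<in> psh_maps c (inf_psh R 1) (inf_psh R 3)"
      using t to_origin_in[of 3 c 1] to_fst_axis_in[of 3 c 1] to_snd_axis_in[of 3 c 1] by auto
    note eq = point_map_point_map[OF this f x, of to_product]
    obtain d e where "x = (d, e)" "d \<in> carrier (RD f)"
      using x by (auto simp: inf_points_def)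
    then show ?thesis
      unfolding eq using f x t by (auto simp: point_fun_defs point_map_def)
  qed
  moreover have "i = 0 \<or> i = 1" if "i < 2" for i :: nat using that by auto
  ultimately show ?thesis
    using to_origin_in[of 3 c 1] to_origin_in[of 1 c 1] to_fst_axis_in[of 3 c 1] to_snd_axis_in[of 3 c 1]
      to_product_in[of 1 c 3]
    unfolding points_cocone_def by auto
qed

end

section \<open>The two cocones become limits on the line\<close>

context kl_line
begin

text \<open>A compatible family consists of functions a + b d and a + c e with the same value at 0;
  the one function on D(2) that restricts to both is a + b d + c e.\<close>

lemma axes_limit:
  assumes f: "f \<in> into C c"
  shows "points_limit (line R) c 3 (\<lambda>_. 1) (axes_edges c) 2 (axes_legs c) f"
  unfolding points_limit_def
proof (intro allI impI)
  let ?c = "Dom C f"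
  let ?K = "Rng R ?c"
  have c: "?c \<in> Ob C" using f by simp
  interpret K: cring ?K by (rule cring_Rng[OF c])
  have all3: "(\<forall>i<3. P i) \<longleftrightarrow> P 0 \<and> P 1 \<and> P 2" for P :: "nat \<Rightarrow> bool"
    by (auto simp: numeral_eq_Suc less_Suc_eq)
  fix \<psi> :: "nat \<Rightarrow> 'b \<Rightarrow> 'c \<times> 'c \<Rightarrow> 'c"
  assume A: "(\<forall>i<3. \<psi> i \<in> maps C ?c (loc C (inf_psh R 1)) (loc C (line R))) \<and>
      (\<forall>(i, j, u)\<in>axes_edges c. \<forall>g\<in>into C ?c. \<forall>x\<in>inf_points (RD g) 1.
         \<psi> j g (u (f \<cdot> g) x) = \<psi> i g x)"
  then have \<psi>: "\<psi> 1 \<in> maps C ?c (loc C (inf_psh R 1)) (loc C (line R))"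
    "\<psi> 2 \<in> maps C ?c (loc C (inf_psh R 1)) (loc C (line R))" by (simp_all add: all3)
  have e: "\<psi> j g (zero_at g, zero_at g) = \<psi> 0 g x"
    if g: "g \<in> into C ?c" and x: "x \<in> inf_points (RD g) 1" and j: "j = 1 \<or> j = 2" for j g x
  proof -
    have "(0, j, point_map c 1 to_origin) \<in> axes_edges c" using j by auto
    from bspec[OF conjunct2[OF A] this] have "\<psi> j g (point_map c 1 to_origin (f \<cdot> g) x) = \<psi> 0 g x"
      using g x by simp
    then show ?thesis by (simp only: point_map_apply[OF f g x] to_origin_def)
  qed
  obtain w1 where w1: "w1 \<in> carrier (truncated_weil ?K 1)"
    and \<psi>1: "\<And>g x. \<lbrakk>g \<in> into C ?c; x \<in> inf_points (RD g) 1\<rbrakk>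
      \<Longrightarrow> \<psi> 1 g x = eval_at g 1 w1 x"
    using line_map_eval[OF c _ _ \<psi>(1)] by auto
  obtain w2 where w2: "w2 \<in> carrier (truncated_weil ?K 1)"
    and \<psi>2: "\<And>g x. \<lbrakk>g \<in> into C ?c; x \<in> inf_points (RD g) 1\<rbrakk>
      \<Longrightarrow> \<psi> 2 g x = eval_at g 1 w2 x"
    using line_map_eval[OF c _ _ \<psi>(2)] by auto
  have wc: "w1 0 \<in> carrier ?K" "w1 1 \<in> carrier ?K" "w2 0 \<in> carrier ?K" "w2 1 \<in> carrier ?K"
    using tw_nth[OF w1] tw_nth[OF w2] by auto
  have D: "Dom C (Id C ?c) = ?c" using c by (rule Id_Dom)
  have o: "(\<zero>\<^bsub>?K\<^esub>, \<zero>\<^bsub>?K\<^esub>) \<in> inf_points ?K n" for n by (simp add: inf_points_def)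
  \<comment> \<open>Both edges are evaluated at the origin of the identity stage, where the
    polynomials reduce to their constant terms.\<close>
  have "w1 0 = w2 0"
    using e[OF into_Id[OF c], of "(\<zero>\<^bsub>?K\<^esub>, \<zero>\<^bsub>?K\<^esub>)" 1]
      e[OF into_Id[OF c], of "(\<zero>\<^bsub>?K\<^esub>, \<zero>\<^bsub>?K\<^esub>)" 2] \<psi>1[OF into_Id[OF c], of "(\<zero>\<^bsub>?K\<^esub>, \<zero>\<^bsub>?K\<^esub>)"]
      \<psi>2[OF into_Id[OF c], of "(\<zero>\<^bsub>?K\<^esub>, \<zero>\<^bsub>?K\<^esub>)"] o wc
    by (simp add: D weil_eval_def RRes_Id[OF c])
  note w0 = this
  let ?w = "\<lambda>i\<in>{..2::nat}. if i = 0 then w1 0 else if i = 1 then w1 1 else w2 1"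
  have w: "?w \<in> carrier (truncated_weil ?K 2)" using wc by (auto simp: tw_carrier)
  let ?\<chi> = "\<lambda>g\<in>into C ?c. \<lambda>x\<in>inf_points (RD g) 2. eval_at g 2 ?w x"
  show "\<exists>!\<chi>. \<chi> \<in> maps C ?c (loc C (inf_psh R 2)) (loc C (line R)) \<and>
      (\<forall>i<3. \<forall>g\<in>into C ?c. \<forall>x\<in>inf_points (RD g) 1. \<chi> g (axes_legs c i (f \<cdot> g) x) = \<psi> i g x)"
  proof (rule ex1I[of _ ?\<chi>], intro conjI)
    show "?\<chi> \<in> maps C ?c (loc C (inf_psh R 2)) (loc C (line R))"
      by (rule weil_eval_map[OF c _ _ w]) auto
    have "?\<chi> g (axes_legs c i (f \<cdot> g) x) = \<psi> i g x"
      if g: "g \<in> into C ?c" and x: "x \<in> inf_points (RD g) 1" and i: "i = 0 \<or> i = 1 \<or> i = 2" for g x i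
    proof -
      have cg: "Dom C g \<in> Ob C" using g by simp
      interpret L: cring "RD g" by (rule cring_Rng[OF cg])
      note wr = wc[THEN RRes_simps(1)[OF g]]
      obtain d where d: "d \<in> DD g" "x = (d, zero_at g)"
        using x inf_points_1[OF cg] by blast
      then have dc: "d \<in> carrier (RD g)" by simp
      note ax = inf_axes[OF cg d(1)]
      show ?thesis
        unfolding point_map_apply[OF f g x]
        using i e[OF g x, of 1] \<psi>1[OF g x] \<psi>2[OF g x] \<psi>1[OF g inf_origin[OF cg]] wr dc w0 g x d(2) ax[of 1] ax[of 2] inf_origin[OF cg, of 2]
        by (elim disjE) (simp_all add: point_fun_defs weil_eval_def)
    qed
    then show "\<forall>i<3. \<forall>g\<in>into C ?c. \<forall>x\<in>inf_points (RD g) 1. ?\<chi> g (axes_legs c i (f \<cdot> g) x) = \<psi> i g x"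
      unfolding all3 by blast
  next
    fix \<chi>
    assume B: "\<chi> \<in> maps C ?c (loc C (inf_psh R 2)) (loc C (line R)) \<and>
      (\<forall>i<3. \<forall>g\<in>into C ?c. \<forall>x\<in>inf_points (RD g) 1. \<chi> g (axes_legs c i (f \<cdot> g) x) = \<psi> i g x)"
    then have \<chi>: "\<chi> \<in> maps C ?c (loc C (inf_psh R 2)) (loc C (line R))" ..
    obtain v where v: "v \<in> carrier (truncated_weil ?K 2)"
      and \<chi>v: "\<And>g x. \<lbrakk>g \<in> into C ?c; x \<in> inf_points (RD g) 2\<rbrakk>
        \<Longrightarrow> \<chi> g x = eval_at g 2 v x"
      using line_map_eval[OF c _ _ \<chi>] by auto
    have vc: "v 0 \<in> carrier ?K" "v 1 \<in> carrier ?K" "v 2 \<in> carrier ?K"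
      using tw_nth[OF v] by auto
    \<comment> \<open>The legs restrict the polynomial of \<open>\<chi>\<close> to the axes, where
      its coefficients can be compared with those of the two given functions.\<close>
    have ax: "RRes R g (v 0) \<oplus>\<^bsub>RD g\<^esub> RRes R g (v 1) \<otimes>\<^bsub>RD g\<^esub> d =
        RRes R g (w1 0) \<oplus>\<^bsub>RD g\<^esub> RRes R g (w1 1) \<otimes>\<^bsub>RD g\<^esub> d"
      "RRes R g (v 0) \<oplus>\<^bsub>RD g\<^esub> RRes R g (v 2) \<otimes>\<^bsub>RD g\<^esub> d =
        RRes R g (w2 0) \<oplus>\<^bsub>RD g\<^esub> RRes R g (w2 1) \<otimes>\<^bsub>RD g\<^esub> d"
      if g: "g \<in> into C ?c" and d: "d \<in> DD g" for g d
    proof -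
      have cg: "Dom C g \<in> Ob C" using g by simp
      interpret L: cring "RD g" by (rule cring_Rng[OF cg])
      let ?x = "(d, zero_at g)"
      note a = inf_axes[OF cg d]
      have x: "?x \<in> inf_points (RD g) 1" by (rule a) simp
      have leg: "\<chi> g (axes_legs c 1 (f \<cdot> g) ?x) = \<psi> 1 g ?x" "\<chi> g (axes_legs c 2 (f \<cdot> g) ?x) = \<psi> 2 g ?x"
        using conjunct2[OF B] g x unfolding all3 by blast+
      have dc: "d \<in> carrier (RD g)" using d by simp
      note r = wc[THEN RRes_simps(1)[OF g]] vc[THEN RRes_simps(1)[OF g]]
      show "RRes R g (v 0) \<oplus>\<^bsub>RD g\<^esub> RRes R g (v 1) \<otimes>\<^bsub>RD g\<^esub> d =
        RRes R g (w1 0) \<oplus>\<^bsub>RD g\<^esub> RRes R g (w1 1) \<otimes>\<^bsub>RD g\<^esub> d"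
        using leg(1)[unfolded point_map_apply[OF f g x]] \<psi>1[OF g x] \<chi>v[OF g a(1)] r dc
        by (simp add: to_fst_axis_def weil_eval_def)
      show "RRes R g (v 0) \<oplus>\<^bsub>RD g\<^esub> RRes R g (v 2) \<otimes>\<^bsub>RD g\<^esub> d =
        RRes R g (w2 0) \<oplus>\<^bsub>RD g\<^esub> RRes R g (w2 1) \<otimes>\<^bsub>RD g\<^esub> d"
        using leg(2)[unfolded point_map_apply[OF f g x]] \<psi>2[OF g x] \<chi>v[OF g a(2)] r dc
        by (simp add: to_snd_axis_def weil_eval_def)
    qed
    have "v 0 = w1 0" "v 1 = w1 1"
      using line_affine_eqD[OF c vc(1,2) wc(1,2) ax(1)] by auto
    moreover have "v 2 = w2 1"
      using line_affine_eqD[OF c vc(1,3) wc(3,4) ax(2)] by auto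
    ultimately have "v = ?w"
      by (intro tw_eqI[OF v w]) (auto simp: numeral_eq_Suc le_Suc_eq)
    then show "\<chi> = ?\<chi>"
      by (intro inf_maps_eqI[OF \<chi> weil_eval_map[OF c _ _ w]]) (simp_all add: \<chi>v)
  qed
qed

text \<open>A function a + b d + c e + k d e that is constant along both axes has b = c = 0, so it
  is the function a + k t of t = d e.\<close>

lemma product_limit:
  assumes f: "f \<in> into C c"
  shows "points_limit (line R) c 2 (\<lambda>i. if i = 0 then 3 else 1) (product_edges c) 1 (product_legs c) f"
  unfolding points_limit_def
proof (intro allI impI)
  let ?c = "Dom C f"
  let ?K = "Rng R ?c"
  have c: "?c \<in> Ob C" using f by simp
  interpret K: cring ?K by (rule cring_Rng[OF c])
  have all2: "(\<forall>i<2. P i) \<longleftrightarrow> P 0 \<and> P 1" for P :: "nat \<Rightarrow> bool"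
    by (auto simp: numeral_eq_Suc less_Suc_eq)
  fix \<psi> :: "nat \<Rightarrow> 'b \<Rightarrow> 'c \<times> 'c \<Rightarrow> 'c"
  assume A: "(\<forall>i<2. \<psi> i \<in> maps C ?c (loc C (inf_psh R (if i = 0 then 3 else 1))) (loc C (line R))) \<and>
      (\<forall>(i, j, u)\<in>product_edges c. \<forall>g\<in>into C ?c. \<forall>x\<in>inf_points (RD g) (if i = 0 then 3 else 1).
         \<psi> j g (u (f \<cdot> g) x) = \<psi> i g x)"
  then have \<psi>: "\<psi> 0 \<in> maps C ?c (loc C (inf_psh R 3)) (loc C (line R))" by (simp add: all2)
  have e: "\<psi> 0 g (s (RD g) x) = \<psi> 1 g x"
    if g: "g \<in> into C ?c" and x: "x \<in> inf_points (RD g) 1"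
      and s: "s = to_origin \<or> s = to_fst_axis \<or> s = to_snd_axis" for s g x
  proof -
    have "(1, 0, point_map c 1 s) \<in> product_edges c" using s by auto
    from bspec[OF conjunct2[OF A] this] have "\<psi> 0 g (point_map c 1 s (f \<cdot> g) x) = \<psi> 1 g x"
      using g x by simp
    then show ?thesis by (simp only: point_map_apply[OF f g x])
  qed
  obtain w where w: "w \<in> carrier (truncated_weil ?K 3)"
    and \<psi>w: "\<And>g x. \<lbrakk>g \<in> into C ?c; x \<in> inf_points (RD g) 3\<rbrakk>
      \<Longrightarrow> \<psi> 0 g x = eval_at g 3 w x"
    using line_map_eval[OF c _ _ \<psi>] by auto
  have wc: "w 0 \<in> carrier ?K" "w 1 \<in> carrier ?K" "w 2 \<in> carrier ?K" "w 3 \<in> carrier ?K"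
    using tw_nth[OF w] by auto
  have const: "\<psi> 1 g x = RRes R g (w 0)"
      "RRes R g (w 0) \<oplus>\<^bsub>RD g\<^esub> RRes R g (w 1) \<otimes>\<^bsub>RD g\<^esub> d =
        RRes R g (w 0) \<oplus>\<^bsub>RD g\<^esub> RRes R g \<zero>\<^bsub>?K\<^esub> \<otimes>\<^bsub>RD g\<^esub> d"
      "RRes R g (w 0) \<oplus>\<^bsub>RD g\<^esub> RRes R g (w 2) \<otimes>\<^bsub>RD g\<^esub> d =
        RRes R g (w 0) \<oplus>\<^bsub>RD g\<^esub> RRes R g \<zero>\<^bsub>?K\<^esub> \<otimes>\<^bsub>RD g\<^esub> d"
    if g: "g \<in> into C ?c" and d: "d \<in> DD g" and x: "x = (d, zero_at g)" for g d x
  proof -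
    have cg: "Dom C g \<in> Ob C" using g by simp
    interpret L: cring "RD g" by (rule cring_Rng[OF cg])
    note a = inf_axes[OF cg d]
    have x1: "x \<in> inf_points (RD g) 1" unfolding x by (rule a) simp
    have dc: "d \<in> carrier (RD g)" using d by simp
    note r = wc[THEN RRes_simps(1)[OF g]] RRes_simps(5)[OF g]
    show 1: "\<psi> 1 g x = RRes R g (w 0)"
      using e[OF g x1, of to_origin] \<psi>w[OF g inf_origin[OF cg]] r by (simp add: to_origin_def weil_eval_def)
    show "RRes R g (w 0) \<oplus>\<^bsub>RD g\<^esub> RRes R g (w 1) \<otimes>\<^bsub>RD g\<^esub> d =
        RRes R g (w 0) \<oplus>\<^bsub>RD g\<^esub> RRes R g \<zero>\<^bsub>?K\<^esub> \<otimes>\<^bsub>RD g\<^esub> d"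
      using e[OF g x1, of to_fst_axis] \<psi>w[OF g a(1)] r dc 1 by (simp add: to_fst_axis_def weil_eval_def x)
    show "RRes R g (w 0) \<oplus>\<^bsub>RD g\<^esub> RRes R g (w 2) \<otimes>\<^bsub>RD g\<^esub> d =
        RRes R g (w 0) \<oplus>\<^bsub>RD g\<^esub> RRes R g \<zero>\<^bsub>?K\<^esub> \<otimes>\<^bsub>RD g\<^esub> d"
      using e[OF g x1, of to_snd_axis] \<psi>w[OF g a(2)] r dc 1 by (simp add: to_snd_axis_def weil_eval_def x)
  qed
  \<comment> \<open>On the first axis the polynomial is w0 + w1 d and also constantly w0, so
    cancelling d gives w1 = 0; likewise for w2 on the second axis.\<close>
  have w1: "w 1 = \<zero>\<^bsub>?K\<^esub>" using line_affine_eqD(2)[OF c wc(1,2) wc(1) K.zero_closed const(2)[OF _ _ refl]] .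
  have w2: "w 2 = \<zero>\<^bsub>?K\<^esub>" using line_affine_eqD(2)[OF c wc(1,3) wc(1) K.zero_closed const(3)[OF _ _ refl]] .
  have \<psi>0: "\<psi> 0 g (d, e) = RRes R g (w 0) \<oplus>\<^bsub>RD g\<^esub> RRes R g (w 3) \<otimes>\<^bsub>RD g\<^esub> (d \<otimes>\<^bsub>RD g\<^esub> e)"
    if g: "g \<in> into C ?c" and x: "(d, e) \<in> inf_points (RD g) 3" for g d e
  proof -
    interpret L: cring "RD g" using g by (intro cring_Rng) simp
    have "d \<in> carrier (RD g)" "e \<in> carrier (RD g)"
      using x by (auto simp: inf_points_def)
    then show ?thesis
      using \<psi>w[OF g x] wc[THEN RRes_simps(1)[OF g]] RRes_simps(5)[OF g] w1 w2
      by (simp add: weil_eval_def)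
  qed
  let ?v = "\<lambda>i\<in>{..1::nat}. if i = 0 then w 0 else w 3"
  have v: "?v \<in> carrier (truncated_weil ?K 1)" using wc by (auto simp: tw_carrier)
  let ?\<chi> = "\<lambda>g\<in>into C ?c. \<lambda>x\<in>inf_points (RD g) 1. eval_at g 1 ?v x"
  have \<chi>v: "?\<chi> g (d, zero_at g) = RRes R g (w 0) \<oplus>\<^bsub>RD g\<^esub> RRes R g (w 3) \<otimes>\<^bsub>RD g\<^esub> d"
    if g: "g \<in> into C ?c" and d: "d \<in> DD g" for g d
  proof -
    have cg: "Dom C g \<in> Ob C" using g by simp
    interpret L: cring "RD g" by (rule cring_Rng[OF cg])
    show ?thesis using inf_axes(1)[OF cg d order_refl] g d wc[THEN RRes_simps(1)[OF g]]
      by (simp add: weil_eval_def)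
  qed
  show "\<exists>!\<chi>. \<chi> \<in> maps C ?c (loc C (inf_psh R 1)) (loc C (line R)) \<and>
      (\<forall>i<2. \<forall>g\<in>into C ?c. \<forall>x\<in>inf_points (RD g) (if i = 0 then 3 else 1).
         \<chi> g (product_legs c i (f \<cdot> g) x) = \<psi> i g x)"
  proof (rule ex1I[of _ ?\<chi>], intro conjI)
    show "?\<chi> \<in> maps C ?c (loc C (inf_psh R 1)) (loc C (line R))"
      by (rule weil_eval_map[OF c _ _ v]) auto
    have "?\<chi> g (product_legs c 0 (f \<cdot> g) x) = \<psi> 0 g x"
      if g: "g \<in> into C ?c" and x: "x \<in> inf_points (RD g) 3" for g x
    proof -
      have cg: "Dom C g \<in> Ob C" using g by simp
      obtain d e where de: "x = (d, e)" "d \<in> DD g" "e \<in> DD g"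
        using x by (cases x) (auto simp: inf_points_def)
      then have "d \<otimes>\<^bsub>RD g\<^esub> e \<in> DD g"
        using inf_D_mult[OF cg _ de(3)] by simp
      moreover have "product_legs c 0 (f \<cdot> g) x = (d \<otimes>\<^bsub>RD g\<^esub> e, zero_at g)"
        using point_map_apply[OF f g x, of to_product] by (simp add: de(1) to_product_def)
      ultimately show ?thesis
        using \<psi>0[OF g, of d e] \<chi>v[OF g] x by (simp only: de(1))
    qed
    moreover have "?\<chi> g (product_legs c 1 (f \<cdot> g) x) = \<psi> 1 g x"
      if g: "g \<in> into C ?c" and x: "x \<in> inf_points (RD g) 1" for g x
    proof -
      have cg: "Dom C g \<in> Ob C" using g by simp
      interpret L: cring "RD g" by (rule cring_Rng[OF cg])
      have "\<exists>d\<in>DD g. x = (d, zero_at g)"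
        using x inf_points_1[OF cg] by blast
      then have "\<psi> 1 g x = RRes R g (w 0)" using const(1)[OF g] by blast
      moreover have "?\<chi> g (to_origin (RD g) x) = RRes R g (w 0)"
        using \<chi>v[OF g, of "zero_at g"] wc[THEN RRes_simps(1)[OF g]]
        by (simp add: to_origin_def del: restrict_apply)
      ultimately show ?thesis using point_map_apply[OF f g x, of to_origin] by (simp del: restrict_apply)
    qed
    ultimately show "\<forall>i<2. \<forall>g\<in>into C ?c. \<forall>x\<in>inf_points (RD g) (if i = 0 then 3 else 1).
         ?\<chi> g (product_legs c i (f \<cdot> g) x) = \<psi> i g x"
      unfolding all2 by (simp del: restrict_apply)
  next
    fix \<chi>
    assume B: "\<chi> \<in> maps C ?c (loc C (inf_psh R 1)) (loc C (line R)) \<and>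
      (\<forall>i<2. \<forall>g\<in>into C ?c. \<forall>x\<in>inf_points (RD g) (if i = 0 then 3 else 1).
         \<chi> g (product_legs c i (f \<cdot> g) x) = \<psi> i g x)"
    then have \<chi>: "\<chi> \<in> maps C ?c (loc C (inf_psh R 1)) (loc C (line R))" ..
    have leg: "\<chi> g (to_product (RD g) x) = \<psi> 0 g x"
      if g: "g \<in> into C ?c" and x: "x \<in> inf_points (RD g) 3" for g x
      using conjunct2[OF B, rule_format, of 0 g x] g x by (simp add: point_map_apply[OF f g x])
    obtain u where u: "u \<in> carrier (truncated_weil ?K 1)"
      and \<chi>u: "\<And>g x. \<lbrakk>g \<in> into C ?c; x \<in> inf_points (RD g) 1\<rbrakk>
        \<Longrightarrow> \<chi> g x = eval_at g 1 u x"
      using line_map_eval[OF c _ _ \<chi>] by auto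
    have uc: "u 0 \<in> carrier ?K" "u 1 \<in> carrier ?K" using tw_nth[OF u] by auto
    \<comment> \<open>The coefficients of \<open>\<chi>\<close> pulled back along (d, e) \<mapsto> d
      e: the linear one moves to x y, and x and y get none. Comparing coefficients on D x D
      therefore determines \<open>\<chi>\<close>.\<close>
    let ?u = "\<lambda>i\<in>{..3::nat}. if i = 0 then u 0 else if i = 3 then u 1 else \<zero>\<^bsub>?K\<^esub>"
    have u3: "?u \<in> carrier (truncated_weil ?K 3)" using uc by (auto simp: tw_carrier)
    have "?u = w"
    proof (rule weil_eval_inj[OF c _ _ u3 w])
      fix g x assume g: "g \<in> into C ?c" and x: "x \<in> inf_points (RD g) 3"
      have cg: "Dom C g \<in> Ob C" using g by simp
      interpret L: cring "RD g" by (rule cring_Rng[OF cg])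
      obtain d e where de: "x = (d, e)" "d \<in> DD g" "e \<in> DD g"
        using x by (cases x) (auto simp: inf_points_def)
      have "d \<otimes>\<^bsub>RD g\<^esub> e \<in> DD g"
        using inf_D_mult[OF cg _ de(3)] de(2) by simp
      from \<chi>u[OF g inf_axes(1)[OF cg this order_refl]]
      show "eval_at g 3 ?u x = eval_at g 3 w x"
        using leg[OF g x] \<psi>w[OF g x] de uc[THEN RRes_simps(1)[OF g]] RRes_simps(5)[OF g]
        by (simp add: to_product_def weil_eval_def)
    qed auto
    from fun_cong[OF this, of 0] fun_cong[OF this, of 3] have "u 0 = w 0" "u 1 = w 3" by auto
    then have "u = ?v"
      by (intro tw_eqI[OF u v]) (auto simp: le_Suc_eq)
    then show "\<chi> = ?\<chi>"
      by (intro inf_maps_eqI[OF \<chi> weil_eval_map[OF c _ _ v]]) (simp_all add: \<chi>u)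
  qed
qed

section \<open>Consequences for an arbitrary microlinear object\<close>

lemma points_limit_unique:
  assumes c: "c \<in> Ob C" and co: "points_cocone c m n E k p" and lim: "points_limit F c m n E k p (Id C c)"
    and \<chi>: "\<chi> \<in> psh_maps c (inf_psh R k) F" "\<chi>' \<in> psh_maps c (inf_psh R k) F"
    and eq: "\<And>i g x. \<lbrakk>i < m; g \<in> into C c; x \<in> inf_points (RD g) (n i)\<rbrakk>
      \<Longrightarrow> \<chi> g (p i g x) = \<chi>' g (p i g x)"
  shows "\<chi> = \<chi>'"
proof -
  have D: "Dom C (Id C c) = c" using c by (rule Id_Dom)
  \<comment> \<open>The cocone formed by the composites of \<open>\<chi>\<close> with the legs. By
    assumption \<open>\<chi>'\<close> induces the same one, so both are its mediating map.\<close>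
  let ?\<psi> = "\<lambda>i. \<lambda>g\<in>into C c. \<lambda>x\<in>inf_points (RD g) (n i). \<chi> g (p i g x)"
  have p: "p i \<in> psh_maps c (inf_psh R (n i)) (inf_psh R k)" if "i < m" for i
    using co that by (auto simp: points_cocone_def)
  have px: "p i g x \<in> inf_points (RD g) k"
    if "i < m" "g \<in> into C c" "x \<in> inf_points (RD g) (n i)" for i g x
    using inf_maps_closed[OF p that(2,3)] that(1) by simp
  have "?\<psi> i \<in> psh_maps c (inf_psh R (n i)) F" if i: "i < m" for i
  proof (rule inf_maps_memI)
    fix f x assume f: "f \<in> into C c" and x: "x \<in> inf_points (RD f) (n i)"
    show "\<chi> f (p i f x) \<in> Sec F (Dom C f)" by (rule inf_maps_closed[OF \<chi>(1) f px[OF i f x]])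
    fix g assume g: "g \<in> over f"
    show "Res F g (\<chi> f (p i f x)) = \<chi> (f \<cdot> g) (p i (f \<cdot> g) (res_pair g x))"
      using inf_maps_natural[OF \<chi>(1) f g px[OF i f x]] inf_maps_natural[OF p[OF i] f g x] by simp
  qed
  moreover have "?\<psi> j g (u (Id C c \<cdot> g) x) = ?\<psi> i g x"
    if e: "(i, j, u) \<in> E" and g: "g \<in> into C c" and x: "x \<in> inf_points (RD g) (n i)" for i j u g x
  proof -
    have u: "u \<in> psh_maps c (inf_psh R (n i)) (inf_psh R (n j))" "p j g (u g x) = p i g x"
      using co e g x by (auto simp: points_cocone_def)
    then show ?thesis using inf_maps_closed[OF u(1) g x] g x by simp
  qed
  ultimately have "\<exists>!\<chi>. \<chi> \<in> psh_maps c (inf_psh R k) F \<and>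
      (\<forall>i<m. \<forall>g\<in>into C c. \<forall>x\<in>inf_points (RD g) (n i). \<chi> g (p i (Id C c \<cdot> g) x) = ?\<psi> i g x)"
    by (intro lim[unfolded points_limit_def D, THEN spec, THEN mp]) blast
  moreover have "\<forall>i<m. \<forall>g\<in>into C c. \<forall>x\<in>inf_points (RD g) (n i). \<chi> g (p i (Id C c \<cdot> g) x) = ?\<psi> i g x"
    "\<forall>i<m. \<forall>g\<in>into C c. \<forall>x\<in>inf_points (RD g) (n i). \<chi>' g (p i (Id C c \<cdot> g) x) = ?\<psi> i g x"
    using eq by simp_all
  ultimately show ?thesis using \<chi> by blast
qed

lemma inf_D2_maps_eqI:
  assumes c: "c \<in> Ob C" and F: "microlinear C R F"
    and \<phi>: "\<phi> \<in> psh_maps c (inf_D2 R) F" "\<phi>' \<in> psh_maps c (inf_D2 R) F"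
    and eq: "\<And>f d. \<lbrakk>f \<in> into C c; d \<in> DD f\<rbrakk> \<Longrightarrow>
      \<phi> f (d, zero_at f) = \<phi>' f (d, zero_at f) \<and>
      \<phi> f (zero_at f, d) = \<phi>' f (zero_at f, d)"
  shows "\<phi> = \<phi>'"
proof (rule points_limit_unique[OF c axes_cocone])
  show "points_limit F c 3 (\<lambda>_. 1) (axes_edges c) 2 (axes_legs c) (Id C c)"
    by (rule microlinear_points_limit[OF c F axes_cocone axes_limit])
  show "\<phi> \<in> psh_maps c (inf_psh R 2) F" "\<phi>' \<in> psh_maps c (inf_psh R 2) F"
    using \<phi> by (simp_all add: inf_psh_2)
  fix i :: nat and g x assume "i < 3" and g: "g \<in> into C c" and x: "x \<in> inf_points (RD g) 1"
  have cg: "Dom C g \<in> Ob C" using g by simp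
  obtain d where d: "d \<in> DD g" "x = (d, zero_at g)"
    using x inf_points_1[OF cg] by blast
  \<comment> \<open>The leg through the origin is the case d = 0 of an axis.\<close>
  have z: "zero_at g \<in> DD g"
    using inf_origin[OF cg, of 3] inf_points_D[OF cg] by blast
  have "axes_legs c i g x = (d, zero_at g) \<or> axes_legs c i g x = (zero_at g, d)
    \<or> axes_legs c i g x = (zero_at g, zero_at g)"
    using g x d(2) by (auto simp: point_map_def point_fun_defs)
  then show "\<phi> g (axes_legs c i g x) = \<phi>' g (axes_legs c i g x)"
    using eq[OF g d(1)] eq[OF g z] by auto
qed

lemma inf_D_presheaf: "presheaf C (inf_D R)"
proof
  fix f x assume f: "f \<in> Arr C" and "x \<in> Sec (inf_D R) (Cod C f)"
  then show "Res (inf_D R) f x \<in> DD f"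
    using inf_D_res[of f "Cod C f" x] by (simp add: into_def)
qed (auto simp: RRes_Id into_def intro!: RRes_comp)

lemma inf_psh_presheaf: "presheaf C (inf_psh R n)"
proof
  fix f x assume f: "f \<in> Arr C" and "x \<in> Sec (inf_psh R n) (Cod C f)"
  then show "Res (inf_psh R n) f x \<in> Sec (inf_psh R n) (Dom C f)"
    using inf_points_res[of f "Cod C f" x n] by (simp add: into_def)
next
  fix c x assume "c \<in> Ob C" "x \<in> Sec (inf_psh R n) c"
  then show "Res (inf_psh R n) (Id C c) x = x"
    by (cases x) (auto simp: inf_points_def RRes_Id)
next
  fix f g x assume "f \<in> Arr C" "g \<in> Arr C" "Dom C f = Cod C g" "x \<in> Sec (inf_psh R n) (Cod C f)"
  then show "Res (inf_psh R n) (f \<cdot> g) x = Res (inf_psh R n) g (Res (inf_psh R n) f x)"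
    using RRes_comp[of f "Cod C f" g] by (cases x) (auto simp: inf_points_def into_def)
qed

text \<open>Passage from D itself to D as the first axis, the form in which it occurs in the
  diagrams.\<close>

lemma fst_map_in:
  assumes c: "c \<in> Ob C" and \<chi>: "\<chi> \<in> psh_maps c (inf_D R) F"
  shows "(\<lambda>f\<in>into C c. \<lambda>x\<in>inf_points (RD f) 1. \<chi> f (fst x)) \<in> psh_maps c (inf_psh R 1) F"
proof (rule inf_maps_memI)
  fix f x assume f: "f \<in> into C c" and "x \<in> inf_points (RD f) 1"
  then have x: "fst x \<in> DD f" by (auto simp: inf_points_def)
  show "\<chi> f (fst x) \<in> Sec F (Dom C f)" using maps_closed[OF \<chi> f, of "fst x"] x by simp
  fix g assume g: "g \<in> over f"
  show "Res F g (\<chi> f (fst x)) = \<chi> (f \<cdot> g) (fst (res_pair g x))"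
    using maps_natural[OF \<chi> f g, of "fst x"] x by simp
qed

text \<open>Uniqueness of the mediating map for the multiplication D x D \<rightarrow> D: maps out
  of D are tested on products, although no claim is made that every element of D is a
  product.\<close>

lemma inf_D_maps_eqI:
  assumes c: "c \<in> Ob C" and F: "microlinear C R F"
    and \<chi>: "\<chi> \<in> psh_maps c (inf_D R) F" "\<chi>' \<in> psh_maps c (inf_D R) F"
    and eq: "\<And>f d e. \<lbrakk>f \<in> into C c; d \<in> DD f; e \<in> DD f\<rbrakk> \<Longrightarrow>
      \<chi> f (d \<otimes>\<^bsub>RD f\<^esub> e) = \<chi>' f (d \<otimes>\<^bsub>RD f\<^esub> e)"
  shows "\<chi> = \<chi>'"
proof -
  let ?l = "\<lambda>\<chi>. \<lambda>f\<in>into C c. \<lambda>x\<in>inf_points (RD f) 1. \<chi> f (fst x)"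
  have "?l \<chi> = ?l \<chi>'"
  proof (rule points_limit_unique[OF c product_cocone])
    show "points_limit F c 2 (\<lambda>i. if i = 0 then 3 else 1) (product_edges c) 1 (product_legs c) (Id C c)"
      by (rule microlinear_points_limit[OF c F product_cocone product_limit])
    show "?l \<chi> \<in> psh_maps c (inf_psh R 1) F" "?l \<chi>' \<in> psh_maps c (inf_psh R 1) F"
      by (rule fst_map_in[OF c \<chi>(1)], rule fst_map_in[OF c \<chi>(2)])
    fix i :: nat and g x assume "i < 2" and g: "g \<in> into C c"
      and x: "x \<in> inf_points (RD g) (if i = 0 then 3 else 1)"
    have cg: "Dom C g \<in> Ob C" using g by simp
    interpret L: cring "RD g" by (rule cring_Rng[OF cg])
    have z: "zero_at g \<in> DD g" by simp
    have "\<exists>d e. d \<in> DD g \<and> e \<in> DD g \<and>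
        product_legs c i g x = (d \<otimes>\<^bsub>RD g\<^esub> e, zero_at g)"
    proof (cases "i = 0")
      case True
      then show ?thesis using g x
        by (cases x) (auto simp: point_map_def to_product_def inf_points_def)
    next
      case False
      \<comment> \<open>The constant leg hits 0, which is the product of 0 with itself.\<close>
      then have "product_legs c i g x = ((zero_at g) \<otimes>\<^bsub>RD g\<^esub> (zero_at g), zero_at g)"
        using g x by (simp add: point_map_def to_origin_def)
      then show ?thesis using z by blast
    qed
    then obtain d e where de: "d \<in> DD g" "e \<in> DD g"
      "product_legs c i g x = (d \<otimes>\<^bsub>RD g\<^esub> e, zero_at g)" by blast
    have "d \<otimes>\<^bsub>RD g\<^esub> e \<in> DD g" using inf_D_mult[OF cg _ de(2)] de(1) by simp
    then show "?l \<chi> g (product_legs c i g x) = ?l \<chi>' g (product_legs c i g x)"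
      unfolding de(3) using eq[OF g de(1,2)] inf_axes(1)[OF cg _ order_refl] g by simp
  qed
  note l = this
  show ?thesis
  proof (rule maps_eqI[OF \<chi>])
    fix f d assume f: "f \<in> into C c" and "d \<in> El (loc C (inf_D R)) f"
    then have "(d, zero_at f) \<in> inf_points (RD f) 1" using inf_axes(1)[of "Dom C f" d 1] by simp
    then show "\<chi> f d = \<chi>' f d" using fun_cong[OF fun_cong[OF l, of f], of "(d, zero_at f)"] f by simp
  qed
qed

lemma inf_D_product_factor:
  assumes c: "c \<in> Ob C" and F: "microlinear C R F"
    and \<phi>: "\<phi> \<in> psh_maps c (inf_psh R 3) F"
    and ax: "\<And>f d. \<lbrakk>f \<in> into C c; d \<in> DD f\<rbrakk> \<Longrightarrow>
      \<phi> f (d, zero_at f) = \<phi> f (zero_at f, zero_at f) \<and>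
      \<phi> f (zero_at f, d) = \<phi> f (zero_at f, zero_at f)"
  obtains \<chi> where "\<chi> \<in> psh_maps c (inf_D R) F"
    and "\<And>f d e. \<lbrakk>f \<in> into C c; d \<in> DD f; e \<in> DD f\<rbrakk>
      \<Longrightarrow> \<chi> f (d \<otimes>\<^bsub>RD f\<^esub> e) = \<phi> f (d, e)"
proof -
  have D: "Dom C (Id C c) = c" using c by (rule Id_Dom)
  have lim: "points_limit F c 2 (\<lambda>i. if i = 0 then 3 else 1) (product_edges c) 1 (product_legs c) (Id C c)"
    by (rule microlinear_points_limit[OF c F product_cocone product_limit])
  \<comment> \<open>The component at the auxiliary copy of D is forced: it is constantly the value
    of \<open>\<phi>\<close> at the origin.\<close>
  let ?\<psi> = "\<lambda>i::nat. if i = 0 then \<phi> else (\<lambda>f\<in>into C c. \<lambda>x\<in>inf_points (RD f) 1.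
     \<phi> f (zero_at f, zero_at f))"
  have "?\<psi> 1 \<in> psh_maps c (inf_psh R 1) F"
    unfolding if_not_P[OF one_neq_zero]
  proof (rule inf_maps_memI)
    fix f x assume f: "f \<in> into C c"
    then have o: "(zero_at f, zero_at f) \<in> inf_points (RD f) 3"
      by (intro inf_origin) simp
    show "\<phi> f (zero_at f, zero_at f) \<in> Sec F (Dom C f)"
      by (rule inf_maps_closed[OF \<phi> f o])
    fix g assume g: "g \<in> over f"
    show "Res F g (\<phi> f (zero_at f, zero_at f)) =
       \<phi> (f \<cdot> g) ((zero_at (f \<cdot> g)), (zero_at (f \<cdot> g)))"
      using inf_maps_natural[OF \<phi> f g o] f g by (simp add: RRes_simps(5)[OF g])
  qed
  then have 1: "\<forall>i<2. ?\<psi> i \<in> psh_maps c (inf_psh R (if i = 0 then 3 else 1)) F"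
    using \<phi> by (auto simp: less_Suc_eq numeral_2_eq_2)
  have e: "\<phi> g (point_map c 1 s (Id C c \<cdot> g) x) = ?\<psi> 1 g x"
    if s: "s = to_origin \<or> s = to_fst_axis \<or> s = to_snd_axis" and g: "g \<in> into C c"
      and x: "x \<in> inf_points (RD g) 1" for s g x
  proof -
    obtain d where d: "d \<in> DD g" "x = (d, zero_at g)"
      using x inf_points_1[of "Dom C g"] g by auto
    have "point_map c 1 s (Id C c \<cdot> g) x = s (RD g) x"
      using g x by (simp add: point_map_def)
    moreover have "\<phi> g (s (RD g) x) = \<phi> g (zero_at g, zero_at g)"
      using s ax[OF g d(1)] d(2) by (auto simp: point_fun_defs)
    ultimately show ?thesis using g x by simp
  qed
  have 2: "\<forall>(i, j, u)\<in>product_edges c. \<forall>g\<in>into C c. \<forall>x\<in>inf_points (RD g) (if i = 0 then 3 else 1).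
         ?\<psi> j g (u (Id C c \<cdot> g) x) = ?\<psi> i g x"
    using e by simp
  have "\<exists>\<chi>. \<chi> \<in> psh_maps c (inf_psh R 1) F \<and>
      (\<forall>i<2. \<forall>g\<in>into C c. \<forall>x\<in>inf_points (RD g) (if i = 0 then 3 else 1).
         \<chi> g (product_legs c i (Id C c \<cdot> g) x) = ?\<psi> i g x)"
    by (rule ex1_implies_ex, rule lim[unfolded points_limit_def D, THEN spec, THEN mp])
      (rule conjI[OF 1 2])
  then obtain \<chi> where \<chi>: "\<chi> \<in> psh_maps c (inf_psh R 1) F"
    and "\<forall>i<2. \<forall>g\<in>into C c. \<forall>x\<in>inf_points (RD g) (if i = 0 then 3 else 1).
         \<chi> g (product_legs c i (Id C c \<cdot> g) x) = ?\<psi> i g x" by blast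
  then have \<chi>': "\<chi> g (point_map c 3 to_product g x) = \<phi> g x"
    if "g \<in> into C c" "x \<in> inf_points (RD g) 3" for g x using that by force
  have ax': "(d, zero_at f) \<in> inf_points (RD f) 1"
    if "f \<in> into C c" "d \<in> DD f" for f d
    using inf_axes(1)[of "Dom C f" d 1] that by simp
  show thesis
  proof (rule that)
    have "(\<lambda>f\<in>into C c. \<lambda>d\<in>El (loc C (inf_D R)) f. \<chi> f (d, zero_at f))
      \<in> psh_maps c (inf_D R) F"
    proof (rule maps_memI)
      fix f d assume f: "f \<in> into C c" and "d \<in> El (loc C (inf_D R)) f"
      then have d: "d \<in> DD f" by simp
      show "\<chi> f (d, zero_at f) \<in> El (loc C F) f"
        using inf_maps_closed[OF \<chi> f ax'[OF f d]] by simp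
      fix g assume g: "g \<in> over f"
      show "Rs (loc C (inf_D R)) g d \<in> El (loc C (inf_D R)) (f \<cdot> g)"
        using inf_D_res[OF g d] f g by simp
      show "Rs (loc C F) g (\<chi> f (d, zero_at f)) =
          \<chi> (f \<cdot> g) (Rs (loc C (inf_D R)) g d, (zero_at (f \<cdot> g)))"
        using inf_maps_natural[OF \<chi> f g ax'[OF f d]] f g by (simp add: RRes_simps(5)[OF g])
    qed
    then show "(\<lambda>f\<in>into C c. \<lambda>d\<in>DD f. \<chi> f (d, zero_at f))
      \<in> psh_maps c (inf_D R) F" by simp
    fix f d e assume f: "f \<in> into C c" and d: "d \<in> DD f" and e: "e \<in> DD f"
    have x: "(d, e) \<in> inf_points (RD f) 3" using d e inf_points_D[of "Dom C f"] f by simp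
    have "d \<otimes>\<^bsub>RD f\<^esub> e \<in> DD f" using inf_D_mult[OF _ _ e] d f by simp
    then show "(\<lambda>f\<in>into C c. \<lambda>d\<in>DD f. \<chi> f (d, zero_at f)) f
        (d \<otimes>\<^bsub>RD f\<^esub> e) = \<phi> f (d, e)"
      using \<chi>'[OF f x] f x by (simp add: point_map_def to_product_def)
  qed
qed

end

section \<open>Sections of the groupoid and curves of sections\<close>

context small_category
begin

lemma maps_res_in:
  assumes "\<phi> \<in> psh_maps c A B" "f \<in> into C c"
  shows "maps_res C f \<phi> \<in> psh_maps (Dom C f) A B"
proof -
  have \<phi>: "\<phi> \<in> (\<Pi>\<^sub>E f\<in>into C c. Sec A (Dom C f) \<rightarrow>\<^sub>E Sec B (Dom C f))"
    using assms(1) by (simp add: maps_def)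
  have "\<phi> (f \<cdot> g) \<in> Sec A (Dom C g) \<rightarrow>\<^sub>E Sec B (Dom C g)" if "g \<in> over f" for g
    using PiE_mem[OF \<phi> into_comp[OF assms(2) that]] assms(2) that by simp
  then have "(\<lambda>g\<in>over f. \<phi> (f \<cdot> g)) \<in>
      (\<Pi>\<^sub>E g\<in>over f. Sec A (Dom C g) \<rightarrow>\<^sub>E Sec B (Dom C g))" by simp
  then show ?thesis
    using assms by (auto simp: maps_def maps_res_def comp_assoc)
qed

lemma maps_res_Id:
  assumes "c \<in> Ob C" "\<phi> \<in> maps C c A B"
  shows "maps_res C (Id C c) \<phi> = \<phi>"
proof
  fix f show "maps_res C (Id C c) \<phi> f = \<phi> f"
    using assms by (cases "f \<in> into C c") (auto simp: maps_res_def Id_Dom maps_def PiE_def extensional_def)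
qed

lemma maps_res_comp:
  "\<lbrakk>f \<in> into C c; g \<in> over f\<rbrakk> \<Longrightarrow> maps_res C (f \<cdot> g) \<phi> = maps_res C g (maps_res C f \<phi>)"
  by (auto simp: maps_res_def comp_assoc intro!: restrict_ext)

end

section \<open>The monoid of sections and its bisections\<close>

locale lie_setting = kl_line C J R + groupoid_sheaf C J G
  for C :: "('o, 'm) cat" (structure) and J :: "'o \<Rightarrow> 'm set set"
    and R :: "('o, 'm, 'r) rng_psh" and G :: "('o, 'm, 'x, 'g) gpd" +
  assumes microlinear_base: "microlinear C R (Base G)"
    and microlinear_tot: "microlinear C R (Tot G)"
begin

abbreviation Gamma ("\<Gamma>") where "\<Gamma> c \<equiv> Sec (GammaAG C R G) c"

abbreviation Gamma_L ("\<Gamma>M") where "\<Gamma>M c \<equiv> Gamma_module C R G c"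

abbreviation SS where "SS c \<equiv> Sec (Sect C G) c"

abbreviation MD where "MD f \<equiv> Sec (Base G) (Dom C f)"

abbreviation mul where "mul c \<equiv> sect_mult C G c"

abbreviation sunit where "sunit c \<equiv> sect_unit C G c"

abbreviation br where "br c \<equiv> bracket C R G c"

lemma res_base:
  "\<lbrakk>f \<in> into C c; x \<in> Sec (Base G) c\<rbrakk> \<Longrightarrow> Res (Base G) f x \<in> MD f"
  "\<lbrakk>c \<in> Ob C; x \<in> Sec (Base G) c\<rbrakk> \<Longrightarrow> Res (Base G) (Id C c) x = x"
  "\<lbrakk>f \<in> into C c; g \<in> over f; x \<in> Sec (Base G) c\<rbrakk>
    \<Longrightarrow> Res (Base G) (f \<cdot> g) x = Res (Base G) g (Res (Base G) f x)"
  using base.Res_closed[of f x] base.Res_Id base.Res_Comp[of f g x] by (auto simp: into_def)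

lemma gpd_natural:
  "\<lbrakk>f \<in> into C c; x \<in> Sec (Base G) c\<rbrakk> \<Longrightarrow> Res (Tot G) f (gid G c x) = gid G (Dom C f) (Res (Base G) f x)"
  "\<lbrakk>f \<in> into C c; a \<in> Sec (Tot G) c\<rbrakk> \<Longrightarrow> Res (Base G) f (gsrc G c a) = gsrc G (Dom C f) (Res (Tot G) f a)"
  "\<lbrakk>f \<in> into C c; a \<in> Sec (Tot G) c\<rbrakk> \<Longrightarrow> Res (Base G) f (gtgt G c a) = gtgt G (Dom C f) (Res (Tot G) f a)"
  "\<lbrakk>f \<in> into C c; a \<in> Sec (Tot G) c; b \<in> Sec (Tot G) c; gsrc G c a = gtgt G c b\<rbrakk>
    \<Longrightarrow> Res (Tot G) f (gmul G c a b) = gmul G (Dom C f) (Res (Tot G) f a) (Res (Tot G) f b)"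
  using gid_natural[of f x] gsrc_natural[of f a] gtgt_natural[of f a] gmul_natural[of f a b]
  by (auto simp: into_def)

lemma Sect_iff:
  "\<sigma> \<in> SS c \<longleftrightarrow> \<sigma> \<in> psh_maps c (Base G) (Tot G) \<and>
    (\<forall>f\<in>into C c. \<forall>x\<in>MD f. gsrc G (Dom C f) (\<sigma> f x) = x)"
  by (simp add: Sect_def exp_psh_def)

lemma Res_Sect [simp]: "Res (Sect C G) = maps_res C"
  by (simp add: Sect_def)

lemma sect_simps:
  assumes "\<sigma> \<in> SS c" "f \<in> into C c" "x \<in> MD f"
  shows "\<sigma> f x \<in> Sec (Tot G) (Dom C f)" "gsrc G (Dom C f) (\<sigma> f x) = x"
    and "gtgt G (Dom C f) (\<sigma> f x) \<in> MD f"
    and "g \<in> over f \<Longrightarrow> Res (Tot G) g (\<sigma> f x) = \<sigma> (f \<cdot> g) (Res (Base G) g x)"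
proof -
  have \<sigma>: "\<sigma> \<in> psh_maps c (Base G) (Tot G)" using assms(1) by (simp add: Sect_iff)
  show 1: "\<sigma> f x \<in> Sec (Tot G) (Dom C f)" using maps_closed[OF \<sigma> assms(2)] assms(3) by simp
  show "gsrc G (Dom C f) (\<sigma> f x) = x" using assms by (simp add: Sect_iff)
  show "gtgt G (Dom C f) (\<sigma> f x) \<in> MD f" using 1 assms(2) by (intro gtgt_closed) simp
  show "g \<in> over f \<Longrightarrow> Res (Tot G) g (\<sigma> f x) = \<sigma> (f \<cdot> g) (Res (Base G) g x)"
    using maps_natural[OF \<sigma> assms(2)] assms(3) by simp
qed

lemma sect_eqI:
  assumes "\<sigma> \<in> SS c" "\<rho> \<in> SS c"
    and "\<And>f x. \<lbrakk>f \<in> into C c; x \<in> MD f\<rbrakk> \<Longrightarrow> \<sigma> f x = \<rho> f x"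
  shows "\<sigma> = \<rho>"
  using assms by (intro maps_eqI[of \<sigma> c "loc C (Base G)" "loc C (Tot G)" \<rho> "loc C (Tot G)"]) (auto simp: Sect_iff)

lemma sect_memI:
  assumes "\<And>f x. \<lbrakk>f \<in> into C c; x \<in> MD f\<rbrakk>
      \<Longrightarrow> \<sigma> f x \<in> Sec (Tot G) (Dom C f) \<and> gsrc G (Dom C f) (\<sigma> f x) = x"
    and "\<And>f g x. \<lbrakk>f \<in> into C c; g \<in> over f; x \<in> MD f\<rbrakk>
      \<Longrightarrow> Res (Tot G) g (\<sigma> f x) = \<sigma> (f \<cdot> g) (Res (Base G) g x)"
  shows "(\<lambda>f\<in>into C c. \<lambda>x\<in>MD f. \<sigma> f x) \<in> SS c"
  using maps_memI[of c "loc C (Base G)" \<sigma> "loc C (Tot G)"] assms res_base(1)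
  by (auto simp: Sect_iff)

lemma sect_mult_apply:
  "\<lbrakk>f \<in> into C c; x \<in> MD f\<rbrakk> \<Longrightarrow>
    mul c \<sigma> \<rho> f x = gmul G (Dom C f) (\<sigma> f (gtgt G (Dom C f) (\<rho> f x))) (\<rho> f x)"
  by (simp add: sect_mult_def)

lemma sect_unit_apply:
  "\<lbrakk>f \<in> into C c; x \<in> MD f\<rbrakk> \<Longrightarrow> sunit c f x = gid G (Dom C f) x"
  by (simp add: sect_unit_def)

lemma sect_unit_in: "sunit c \<in> SS c"
  unfolding sect_unit_def
  by (rule sect_memI) (auto simp: gid_closed gsrc_gid gpd_natural)

lemma sect_mult_in:
  assumes \<sigma>: "\<sigma> \<in> SS c" and \<rho>: "\<rho> \<in> SS c"
  shows "mul c \<sigma> \<rho> \<in> SS c"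
  unfolding sect_mult_def
proof (rule sect_memI)
  fix f x assume f: "f \<in> into C c" and x: "x \<in> MD f"
  note r = sect_simps[OF \<rho> f x]
  note s = sect_simps[OF \<sigma> f r(3)]
  show "gmul G (Dom C f) (\<sigma> f (gtgt G (Dom C f) (\<rho> f x))) (\<rho> f x) \<in> Sec (Tot G) (Dom C f) \<and>
    gsrc G (Dom C f) (gmul G (Dom C f) (\<sigma> f (gtgt G (Dom C f) (\<rho> f x))) (\<rho> f x)) = x"
    using f r s by (simp add: gmul_closed gsrc_gmul)
  fix g assume g: "g \<in> over f"
  show "Res (Tot G) g (gmul G (Dom C f) (\<sigma> f (gtgt G (Dom C f) (\<rho> f x))) (\<rho> f x)) =
    gmul G (Dom C (f \<cdot> g)) (\<sigma> (f \<cdot> g) (gtgt G (Dom C (f \<cdot> g)) (\<rho> (f \<cdot> g) (Res (Base G) g x))))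
      (\<rho> (f \<cdot> g) (Res (Base G) g x))"
    using f g r s by (simp add: gpd_natural)
qed

text \<open>Taking targets turns the product of sections into composition of self-maps of the base;
  bisections are the sections whose self-map is bijective at every stage.\<close>

lemma gtgt_sect_mult:
  assumes \<sigma>: "\<sigma> \<in> SS c" and \<rho>: "\<rho> \<in> SS c"
    and f: "f \<in> into C c" and x: "x \<in> MD f"
  shows "gtgt G (Dom C f) (mul c \<sigma> \<rho> f x) =
    gtgt G (Dom C f) (\<sigma> f (gtgt G (Dom C f) (\<rho> f x)))"
proof -
  note r = sect_simps[OF \<rho> f x]
  show ?thesis using f x r sect_simps[OF \<sigma> f r(3)] by (simp add: sect_mult_apply gtgt_gmul)
qed

abbreviation sect_monoid where
  "sect_monoid c \<equiv> \<lparr>carrier = SS c, monoid.mult = mul c, one = sunit c\<rparr>"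

lemma monoid_sect: "Group.monoid (sect_monoid c)"
proof (rule monoidI, simp_all add: sect_mult_in sect_unit_in)
  fix \<sigma> \<rho> \<tau> assume \<sigma>: "\<sigma> \<in> SS c" and \<rho>: "\<rho> \<in> SS c" and \<tau>: "\<tau> \<in> SS c"
  show "mul c (mul c \<sigma> \<rho>) \<tau> = mul c \<sigma> (mul c \<rho> \<tau>)"
  proof (rule sect_eqI)
    fix f x assume f: "f \<in> into C c" and x: "x \<in> MD f"
    note t = sect_simps[OF \<tau> f x]
    note r = sect_simps[OF \<rho> f t(3)]
    note s = sect_simps[OF \<sigma> f r(3)]
    show "mul c (mul c \<sigma> \<rho>) \<tau> f x = mul c \<sigma> (mul c \<rho> \<tau>) f x"
      using f x t r s by (simp add: sect_mult_apply gtgt_gmul gmul_assoc)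
  qed (simp_all add: sect_mult_in \<sigma> \<rho> \<tau>)
next
  fix \<sigma> assume \<sigma>: "\<sigma> \<in> SS c"
  show "mul c (sunit c) \<sigma> = \<sigma>"
  proof (rule sect_eqI)
    fix f x assume f: "f \<in> into C c" and x: "x \<in> MD f"
    show "mul c (sunit c) \<sigma> f x = \<sigma> f x"
      using f x sect_simps[OF \<sigma> f x] by (simp add: sect_mult_apply sect_unit_apply gmul_gid_left)
  qed (simp_all add: sect_mult_in sect_unit_in \<sigma>)
  show "mul c \<sigma> (sunit c) = \<sigma>"
  proof (rule sect_eqI)
    fix f x assume f: "f \<in> into C c" and x: "x \<in> MD f"
    show "mul c \<sigma> (sunit c) f x = \<sigma> f x"
      using f x sect_simps[OF \<sigma> f x] gmul_gid_right[of "Dom C f" "\<sigma> f x"]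
      by (simp add: sect_mult_apply sect_unit_apply gtgt_gid)
  qed (simp_all add: sect_mult_in sect_unit_in \<sigma>)
qed

lemma sect_mult_res:
  assumes f: "f \<in> into C c"
  shows "maps_res C f (mul c \<sigma> \<rho>) = mul (Dom C f) (maps_res C f \<sigma>) (maps_res C f \<rho>)"
proof (rule ext)
  fix g show "maps_res C f (mul c \<sigma> \<rho>) g =
    mul (Dom C f) (maps_res C f \<sigma>) (maps_res C f \<rho>) g"
    using f by (cases "g \<in> over f") (auto simp: maps_res_def sect_mult_def)
qed

lemma sect_unit_res:
  assumes f: "f \<in> into C c"
  shows "maps_res C f (sunit c) = sunit (Dom C f)"
proof (rule ext)
  fix g show "maps_res C f (sunit c) g = sunit (Dom C f) g"
    using f by (cases "g \<in> over f") (auto simp: maps_res_def sect_unit_def)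
qed

lemma Bisect_iff:
  "\<sigma> \<in> Sec (Bisect C G) c \<longleftrightarrow> \<sigma> \<in> SS c \<and>
    (\<forall>f\<in>into C c. bij_betw (\<lambda>x. gtgt G (Dom C f) (\<sigma> f x)) (MD f) (MD f))"
  by (simp add: Bisect_def)

text \<open>By \<open>gtgt_sect_mult\<close> the self-maps of the base that belong to
  \<open>\<sigma>\<close> and \<open>\<rho>\<close> are inverse to each other.\<close>

lemma Bisect_if_invertible:
  assumes \<sigma>: "\<sigma> \<in> SS c" and \<rho>: "\<rho> \<in> SS c"
    and inv: "mul c \<sigma> \<rho> = sunit c" "mul c \<rho> \<sigma> = sunit c"
  shows "\<sigma> \<in> Sec (Bisect C G) c"
  unfolding Bisect_iff
proof (intro conjI ballI \<sigma>)
  fix f assume f: "f \<in> into C c"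
  have "gtgt G (Dom C f) (\<sigma> f (gtgt G (Dom C f) (\<rho> f x))) = x"
    "gtgt G (Dom C f) (\<rho> f (gtgt G (Dom C f) (\<sigma> f x))) = x" if x: "x \<in> MD f" for x
    using gtgt_sect_mult[OF \<sigma> \<rho> f x] gtgt_sect_mult[OF \<rho> \<sigma> f x] inv f x
    by (simp_all add: sect_unit_apply gtgt_gid)
  then show "bij_betw (\<lambda>x. gtgt G (Dom C f) (\<sigma> f x)) (MD f) (MD f)"
    using sect_simps(3)[OF \<sigma> f] sect_simps(3)[OF \<rho> f]
    by (intro bij_betwI[where g = "\<lambda>x. gtgt G (Dom C f) (\<rho> f x)"]) auto
qed

lemma Bisect_mult:
  assumes \<sigma>: "\<sigma> \<in> Sec (Bisect C G) c" and \<rho>: "\<rho> \<in> Sec (Bisect C G) c"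
  shows "mul c \<sigma> \<rho> \<in> Sec (Bisect C G) c"
proof -
  have s: "\<sigma> \<in> SS c" "\<rho> \<in> SS c" using \<sigma> \<rho> by (simp_all add: Bisect_iff)
  have "bij_betw (\<lambda>x. gtgt G (Dom C f) (mul c \<sigma> \<rho> f x)) (MD f) (MD f)"
    if f: "f \<in> into C c" for f
  proof -
    have "bij_betw ((\<lambda>x. gtgt G (Dom C f) (\<sigma> f x)) \<circ> (\<lambda>x. gtgt G (Dom C f) (\<rho> f x)))
        (MD f) (MD f)"
      by (rule bij_betw_trans[of _ _ "MD f"]) (use \<sigma> \<rho> f in \<open>simp_all add: Bisect_iff\<close>)
    then show ?thesis
      by (subst bij_betw_cong[of _ _ "(\<lambda>x. gtgt G (Dom C f) (\<sigma> f x)) \<circ> (\<lambda>x. gtgt G (Dom C f) (\<rho> f x))"])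
        (simp_all add: gtgt_sect_mult[OF s f])
  qed
  then show ?thesis using sect_mult_in[OF s] by (simp add: Bisect_iff)
qed

section \<open>Families of sections tested at points of the base\<close>

definition sect_at where
  "sect_at A \<Phi> f x = (\<lambda>g\<in>over f. \<lambda>a\<in>Sec A (Dom C g).
     \<Phi> (f \<cdot> g) a (Id C (Dom C g)) (Res (Base G) g x))"

text \<open>The Yoneda argument: the value at an arrow \<open>g\<close> is a value at an identity
  arrow after restriction along \<open>g\<close>. This is why \<open>sect_at\<close> can refer to
  identity arrows only.\<close>

lemma sect_maps_shift:
  assumes \<Phi>: "\<Phi> \<in> psh_maps c A (Sect C G)" and f: "f \<in> into C c"
    and a: "a \<in> Sec A (Dom C f)" and g: "g \<in> over f"
  shows "\<Phi> f a g = \<Phi> (f \<cdot> g) (Res A g a) (Id C (Dom C g))"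
proof -
  have "maps_res C g (\<Phi> f a) = \<Phi> (f \<cdot> g) (Res A g a)"
    using maps_natural[OF \<Phi> f g, of a] a by simp
  then have "\<Phi> (f \<cdot> g) (Res A g a) (Id C (Dom C g)) = maps_res C g (\<Phi> f a) (Id C (Dom C g))" by simp
  also have "\<dots> = \<Phi> f a g" using g by simp
  finally show ?thesis ..
qed

lemma sect_maps_closed:
  "\<lbrakk>\<Phi> \<in> psh_maps c A (Sect C G); f \<in> into C c; a \<in> Sec A (Dom C f)\<rbrakk>
    \<Longrightarrow> \<Phi> f a \<in> SS (Dom C f)"
  by (drule maps_closed) auto

lemma presheaf_res:
  assumes "presheaf C A" "f \<in> into C c" "a \<in> Sec A c"
  shows "Res A f a \<in> Sec A (Dom C f)"
  using presheaf.Res_closed[OF assms(1), of f a] assms(2,3) by (simp add: into_def)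

text \<open>With x fixed, evaluation at x makes a family of sections into a map with values in G, to
  which microlinearity applies. Its naturality combines that of each section
  \<open>\<Phi> f a\<close> with that of \<open>\<Phi>\<close>.\<close>

lemma sect_at_in:
  assumes A: "presheaf C A" and \<Phi>: "\<Phi> \<in> psh_maps c A (Sect C G)" and f: "f \<in> into C c"
    and x: "x \<in> MD f"
  shows "sect_at A \<Phi> f x \<in> psh_maps (Dom C f) A (Tot G)"
proof -
  have "(\<lambda>g\<in>over f. \<lambda>a\<in>El (loc C A) g. \<Phi> (f \<cdot> g) a (Id C (Dom C g)) (Res (Base G) g x))
    \<in> psh_maps (Dom C f) A (Tot G)"
  proof (rule maps_memI)
    fix g a assume g: "g \<in> over f" and "a \<in> El (loc C A) g"
    then have a: "a \<in> Sec A (Dom C (f \<cdot> g))" using f by simp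
    note fg = into_comp[OF f g] and xg = res_base(1)[OF g x]
    have I: "Id C (Dom C g) \<in> over (f \<cdot> g)" using f g by simp
    have D: "Dom C (Id C (Dom C g)) = Dom C g" using g by (intro Id_Dom) simp
    note s = sect_simps[OF sect_maps_closed[OF \<Phi> fg a] I, of "Res (Base G) g x", unfolded D, OF xg]
    show "\<Phi> (f \<cdot> g) a (Id C (Dom C g)) (Res (Base G) g x) \<in> El (loc C (Tot G)) g"
      using s(1) by simp
    fix k assume k: "k \<in> over g"
    have k': "k \<in> over (f \<cdot> g)" using f g k by simp
    show "Rs (loc C A) k a \<in> El (loc C A) (g \<cdot> k)"
      using presheaf_res[OF A k] a f g k by simp
    have "Res (Tot G) k (\<Phi> (f \<cdot> g) a (Id C (Dom C g)) (Res (Base G) g x)) =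
        \<Phi> (f \<cdot> g) a k (Res (Base G) k (Res (Base G) g x))"
      using s(4)[OF k] k by simp
    also have "\<dots> = \<Phi> (f \<cdot> g \<cdot> k) (Res A k a) (Id C (Dom C k)) (Res (Base G) (g \<cdot> k) x)"
      using sect_maps_shift[OF \<Phi> fg a k'] res_base(3)[OF g k x] by simp
    finally show "Rs (loc C (Tot G)) k (\<Phi> (f \<cdot> g) a (Id C (Dom C g)) (Res (Base G) g x)) =
        \<Phi> (f \<cdot> (g \<cdot> k)) (Rs (loc C A) k a) (Id C (Dom C (g \<cdot> k))) (Res (Base G) (g \<cdot> k) x)"
      using g k by (simp add: comp_assoc[OF f g k])
  qed
  then show ?thesis by (simp add: sect_at_def)
qed

text \<open>A section is determined by its values at the points of all later stages, and
  \<open>sect_maps_shift\<close> expresses each of these by \<open>sect_at\<close>.\<close>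

lemma sect_maps_eqI:
  assumes A: "presheaf C A"
    and \<Phi>: "\<Phi> \<in> psh_maps c A (Sect C G)" "\<Phi>' \<in> psh_maps c A (Sect C G)"
    and eq: "\<And>f x. \<lbrakk>f \<in> into C c; x \<in> MD f\<rbrakk> \<Longrightarrow> sect_at A \<Phi> f x = sect_at A \<Phi>' f x"
  shows "\<Phi> = \<Phi>'"
proof (rule maps_eqI[OF \<Phi>])
  fix f a assume f: "f \<in> into C c" and "a \<in> El (loc C A) f"
  then have a: "a \<in> Sec A (Dom C f)" by simp
  show "\<Phi> f a = \<Phi>' f a"
  proof (rule sect_eqI[OF sect_maps_closed[OF \<Phi>(1) f a] sect_maps_closed[OF \<Phi>(2) f a]])
    fix g x assume g: "g \<in> over f" and x: "x \<in> MD g"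
    have x': "x \<in> MD (f \<cdot> g)" using f g x by simp
    have D: "Dom C (Id C (Dom C g)) = Dom C g" using g by (intro Id_Dom) simp
    have at: "\<Psi> (f \<cdot> g) (Res A g a) (Id C (Dom C g)) x = sect_at A \<Psi> (f \<cdot> g) x (Id C (Dom C g)) (Res A g a)" for \<Psi>
      using f g x presheaf_res[OF A g a] comp_Id[OF into_comp[OF f g]]
      by (simp add: sect_at_def D res_base(2))
    then show "\<Phi> f a g x = \<Phi>' f a g x"
      using sect_maps_shift[OF \<Phi>(1) f a g] sect_maps_shift[OF \<Phi>(2) f a g] eq[OF into_comp[OF f g] x']
        at[of \<Phi>] at[of \<Phi>'] by simp
  qed
qed

lemma inf_D2_presheaf: "presheaf C (inf_D2 R)"
  using inf_psh_presheaf[of 2] by (simp add: inf_psh_2)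

lemma inf_D2_sect_eqI:
  assumes \<Phi>: "\<Phi> \<in> psh_maps c (inf_D2 R) (Sect C G)" "\<Phi>' \<in> psh_maps c (inf_D2 R) (Sect C G)"
    and eq: "\<And>f d. \<lbrakk>f \<in> into C c; d \<in> DD f\<rbrakk> \<Longrightarrow>
      \<Phi> f (d, zero_at f) = \<Phi>' f (d, zero_at f) \<and>
      \<Phi> f (zero_at f, d) = \<Phi>' f (zero_at f, d)"
  shows "\<Phi> = \<Phi>'"
proof (rule sect_maps_eqI[OF inf_D2_presheaf \<Phi>])
  fix f x assume f: "f \<in> into C c" and x: "x \<in> MD f"
  show "sect_at (inf_D2 R) \<Phi> f x = sect_at (inf_D2 R) \<Phi>' f x"
  proof (rule inf_D2_maps_eqI[OF into_Ob[OF f] microlinear_tot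
        sect_at_in[OF inf_D2_presheaf \<Phi>(1) f x] sect_at_in[OF inf_D2_presheaf \<Phi>(2) f x]])
    fix g d assume g: "g \<in> over f" and d: "d \<in> DD g"
    have "(d, zero_at g) \<in> Sec (inf_D2 R) (Dom C g)" "(zero_at g, d) \<in> Sec (inf_D2 R) (Dom C g)"
      using inf_axes[OF into_Ob[OF g] d, of 2] by (simp_all flip: inf_psh_2)
    then show "sect_at (inf_D2 R) \<Phi> f x g (d, zero_at g) = sect_at (inf_D2 R) \<Phi>' f x g (d, zero_at g) \<and>
      sect_at (inf_D2 R) \<Phi> f x g (zero_at g, d) = sect_at (inf_D2 R) \<Phi>' f x g (zero_at g, d)"
      using eq[OF into_comp[OF f g], of d] d f g by (simp add: sect_at_def)
  qed
qed

lemma inf_D_sect_eqI: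
  assumes \<Phi>: "\<Phi> \<in> psh_maps c (inf_D R) (Sect C G)" "\<Phi>' \<in> psh_maps c (inf_D R) (Sect C G)"
    and eq: "\<And>f d e. \<lbrakk>f \<in> into C c; d \<in> DD f; e \<in> DD f\<rbrakk> \<Longrightarrow>
      \<Phi> f (d \<otimes>\<^bsub>RD f\<^esub> e) = \<Phi>' f (d \<otimes>\<^bsub>RD f\<^esub> e)"
  shows "\<Phi> = \<Phi>'"
proof (rule sect_maps_eqI[OF inf_D_presheaf \<Phi>])
  fix f x assume f: "f \<in> into C c" and x: "x \<in> MD f"
  show "sect_at (inf_D R) \<Phi> f x = sect_at (inf_D R) \<Phi>' f x"
  proof (rule inf_D_maps_eqI[OF into_Ob[OF f] microlinear_tot
        sect_at_in[OF inf_D_presheaf \<Phi>(1) f x] sect_at_in[OF inf_D_presheaf \<Phi>(2) f x]])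
    fix g d e assume g: "g \<in> over f" and d: "d \<in> DD g" "e \<in> DD g"
    then show "sect_at (inf_D R) \<Phi> f x g (d \<otimes>\<^bsub>RD g\<^esub> e) = sect_at (inf_D R) \<Phi>' f x g (d \<otimes>\<^bsub>RD g\<^esub> e)"
      using eq[OF into_comp[OF f g], of d e] f g by (simp add: sect_at_def)
  qed
qed

section \<open>Sections of the Lie algebroid as curves of sections of the groupoid\<close>

lemma AG_at_iff:
  "t \<in> AG_at C R G c x \<longleftrightarrow> t \<in> psh_maps c (inf_D R) (Tot G) \<and>
     t (Id C c) \<zero>\<^bsub>Rng R c\<^esub> = gid G c x \<and>
     (\<forall>f\<in>into C c. \<forall>d\<in>DD f. gsrc G (Dom C f) (t f d) = Res (Base G) f x)"
  by (simp add: AG_at_def exp_psh_def)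

lemma Gamma_iff:
  "X \<in> \<Gamma> c \<longleftrightarrow> X \<in> psh_maps c (Base G) (AG C R G) \<and>
     (\<forall>f\<in>into C c. \<forall>x\<in>MD f. X f x \<in> AG_at C R G (Dom C f) x)"
  by (simp add: GammaAG_def exp_psh_def)

lemma Gamma_memI:
  assumes "\<And>f x. \<lbrakk>f \<in> into C c; x \<in> MD f\<rbrakk> \<Longrightarrow> X f x \<in> AG_at C R G (Dom C f) x"
    and "\<And>f g x. \<lbrakk>f \<in> into C c; g \<in> over f; x \<in> MD f\<rbrakk>
      \<Longrightarrow> maps_res C g (X f x) = X (f \<cdot> g) (Res (Base G) g x)"
  shows "(\<lambda>f\<in>into C c. \<lambda>x\<in>MD f. X f x) \<in> \<Gamma> c"
proof -
  have "X f x \<in> Sec (AG C R G) (Dom C f)" if "f \<in> into C c" "x \<in> MD f" for f x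
    using assms(1)[OF that] that by (auto simp: AG_def)
  moreover have "Res (AG C R G) = maps_res C" by (simp add: AG_def)
  ultimately show ?thesis
    using maps_memI[of c "loc C (Base G)" X "loc C (AG C R G)"] assms res_base(1)
    by (simp add: Gamma_iff)
qed

text \<open>The counterpart of \<open>sect_maps_shift\<close>: \<open>flow\<close> uses the values
  of X at identity arrows, and this recovers the others.\<close>

lemma Gamma_shift:
  assumes X: "X \<in> \<Gamma> c" and f: "f \<in> into C c" and x: "x \<in> MD f"
    and g: "g \<in> over f"
  shows "X f x g = X (f \<cdot> g) (Res (Base G) g x) (Id C (Dom C g))"
proof -
  have "X \<in> psh_maps c (Base G) (AG C R G)" using X by (simp add: Gamma_iff)
  from maps_natural[OF this f g, of x] x have "maps_res C g (X f x) = X (f \<cdot> g) (Res (Base G) g x)"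
    by (simp add: AG_def)
  then have "X (f \<cdot> g) (Res (Base G) g x) (Id C (Dom C g)) = maps_res C g (X f x) (Id C (Dom C g))" by simp
  also have "\<dots> = X f x g" using g by simp
  finally show ?thesis ..
qed

lemma Gamma_AG: "\<lbrakk>X \<in> \<Gamma> c; f \<in> into C c; x \<in> MD f\<rbrakk>
    \<Longrightarrow> X f x \<in> AG_at C R G (Dom C f) x"
  by (simp add: Gamma_iff)

lemma to_curve_apply:
  assumes "f \<in> into C c" "d \<in> DD f" "g \<in> over f" "x \<in> MD g"
  shows "to_curve C R G c X f d g x = X (f \<cdot> g) x (Id C (Dom C g)) (RRes R g d)"
  using assms by (simp add: to_curve_def flow_def)

lemma flow_eq_to_curve:
  "\<lbrakk>f \<in> into C c; d \<in> DD f\<rbrakk> \<Longrightarrow>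
    flow C R G (Dom C f) (maps_res C f X) d = to_curve C R G c X f d"
  by (simp add: to_curve_def)

text \<open>Exchanging the arguments x and d costs a change of stage: a section at the stage of d
  has values at points x of later stages, to which d has to be restricted.\<close>

lemma to_curve_in:
  assumes X: "X \<in> \<Gamma> c"
  shows "to_curve C R G c X \<in> psh_maps c (inf_D R) (Sect C G)"
proof -
  have "(\<lambda>f\<in>into C c. \<lambda>d\<in>El (loc C (inf_D R)) f. flow C R G (Dom C f) (maps_res C f X) d)
    \<in> psh_maps c (inf_D R) (Sect C G)"
  proof (rule maps_memI)
    fix f d assume f: "f \<in> into C c" and "d \<in> El (loc C (inf_D R)) f"
    then have d: "d \<in> DD f" by simp
    show "flow C R G (Dom C f) (maps_res C f X) d \<in> El (loc C (Sect C G)) f"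
      unfolding flow_def El_loc
    proof (rule sect_memI)
      fix g x assume g: "g \<in> over f" and x: "x \<in> MD g"
      note fg = into_comp[OF f g] and dg = inf_D_res[OF g d]
      have x': "x \<in> MD (f \<cdot> g)" using f g x by simp
      have D: "Dom C (Id C (Dom C g)) = Dom C g" using g by (intro Id_Dom) simp
      have I: "Id C (Dom C g) \<in> over g" using g by simp
      have "X (f \<cdot> g) x \<in> AG_at C R G (Dom C g) x" using Gamma_AG[OF X fg x'] f g by simp
      then have t: "X (f \<cdot> g) x \<in> psh_maps (Dom C g) (inf_D R) (Tot G)"
        and ts: "\<forall>k\<in>over g. \<forall>d\<in>DD k.
          gsrc G (Dom C k) (X (f \<cdot> g) x k d) = Res (Base G) k x"
        by (simp_all add: AG_at_iff)
      have t2: "gsrc G (Dom C g) (X (f \<cdot> g) x (Id C (Dom C g)) (RRes R g d)) = x"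
        using bspec[OF bspec[OF ts I], unfolded D, OF dg] g x by (simp add: res_base(2))
      show "maps_res C f X g x (Id C (Dom C g)) (RRes R g d) \<in> Sec (Tot G) (Dom C g) \<and>
          gsrc G (Dom C g) (maps_res C f X g x (Id C (Dom C g)) (RRes R g d)) = x"
        using maps_closed[OF t I, of "RRes R g d"] t2 dg g by (simp add: D)
      fix k assume k: "k \<in> over g"
      have k': "k \<in> over (f \<cdot> g)" using f g k by simp
      have "Res (Tot G) k (X (f \<cdot> g) x (Id C (Dom C g)) (RRes R g d)) = X (f \<cdot> g) x k (RRes R k (RRes R g d))"
        using maps_natural[OF t I, of k "RRes R g d"] k dg by (simp add: D)
      also have "\<dots> = X (f \<cdot> g \<cdot> k) (Res (Base G) k x) (Id C (Dom C k)) (RRes R (g \<cdot> k) d)"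
        using Gamma_shift[OF X fg x' k'] RRes_comp[OF g k, of d] d by simp
      finally show "Res (Tot G) k (maps_res C f X g x (Id C (Dom C g)) (RRes R g d)) =
         maps_res C f X (g \<cdot> k) (Res (Base G) k x) (Id C (Dom C (g \<cdot> k))) (RRes R (g \<cdot> k) d)"
        using g k by (simp add: comp_assoc[OF f g k])
    qed
    fix g assume g: "g \<in> over f"
    show "Rs (loc C (inf_D R)) g d \<in> El (loc C (inf_D R)) (f \<cdot> g)"
      using inf_D_res[OF g d] f g by simp
    show "Rs (loc C (Sect C G)) g (flow C R G (Dom C f) (maps_res C f X) d) =
        flow C R G (Dom C (f \<cdot> g)) (maps_res C (f \<cdot> g) X) (Rs (loc C (inf_D R)) g d)"
    proof (rule ext)
      fix k
      show "Rs (loc C (Sect C G)) g (flow C R G (Dom C f) (maps_res C f X) d) k =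
        flow C R G (Dom C (f \<cdot> g)) (maps_res C (f \<cdot> g) X) (Rs (loc C (inf_D R)) g d) k"
        using f g d by (cases "k \<in> over g")
          (auto simp: flow_def maps_res_def comp_assoc[OF f g] RRes_comp[OF g])
    qed
  qed
  then show ?thesis by (simp add: to_curve_def)
qed

lemma to_curve_0:
  assumes X: "X \<in> \<Gamma> c" and f: "f \<in> into C c"
  shows "to_curve C R G c X f (zero_at f) = sunit (Dom C f)"
proof -
  interpret K: cring "RD f" using f by (intro cring_Rng) simp
  have z: "zero_at f \<in> DD f" by simp
  show ?thesis
  proof (rule sect_eqI[OF sect_maps_closed[OF to_curve_in[OF X] f z] sect_unit_in])
    fix g x assume g: "g \<in> over f" and x: "x \<in> MD g"
    have "x \<in> MD (f \<cdot> g)" using f g x by simp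
    from Gamma_AG[OF X into_comp[OF f g] this]
    show "to_curve C R G c X f (zero_at f) g x = sunit (Dom C f) g x"
      unfolding to_curve_apply[OF f z g x]
      using f g x by (simp add: AG_at_iff RRes_simps(5)[OF g] sect_unit_apply)
  qed
qed

lemma of_curve_eq: "of_curve C R G c \<tau> = (\<lambda>f\<in>into C c. \<lambda>x\<in>MD f. sect_at (inf_D R) \<tau> f x)"
  by (simp add: of_curve_def sect_at_def)

lemma of_curve_in:
  assumes \<tau>: "\<tau> \<in> psh_maps c (inf_D R) (Sect C G)"
    and \<tau>0: "\<And>f. f \<in> into C c \<Longrightarrow> \<tau> f (zero_at f) = sunit (Dom C f)"
  shows "of_curve C R G c \<tau> \<in> \<Gamma> c"
  unfolding of_curve_eq
proof (rule Gamma_memI)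
  fix f x assume f: "f \<in> into C c" and x: "x \<in> MD f"
  interpret K: cring "RD f" using f by (intro cring_Rng) simp
  have D: "Dom C (Id C (Dom C f)) = Dom C f" using f by (intro Id_Dom) simp
  have "sect_at (inf_D R) \<tau> f x (Id C (Dom C f)) (zero_at f) = gid G (Dom C f) x"
    using f x \<tau>0[OF f] by (simp add: sect_at_def D res_base(2) sect_unit_apply)
  moreover have "gsrc G (Dom C g) (sect_at (inf_D R) \<tau> f x g d) = Res (Base G) g x"
    if g: "g \<in> over f" and d: "d \<in> DD g" for g d
  proof -
    have d': "d \<in> DD (f \<cdot> g)" and I: "Id C (Dom C g) \<in> over (f \<cdot> g)"
      using d f g by simp_all
    have D: "Dom C (Id C (Dom C g)) = Dom C g" using g by (intro Id_Dom) simp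
    show ?thesis
      using sect_simps(2)[OF sect_maps_closed[OF \<tau> into_comp[OF f g] d'] I, unfolded D, OF res_base(1)[OF g x]] g d
      by (simp add: sect_at_def)
  qed
  ultimately show "sect_at (inf_D R) \<tau> f x \<in> AG_at C R G (Dom C f) x"
    using sect_at_in[OF inf_D_presheaf \<tau> f x] by (simp add: AG_at_iff)
  fix g assume g: "g \<in> over f"
  show "maps_res C g (sect_at (inf_D R) \<tau> f x) = sect_at (inf_D R) \<tau> (f \<cdot> g) (Res (Base G) g x)"
  proof (rule ext)
    fix k show "maps_res C g (sect_at (inf_D R) \<tau> f x) k = sect_at (inf_D R) \<tau> (f \<cdot> g) (Res (Base G) g x) k"
      using f g x by (cases "k \<in> over g")
        (auto simp: sect_at_def maps_res_def comp_assoc[OF f g] res_base(3)[OF g] intro!: restrict_ext)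
  qed
qed

lemma to_of_curve:
  assumes \<tau>: "\<tau> \<in> psh_maps c (inf_D R) (Sect C G)"
    and \<tau>0: "\<And>f. f \<in> into C c \<Longrightarrow> \<tau> f (zero_at f) = sunit (Dom C f)"
  shows "to_curve C R G c (of_curve C R G c \<tau>) = \<tau>"
proof (rule maps_eqI[OF to_curve_in[OF of_curve_in[OF \<tau> \<tau>0]] \<tau>], assumption)
  fix f d assume f: "f \<in> into C c" and "d \<in> El (loc C (inf_D R)) f"
  then have d: "d \<in> DD f" by simp
  show "to_curve C R G c (of_curve C R G c \<tau>) f d = \<tau> f d"
  proof (rule sect_eqI[OF sect_maps_closed[OF to_curve_in[OF of_curve_in[OF \<tau> \<tau>0]] f d] sect_maps_closed[OF \<tau> f d]], assumption)
    fix g x assume g: "g \<in> over f" and x: "x \<in> MD g"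
    have D: "Dom C (Id C (Dom C g)) = Dom C g" using g by (intro Id_Dom) simp
    have "to_curve C R G c (of_curve C R G c \<tau>) f d g x = \<tau> (f \<cdot> g) (RRes R g d) (Id C (Dom C g)) x"
      unfolding to_curve_apply[OF f d g x]
      using f g x inf_D_res[OF g d] comp_Id[OF into_comp[OF f g]]
      by (simp add: of_curve_def D res_base(2) del: inf_D_simps)
    then show "to_curve C R G c (of_curve C R G c \<tau>) f d g x = \<tau> f d g x"
      using sect_maps_shift[OF \<tau> f d g] by simp
  qed
qed

lemma of_to_curve:
  assumes X: "X \<in> \<Gamma> c"
  shows "of_curve C R G c (to_curve C R G c X) = X"
proof -
  have XG: "X \<in> psh_maps c (Base G) (AG C R G)" using X by (simp add: Gamma_iff)
  have OG: "of_curve C R G c (to_curve C R G c X) \<in> psh_maps c (Base G) (AG C R G)"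
    using of_curve_in[OF to_curve_in[OF X] to_curve_0[OF X]] by (simp add: Gamma_iff)
  show ?thesis
  proof (rule maps_eqI[OF OG XG])
    fix f x assume f: "f \<in> into C c" and "x \<in> El (loc C (Base G)) f"
    then have x: "x \<in> MD f" by simp
    have t: "X f x \<in> psh_maps (Dom C f) (inf_D R) (Tot G)"
      using Gamma_AG[OF X f x] by (simp add: AG_at_iff)
    have o: "of_curve C R G c (to_curve C R G c X) f x = sect_at (inf_D R) (to_curve C R G c X) f x"
      using f x by (simp add: of_curve_eq)
    show "of_curve C R G c (to_curve C R G c X) f x = X f x"
      unfolding o
    proof (rule maps_eqI[OF sect_at_in[OF inf_D_presheaf to_curve_in[OF X] f x] t])
      fix g d assume g: "g \<in> over f" and "d \<in> El (loc C (inf_D R)) g"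
      then have d: "d \<in> DD g" by simp
      have D: "Dom C (Id C (Dom C g)) = Dom C g" using g by (intro Id_Dom) simp
      have d': "d \<in> DD (f \<cdot> g)" and I: "Id C (Dom C g) \<in> over (f \<cdot> g)"
        using d f g by simp_all
      have "sect_at (inf_D R) (to_curve C R G c X) f x g d =
          to_curve C R G c X (f \<cdot> g) d (Id C (Dom C g)) (Res (Base G) g x)"
        using g d by (simp add: sect_at_def)
      also have "\<dots> = X (f \<cdot> g) (Res (Base G) g x) (Id C (Dom C g)) d"
        using to_curve_apply[OF into_comp[OF f g] d' I, unfolded D, OF res_base(1)[OF g x]]
          comp_Id[OF into_comp[OF f g]] f g d by (simp add: RRes_Id)
      also have "\<dots> = X f x g d" using Gamma_shift[OF X f x g] by simp
      finally show "sect_at (inf_D R) (to_curve C R G c X) f x g d = X f x g d" .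
    qed
  qed
qed

text \<open>The existence half of the bracket. At each x the map into G factors through the
  multiplication of D, and uniqueness of the factor makes it compatible with restriction of
  x.\<close>

lemma Gamma_of_product:
  assumes \<Phi>: "\<Phi> \<in> psh_maps c (inf_psh R 3) (Sect C G)"
    and ax: "\<And>f d. \<lbrakk>f \<in> into C c; d \<in> DD f\<rbrakk> \<Longrightarrow>
      \<Phi> f (d, zero_at f) = sunit (Dom C f) \<and>
      \<Phi> f (zero_at f, d) = sunit (Dom C f)"
  obtains Z where "Z \<in> \<Gamma> c"
    and "\<And>f d e. \<lbrakk>f \<in> into C c; d \<in> DD f; e \<in> DD f\<rbrakk>
      \<Longrightarrow> to_curve C R G c Z f (d \<otimes>\<^bsub>RD f\<^esub> e) = \<Phi> f (d, e)"
proof -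
  have z: "zero_at f \<in> DD f" if "f \<in> into C c" for f c
  proof -
    interpret K: cring "RD f" using that by (intro cring_Rng) simp
    show ?thesis by simp
  qed
  have pt: "(d, e) \<in> Sec (inf_psh R 3) (Dom C f)"
    if "f \<in> into C c" "d \<in> DD f" "e \<in> DD f" for f c d e
    using inf_points_D[of "Dom C f"] that by simp
  have mult: "d \<otimes>\<^bsub>RD f\<^esub> e \<in> DD f"
    if "f \<in> into C c" "d \<in> DD f" "e \<in> DD f" for f c d e
    using inf_D_mult[of "Dom C f" d e] that by simp
  let ?P = "\<lambda>f x \<chi>. \<chi> \<in> psh_maps (Dom C f) (inf_D R) (Tot G) \<and>
     (\<forall>g\<in>over f. \<forall>d\<in>DD g. \<forall>e\<in>DD g.
        \<chi> g (d \<otimes>\<^bsub>RD g\<^esub> e) = \<Phi> (f \<cdot> g) (d, e) (Id C (Dom C g)) (Res (Base G) g x))"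
  have "\<exists>\<chi>. ?P f x \<chi>" if f: "f \<in> into C c" and x: "x \<in> MD f" for f x
  proof -
    have "sect_at (inf_psh R 3) \<Phi> f x g (d, zero_at g) =
         sect_at (inf_psh R 3) \<Phi> f x g (zero_at g, zero_at g) \<and>
       sect_at (inf_psh R 3) \<Phi> f x g (zero_at g, d) =
         sect_at (inf_psh R 3) \<Phi> f x g (zero_at g, zero_at g)"
      if g: "g \<in> over f" and d: "d \<in> DD g" for g d
      using pt[OF g d z[OF g]] pt[OF g z[OF g] d] pt[OF g z[OF g] z[OF g]]
        ax[OF into_comp[OF f g], of d] ax[OF into_comp[OF f g], of "zero_at g"] f g d z[OF g]
      by (simp add: sect_at_def)
    then obtain \<chi> where \<chi>: "\<chi> \<in> psh_maps (Dom C f) (inf_D R) (Tot G)"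
      "\<And>g d e. \<lbrakk>g \<in> over f; d \<in> DD g; e \<in> DD g\<rbrakk> \<Longrightarrow>
        \<chi> g (d \<otimes>\<^bsub>RD g\<^esub> e) = sect_at (inf_psh R 3) \<Phi> f x g (d, e)"
      using inf_D_product_factor[OF into_Ob[OF f] microlinear_tot sect_at_in[OF inf_psh_presheaf \<Phi> f x]] by blast
    have "?P f x \<chi>"
    proof (intro conjI \<chi>(1) ballI)
      fix g d e assume g: "g \<in> over f" "d \<in> DD g" "e \<in> DD g"
      show "\<chi> g (d \<otimes>\<^bsub>RD g\<^esub> e) = \<Phi> (f \<cdot> g) (d, e) (Id C (Dom C g)) (Res (Base G) g x)"
        using \<chi>(2)[OF g] pt[OF g] g(1) by (simp add: sect_at_def)
    qed
    then show ?thesis by (rule exI[of _ \<chi>])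
  qed
  \<comment> \<open>The factors are chosen independently for each stage and point; that the choice
    is natural is derived below from uniqueness.\<close>
  then obtain Z where Z: "\<And>f x. \<lbrakk>f \<in> into C c; x \<in> MD f\<rbrakk> \<Longrightarrow> ?P f x (Z f x)" by metis
  note Z1 = conjunct1[OF Z] and Z2 = conjunct2[OF Z, rule_format]
  let ?Z = "\<lambda>f\<in>into C c. \<lambda>x\<in>MD f. Z f x"
  have Zin: "?Z \<in> \<Gamma> c"
  proof (rule Gamma_memI)
    fix f x assume f: "f \<in> into C c" and x: "x \<in> MD f"
    interpret K: cring "RD f" using f by (intro cring_Rng) simp
    have D: "Dom C (Id C (Dom C f)) = Dom C f" using f by (intro Id_Dom) simp
    have I: "Id C (Dom C f) \<in> over f" using f by simp
    \<comment> \<open>0 is the product of 0 with itself, so the value there is that of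
      \<open>\<Phi>\<close> at the origin.\<close>
    have "Z f x (Id C (Dom C f)) (zero_at f) = gid G (Dom C f) x"
      using Z2[OF f x I z[OF I] z[OF I]] ax[OF f z[OF f]] f x
      by (simp add: D res_base(2) sect_unit_apply)
    moreover have "gsrc G (Dom C g) (Z f x g d) = Res (Base G) g x"
      if "g \<in> over f" "d \<in> DD g" for g d
    proof -
      let ?s = "\<lambda>g\<in>over f. \<lambda>d\<in>DD g. gsrc G (Dom C g) (Z f x g d)"
      let ?x = "\<lambda>g\<in>over f. \<lambda>d\<in>DD g. Res (Base G) g x"
      \<comment> \<open>The source is known at the products d e, because \<open>\<Phi>\<close>
        consists of sections; that it is x on all of D follows since the base is
        microlinear.\<close>
      have "?s = ?x"
      proof (rule inf_D_maps_eqI[OF into_Ob[OF f] microlinear_base])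
        have "(\<lambda>g\<in>over f. \<lambda>d\<in>El (loc C (inf_D R)) g. gsrc G (Dom C g) (Z f x g d))
          \<in> psh_maps (Dom C f) (inf_D R) (Base G)"
        proof (rule maps_memI)
          fix g d assume g: "g \<in> over f" and d: "d \<in> El (loc C (inf_D R)) g"
          have t: "Z f x g d \<in> Sec (Tot G) (Dom C g)" using maps_closed[OF Z1[OF f x] g d] by simp
          then show "gsrc G (Dom C g) (Z f x g d) \<in> El (loc C (Base G)) g"
            using gsrc_closed[of "Dom C g"] g by simp
          fix k assume k: "k \<in> over g"
          show "Rs (loc C (inf_D R)) k d \<in> El (loc C (inf_D R)) (g \<cdot> k)"
            using inf_D_res[OF k, of d] d g k by simp
          show "Rs (loc C (Base G)) k (gsrc G (Dom C g) (Z f x g d)) =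
            gsrc G (Dom C (g \<cdot> k)) (Z f x (g \<cdot> k) (Rs (loc C (inf_D R)) k d))"
            using maps_natural[OF Z1[OF f x] g k d] gpd_natural(2)[OF k t] g k by simp
        qed
        then show "?s \<in> psh_maps (Dom C f) (inf_D R) (Base G)" by simp
        have "(\<lambda>g\<in>over f. \<lambda>d\<in>El (loc C (inf_D R)) g. Res (Base G) g x)
          \<in> psh_maps (Dom C f) (inf_D R) (Base G)"
        proof (rule maps_memI)
          fix g d assume g: "g \<in> over f" and d: "d \<in> El (loc C (inf_D R)) g"
          show "Res (Base G) g x \<in> El (loc C (Base G)) g" using res_base(1)[OF g x] by simp
          fix k assume k: "k \<in> over g"
          show "Rs (loc C (inf_D R)) k d \<in> El (loc C (inf_D R)) (g \<cdot> k)"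
            using inf_D_res[OF k, of d] d g k by simp
          show "Rs (loc C (Base G)) k (Res (Base G) g x) = Res (Base G) (g \<cdot> k) x"
            using res_base(3)[OF g k x] by simp
        qed
        then show "?x \<in> psh_maps (Dom C f) (inf_D R) (Base G)" by simp
        fix g d e assume g: "g \<in> over f" and d: "d \<in> DD g" "e \<in> DD g"
        have p: "(d, e) \<in> Sec (inf_psh R 3) (Dom C (f \<cdot> g))" and I: "Id C (Dom C g) \<in> over (f \<cdot> g)"
          using pt[OF g d] f g by simp_all
        have D: "Dom C (Id C (Dom C g)) = Dom C g" using g by (intro Id_Dom) simp
        have "gsrc G (Dom C g) (Z f x g (d \<otimes>\<^bsub>RD g\<^esub> e)) = Res (Base G) g x"
          using Z2[OF f x g d] sect_simps(2)[OF sect_maps_closed[OF \<Phi> into_comp[OF f g] p] I, unfolded D, OF res_base(1)[OF g x]]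
          by simp
        then show "?s g (d \<otimes>\<^bsub>RD g\<^esub> e) = ?x g (d \<otimes>\<^bsub>RD g\<^esub> e)"
          using g mult[OF g d] by (simp del: inf_D_simps)
      qed
      from fun_cong[OF fun_cong[OF this, of g], of d] show ?thesis using that by (simp del: inf_D_simps)
    qed
    ultimately show "Z f x \<in> AG_at C R G (Dom C f) x"
      using Z1[OF f x] by (simp add: AG_at_iff)
    fix g assume g: "g \<in> over f"
    have xg: "Res (Base G) g x \<in> MD (f \<cdot> g)" using res_base(1)[OF g x] f g by simp
    \<comment> \<open>Over the domain of \<open>g\<close>, both sides factor the same map through
      the multiplication.\<close>
    show "maps_res C g (Z f x) = Z (f \<cdot> g) (Res (Base G) g x)"
    proof (rule inf_D_maps_eqI[OF into_Ob[OF g] microlinear_tot maps_res_in[OF Z1[OF f x] g]])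
      show "Z (f \<cdot> g) (Res (Base G) g x) \<in> psh_maps (Dom C g) (inf_D R) (Tot G)"
        using Z1[OF into_comp[OF f g] xg] f g by simp
      fix k d e assume k: "k \<in> over g" and d: "d \<in> DD k" "e \<in> DD k"
      have k': "k \<in> over (f \<cdot> g)" using f g k by simp
      have gk: "Dom C (g \<cdot> k) = Dom C k" using g k by simp
      show "maps_res C g (Z f x) k (d \<otimes>\<^bsub>RD k\<^esub> e) = Z (f \<cdot> g) (Res (Base G) g x) k (d \<otimes>\<^bsub>RD k\<^esub> e)"
        using Z2[OF f x into_comp[OF g k], unfolded gk, OF d] Z2[OF into_comp[OF f g] xg k' d] k
        by (simp add: comp_assoc[OF f g k] res_base(3)[OF g k x])
    qed
  qed
  show thesis
  proof (rule that[OF Zin])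
    fix f d e assume f: "f \<in> into C c" and d: "d \<in> DD f" "e \<in> DD f"
    note de = mult[OF f d] and p = pt[OF f d]
    show "to_curve C R G c ?Z f (d \<otimes>\<^bsub>RD f\<^esub> e) = \<Phi> f (d, e)"
    proof (rule sect_eqI[OF sect_maps_closed[OF to_curve_in[OF Zin] f de] sect_maps_closed[OF \<Phi> f p]])
      fix g x assume g: "g \<in> over f" and x: "x \<in> MD g"
      have x': "x \<in> MD (f \<cdot> g)" using f g x by simp
      have D: "Dom C (Id C (Dom C g)) = Dom C g" using g by (intro Id_Dom) simp
      have I: "Id C (Dom C g) \<in> over (f \<cdot> g)" using f g by simp
      have "RRes R g (d \<otimes>\<^bsub>RD f\<^esub> e) = RRes R g d \<otimes>\<^bsub>RD g\<^esub> RRes R g e"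
        using d by (intro RRes_simps(2)[OF g]) simp_all
      then have "to_curve C R G c ?Z f (d \<otimes>\<^bsub>RD f\<^esub> e) g x =
          Z (f \<cdot> g) x (Id C (Dom C g)) (RRes R g d \<otimes>\<^bsub>RD g\<^esub> RRes R g e)"
        unfolding to_curve_apply[OF f de g x] using f g x x' by simp
      also have "\<dots> = \<Phi> (f \<cdot> g) (RRes R g d, RRes R g e) (Id C (Dom C g)) x"
        using Z2[OF into_comp[OF f g] x' I, unfolded D, OF inf_D_res[OF g d(1)] inf_D_res[OF g d(2)]] g x
          comp_Id[OF into_comp[OF f g]] f by (simp add: res_base(2))
      also have "\<dots> = \<Phi> f (d, e) g x" using sect_maps_shift[OF \<Phi> f p g] by simp
      finally show "to_curve C R G c ?Z f (d \<otimes>\<^bsub>RD f\<^esub> e) g x = \<Phi> f (d, e) g x" .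
    qed
  qed
qed

end

section \<open>The module of sections of the Lie algebroid\<close>

context group
begin

text \<open>The order of the factors is that of the equation defining the bracket, with inverses in
  place of negative parameters.\<close>

definition commutator :: "'a \<Rightarrow> 'a \<Rightarrow> 'a" where
  "commutator x y = inv y \<otimes> inv x \<otimes> y \<otimes> x"

lemma commutator_closed [simp, intro]:
  "\<lbrakk>x \<in> carrier G; y \<in> carrier G\<rbrakk> \<Longrightarrow> commutator x y \<in> carrier G"
  by (simp add: commutator_def)

lemma cancel_inv:
  "\<lbrakk>x \<in> carrier G; y \<in> carrier G\<rbrakk> \<Longrightarrow> inv x \<otimes> (x \<otimes> y) = y"
  "\<lbrakk>x \<in> carrier G; y \<in> carrier G\<rbrakk> \<Longrightarrow> x \<otimes> (inv x \<otimes> y) = y"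
  by (simp_all flip: m_assoc)

lemma inv_commutator:
  "\<lbrakk>x \<in> carrier G; y \<in> carrier G\<rbrakk> \<Longrightarrow> inv (commutator x y) = commutator y x"
  by (simp add: commutator_def inv_mult_group m_assoc)

text \<open>In general the factor \<open>commutator x y\<close> appears conjugated by
  \<open>z\<close>; the hypothesis removes the conjugation.\<close>

lemma commutator_mult_right:
  assumes xyz: "x \<in> carrier G" "y \<in> carrier G" "z \<in> carrier G"
    and comm: "commutator x y \<otimes> z = z \<otimes> commutator x y"
  shows "commutator x (y \<otimes> z) = commutator x y \<otimes> commutator x z"
proof -
  have "commutator x (y \<otimes> z) = inv z \<otimes> (commutator x y \<otimes> z) \<otimes> commutator x z"
    using xyz by (simp add: commutator_def inv_mult_group m_assoc cancel_inv)
  also have "\<dots> = commutator x y \<otimes> commutator x z"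
    unfolding comm using xyz by (simp add: m_assoc cancel_inv)
  finally show ?thesis .
qed

text \<open>Expanded into words, the product cancels letter by letter. The inverses inside the
  commutators belong to the general identity and disappear only in its application to
  curves.\<close>

lemma hall_witt:
  assumes "x \<in> carrier G" "y \<in> carrier G" "z \<in> carrier G"
  shows "(inv y \<otimes> commutator z (commutator (inv y) x) \<otimes> y) \<otimes>
     (inv z \<otimes> commutator x (commutator (inv z) y) \<otimes> z) \<otimes>
     (inv x \<otimes> commutator y (commutator (inv x) z) \<otimes> x) = \<one>"
  using assms by (simp add: commutator_def inv_mult_group m_assoc cancel_inv)

end

section \<open>Parameters in D and D(2), and products of curves\<close>

context lie_setting
begin

abbreviation curve where "curve c X \<equiv> to_curve C R G c X"

text \<open>Commutators need inverses, which a general section does not have; the values of curves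
  lie in this group of units.\<close>

abbreviation sect_group where "sect_group c \<equiv> units_of (sect_monoid c)"

lemma group_sect: "group (sect_group c)"
  by (rule monoid.units_group[OF monoid_sect])

lemma sect_group_simps:
  "monoid.mult (sect_group c) = mul c" "one (sect_group c) = sunit c"
  by (simp_all add: units_of_def)

lemma zero_in_D: "c \<in> Ob C \<Longrightarrow> \<zero>\<^bsub>Rng R c\<^esub> \<in> Sec (inf_D R) c"
  using cring.cring_simprules(2,26)[OF cring_Rng, of c] by simp

lemma neg_in_D:
  assumes "c \<in> Ob C" "d \<in> Sec (inf_D R) c"
  shows "\<ominus>\<^bsub>Rng R c\<^esub> d \<in> Sec (inf_D R) c"
proof -
  interpret K: cring "Rng R c" using assms by (intro cring_Rng)
  show ?thesis using assms by (simp add: K.l_minus K.r_minus)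
qed

lemma add_in_D:
  assumes "c \<in> Ob C" "(d, e) \<in> Sec (inf_D2 R) c"
  shows "d \<oplus>\<^bsub>Rng R c\<^esub> e \<in> Sec (inf_D R) c"
proof -
  interpret K: cring "Rng R c" using assms by (intro cring_Rng)
  have "d \<in> carrier (Rng R c)" "e \<in> carrier (Rng R c)" "d \<otimes>\<^bsub>Rng R c\<^esub> d = \<zero>\<^bsub>Rng R c\<^esub>"
    "e \<otimes>\<^bsub>Rng R c\<^esub> e = \<zero>\<^bsub>Rng R c\<^esub>" "d \<otimes>\<^bsub>Rng R c\<^esub> e = \<zero>\<^bsub>Rng R c\<^esub>"
    "e \<otimes>\<^bsub>Rng R c\<^esub> d = \<zero>\<^bsub>Rng R c\<^esub>"
    using assms(2) K.m_comm by (auto simp: inf_D2_def)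
  then show ?thesis by (simp add: K.l_distr K.r_distr)
qed

lemma mult_in_D:
  assumes "c \<in> Ob C" "d \<in> Sec (inf_D R) c" "e \<in> Sec (inf_D R) c"
  shows "d \<otimes>\<^bsub>Rng R c\<^esub> e \<in> Sec (inf_D R) c"
  using inf_D_mult[OF assms(1) _ assms(3)] assms(2) by simp

text \<open>Both coordinates are multiples of the same d, so their product contains d d = 0. This is
  what (a + b) X = a X + b X rests on.\<close>

lemma pairs_in_D2:
  assumes c: "c \<in> Ob C" and a: "a \<in> carrier (Rng R c)" and b: "b \<in> carrier (Rng R c)"
    and d: "d \<in> Sec (inf_D R) c"
  shows "(a \<otimes>\<^bsub>Rng R c\<^esub> d, b \<otimes>\<^bsub>Rng R c\<^esub> d) \<in> Sec (inf_D2 R) c"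
proof -
  interpret K: cring "Rng R c" using c by (intro cring_Rng)
  have "(a \<otimes>\<^bsub>Rng R c\<^esub> d) \<otimes>\<^bsub>Rng R c\<^esub> (b \<otimes>\<^bsub>Rng R c\<^esub> d) = a \<otimes>\<^bsub>Rng R c\<^esub> b \<otimes>\<^bsub>Rng R c\<^esub> (d \<otimes>\<^bsub>Rng R c\<^esub> d)"
    using a b d by (simp add: K.m_ac)
  also have "\<dots> = \<zero>\<^bsub>Rng R c\<^esub>" using a b d by simp
  finally show ?thesis
    using inf_D_mult[OF c a d] inf_D_mult[OF c b d] by (simp add: inf_D2_def)
qed

lemma D2_diagonal: "\<lbrakk>c \<in> Ob C; d \<in> Sec (inf_D R) c\<rbrakk> \<Longrightarrow> (d, d) \<in> Sec (inf_D2 R) c"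
  by (simp add: inf_D2_def)

lemma D2_minus:
  assumes "c \<in> Ob C" "d \<in> Sec (inf_D R) c"
  shows "(\<ominus>\<^bsub>Rng R c\<^esub> d, d) \<in> Sec (inf_D2 R) c"
proof -
  interpret K: cring "Rng R c" using assms by (intro cring_Rng)
  show ?thesis using assms neg_in_D[OF assms] by (simp add: inf_D2_def K.l_minus)
qed

lemma D2_iff: "(d, e) \<in> Sec (inf_D2 R) c \<longleftrightarrow>
    d \<in> Sec (inf_D R) c \<and> e \<in> Sec (inf_D R) c \<and> d \<otimes>\<^bsub>Rng R c\<^esub> e = \<zero>\<^bsub>Rng R c\<^esub>"
  by (simp add: inf_D2_def)

lemma curve_closed:
  "\<lbrakk>X \<in> \<Gamma> c; f \<in> into C c; d \<in> DD f\<rbrakk>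
    \<Longrightarrow> curve c X f d \<in> SS (Dom C f)"
  by (rule sect_maps_closed[OF to_curve_in])

lemma curve_natural:
  "\<lbrakk>X \<in> \<Gamma> c; f \<in> into C c; g \<in> over f; d \<in> DD f\<rbrakk>
    \<Longrightarrow> maps_res C g (curve c X f d) = curve c X (f \<cdot> g) (RRes R g d)"
  by (drule maps_natural[OF to_curve_in, where f = f and g = g and x = d]) simp_all

lemma curve_eqI:
  assumes "X \<in> \<Gamma> c" "Y \<in> \<Gamma> c"
    and "\<And>f d. \<lbrakk>f \<in> into C c; d \<in> DD f\<rbrakk> \<Longrightarrow> curve c X f d = curve c Y f d"
  shows "X = Y"
proof -
  have "curve c X = curve c Y"
    by (rule maps_eqI[OF to_curve_in[OF assms(1)] to_curve_in[OF assms(2)]], rule assms(3))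
      (simp_all only: El_loc)
  from arg_cong[OF this, of "of_curve C R G c"] show ?thesis
    unfolding of_to_curve[OF assms(1)] of_to_curve[OF assms(2)] .
qed

lemma curve_product_eqI:
  assumes "X \<in> \<Gamma> c" "Y \<in> \<Gamma> c"
    and "\<And>f d e. \<lbrakk>f \<in> into C c; d \<in> DD f; e \<in> DD f\<rbrakk>
      \<Longrightarrow> curve c X f (d \<otimes>\<^bsub>RD f\<^esub> e) = curve c Y f (d \<otimes>\<^bsub>RD f\<^esub> e)"
  shows "X = Y"
proof -
  have "curve c X = curve c Y"
    by (rule inf_D_sect_eqI[OF to_curve_in[OF assms(1)] to_curve_in[OF assms(2)] assms(3)])
  from arg_cong[OF this, of "of_curve C R G c"] show ?thesis
    unfolding of_to_curve[OF assms(1)] of_to_curve[OF assms(2)] .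
qed

text \<open>Reparametrized curves: \<open>s\<close> is any natural family of elements of D, such as
  a projection, a sum, a negative or a scalar multiple.\<close>

lemma curve_comp_in:
  assumes A: "presheaf C A" and X: "X \<in> \<Gamma> c"
    and s: "\<And>f a. \<lbrakk>f \<in> into C c; a \<in> Sec A (Dom C f)\<rbrakk> \<Longrightarrow> s f a \<in> DD f"
    and nat: "\<And>f g a. \<lbrakk>f \<in> into C c; g \<in> over f; a \<in> Sec A (Dom C f)\<rbrakk>
      \<Longrightarrow> RRes R g (s f a) = s (f \<cdot> g) (Res A g a)"
  shows "(\<lambda>f\<in>into C c. \<lambda>a\<in>Sec A (Dom C f). curve c X f (s f a)) \<in> psh_maps c A (Sect C G)"
proof -
  have "(\<lambda>f\<in>into C c. \<lambda>a\<in>El (loc C A) f. curve c X f (s f a)) \<in> psh_maps c A (Sect C G)"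
  proof (rule maps_memI)
    fix f a assume f: "f \<in> into C c" and "a \<in> El (loc C A) f"
    then have a: "a \<in> Sec A (Dom C f)" by simp
    show "curve c X f (s f a) \<in> El (loc C (Sect C G)) f"
      using curve_closed[OF X f s[OF f a]] by simp
    fix g assume g: "g \<in> over f"
    show "Rs (loc C A) g a \<in> El (loc C A) (f \<cdot> g)" using presheaf_res[OF A g a] f g by simp
    show "Rs (loc C (Sect C G)) g (curve c X f (s f a)) = curve c X (f \<cdot> g) (s (f \<cdot> g) (Rs (loc C A) g a))"
      using curve_natural[OF X f g s[OF f a]] nat[OF f g a] by simp
  qed
  then show ?thesis by simp
qed

lemma sect_mult_maps_in:
  assumes A: "presheaf C A"
    and \<Phi>: "(\<lambda>f\<in>into C c. \<lambda>a\<in>Sec A (Dom C f). \<Phi> f a) \<in> psh_maps c A (Sect C G)"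
    and \<Psi>: "(\<lambda>f\<in>into C c. \<lambda>a\<in>Sec A (Dom C f). \<Psi> f a) \<in> psh_maps c A (Sect C G)"
  shows "(\<lambda>f\<in>into C c. \<lambda>a\<in>Sec A (Dom C f). mul (Dom C f) (\<Phi> f a) (\<Psi> f a))
    \<in> psh_maps c A (Sect C G)"
proof -
  have "(\<lambda>f\<in>into C c. \<lambda>a\<in>El (loc C A) f. mul (Dom C f) (\<Phi> f a) (\<Psi> f a))
    \<in> psh_maps c A (Sect C G)"
  proof (rule maps_memI)
    fix f a assume f: "f \<in> into C c" and "a \<in> El (loc C A) f"
    then have a: "a \<in> Sec A (Dom C f)" by simp
    have "\<Phi> f a \<in> SS (Dom C f)" "\<Psi> f a \<in> SS (Dom C f)"
      using sect_maps_closed[OF \<Phi> f a] sect_maps_closed[OF \<Psi> f a] f a by simp_all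
    then show "mul (Dom C f) (\<Phi> f a) (\<Psi> f a) \<in> El (loc C (Sect C G)) f"
      by (simp add: sect_mult_in)
    fix g assume g: "g \<in> over f"
    have a': "Res A g a \<in> Sec A (Dom C g)" by (rule presheaf_res[OF A g a])
    then show "Rs (loc C A) g a \<in> El (loc C A) (f \<cdot> g)" using f g by simp
    show "Rs (loc C (Sect C G)) g (mul (Dom C f) (\<Phi> f a) (\<Psi> f a)) =
        mul (Dom C (f \<cdot> g)) (\<Phi> (f \<cdot> g) (Rs (loc C A) g a)) (\<Psi> (f \<cdot> g) (Rs (loc C A) g a))"
      using maps_natural[OF \<Phi> f g, of a] maps_natural[OF \<Psi> f g, of a] f g a a'
      by (simp add: sect_mult_res[OF g])
  qed
  then show ?thesis by simp
qed

lemma sect_unit_mult: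
  "\<sigma> \<in> SS c \<Longrightarrow> mul c (sunit c) \<sigma> = \<sigma>"
  "\<sigma> \<in> SS c \<Longrightarrow> mul c \<sigma> (sunit c) = \<sigma>"
  using monoid.l_one[OF monoid_sect, of \<sigma> c] monoid.r_one[OF monoid_sect, of \<sigma> c] by simp_all

lemma D2_projections:
  assumes "f \<in> into C c" "a \<in> Sec (inf_D2 R) (Dom C f)"
  shows "fst a \<in> DD f" "snd a \<in> DD f"
    and "\<lbrakk>g \<in> over f\<rbrakk> \<Longrightarrow> RRes R g (fst a) = fst (Res (inf_D2 R) g a)"
    and "\<lbrakk>g \<in> over f\<rbrakk> \<Longrightarrow> RRes R g (snd a) = snd (Res (inf_D2 R) g a)"
  using assms by (auto simp: inf_D2_def)

lemma D2_product_in: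
  assumes X: "X \<in> \<Gamma> c" and Y: "Y \<in> \<Gamma> c"
  shows "(\<lambda>f\<in>into C c. \<lambda>a\<in>Sec (inf_D2 R) (Dom C f).
      mul (Dom C f) (curve c X f (fst a)) (curve c Y f (snd a)))
      \<in> psh_maps c (inf_D2 R) (Sect C G)"
    and "(\<lambda>f\<in>into C c. \<lambda>a\<in>Sec (inf_D2 R) (Dom C f).
      mul (Dom C f) (curve c Y f (snd a)) (curve c X f (fst a)))
      \<in> psh_maps c (inf_D2 R) (Sect C G)"
  by (intro sect_mult_maps_in inf_D2_presheaf curve_comp_in X Y; (rule D2_projections; assumption))+

lemma D2_axes:
  assumes "c \<in> Ob C" "d \<in> Sec (inf_D R) c"
  shows "(d, \<zero>\<^bsub>Rng R c\<^esub>) \<in> Sec (inf_D2 R) c" "(\<zero>\<^bsub>Rng R c\<^esub>, d) \<in> Sec (inf_D2 R) c"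
  using inf_axes[OF assms, of 2] by (simp_all flip: inf_psh_2)

text \<open>On either axis of D(2) one of the two curves is taken at 0 and is the unit, which
  commutes with everything.\<close>

lemma curve_commute:
  assumes X: "X \<in> \<Gamma> c" and Y: "Y \<in> \<Gamma> c"
    and f: "f \<in> into C c" and de: "(d, e) \<in> Sec (inf_D2 R) (Dom C f)"
  shows "mul (Dom C f) (curve c X f d) (curve c Y f e) =
    mul (Dom C f) (curve c Y f e) (curve c X f d)"
proof -
  let ?l = "\<lambda>f\<in>into C c. \<lambda>a\<in>Sec (inf_D2 R) (Dom C f).
      mul (Dom C f) (curve c X f (fst a)) (curve c Y f (snd a))"
  let ?r = "\<lambda>f\<in>into C c. \<lambda>a\<in>Sec (inf_D2 R) (Dom C f).
      mul (Dom C f) (curve c Y f (snd a)) (curve c X f (fst a))"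
  have "?l = ?r"
  proof (rule inf_D2_sect_eqI[OF D2_product_in[OF X Y]])
    fix f d assume f: "f \<in> into C c" and d: "d \<in> DD f"
    show "?l f (d, zero_at f) = ?r f (d, zero_at f) \<and>
      ?l f (zero_at f, d) = ?r f (zero_at f, d)"
      using D2_axes[OF into_Ob[OF f] d] f to_curve_0[OF X f] to_curve_0[OF Y f]
        curve_closed[OF X f d] curve_closed[OF Y f d] by (simp add: sect_unit_mult)
  qed
  from fun_cong[OF fun_cong[OF this, of f], of "(d, e)"] f de show ?thesis by simp
qed

text \<open>Both sides are maps out of D(2), and when one argument is 0 each of them is the curve of
  X at the other.\<close>

lemma curve_add:
  assumes X: "X \<in> \<Gamma> c" and f: "f \<in> into C c" and de: "(d, e) \<in> Sec (inf_D2 R) (Dom C f)"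
  shows "curve c X f (d \<oplus>\<^bsub>RD f\<^esub> e) = mul (Dom C f) (curve c X f d) (curve c X f e)"
proof -
  let ?l = "\<lambda>f\<in>into C c. \<lambda>a\<in>Sec (inf_D2 R) (Dom C f). curve c X f (fst a \<oplus>\<^bsub>RD f\<^esub> snd a)"
  let ?r = "\<lambda>f\<in>into C c. \<lambda>a\<in>Sec (inf_D2 R) (Dom C f).
      mul (Dom C f) (curve c X f (fst a)) (curve c X f (snd a))"
  have "?l = ?r"
  proof (rule inf_D2_sect_eqI[OF _ D2_product_in(1)[OF X X]])
    show "?l \<in> psh_maps c (inf_D2 R) (Sect C G)"
    proof (rule curve_comp_in[OF inf_D2_presheaf X])
      fix f a assume f: "f \<in> into C c" and a: "a \<in> Sec (inf_D2 R) (Dom C f)"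
      show "fst a \<oplus>\<^bsub>RD f\<^esub> snd a \<in> DD f"
        using add_in_D[of "Dom C f" "fst a" "snd a"] f a by simp
      fix g assume g: "g \<in> over f"
      show "RRes R g (fst a \<oplus>\<^bsub>RD f\<^esub> snd a) =
          fst (Res (inf_D2 R) g a) \<oplus>\<^bsub>RD (f \<cdot> g)\<^esub> snd (Res (inf_D2 R) g a)"
        using D2_projections[OF f a] f g by (simp add: RRes_simps(3)[OF g])
    qed
    fix f d assume f: "f \<in> into C c" and d: "d \<in> DD f"
    interpret K: cring "RD f" using f by (intro cring_Rng) simp
    show "?l f (d, zero_at f) = ?r f (d, zero_at f) \<and>
      ?l f (zero_at f, d) = ?r f (zero_at f, d)"
      using D2_axes[OF into_Ob[OF f] d] f d to_curve_0[OF X f] curve_closed[OF X f d] by (simp add: sect_unit_mult)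
  qed
  from fun_cong[OF fun_cong[OF this, of f], of "(d, e)"] f de show ?thesis by simp
qed

text \<open>Additivity and commutation at the element (-d, d) of D(2).\<close>

lemma curve_minus:
  assumes X: "X \<in> \<Gamma> c" and f: "f \<in> into C c" and d: "d \<in> DD f"
  shows "mul (Dom C f) (curve c X f (\<ominus>\<^bsub>RD f\<^esub> d)) (curve c X f d) = sunit (Dom C f)"
    and "mul (Dom C f) (curve c X f d) (curve c X f (\<ominus>\<^bsub>RD f\<^esub> d)) = sunit (Dom C f)"
proof -
  interpret K: cring "RD f" using f by (intro cring_Rng) simp
  have p: "(\<ominus>\<^bsub>RD f\<^esub> d, d) \<in> Sec (inf_D2 R) (Dom C f)" using f d by (intro D2_minus) simp_all
  have "d \<in> carrier (RD f)" using d by simp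
  then show *: "mul (Dom C f) (curve c X f (\<ominus>\<^bsub>RD f\<^esub> d)) (curve c X f d) = sunit (Dom C f)"
    using curve_add[OF X f p] to_curve_0[OF X f] by (simp add: K.l_neg)
  show "mul (Dom C f) (curve c X f d) (curve c X f (\<ominus>\<^bsub>RD f\<^esub> d)) = sunit (Dom C f)"
    using curve_commute[OF X X f p] * by simp
qed

lemma curve_unit:
  assumes X: "X \<in> \<Gamma> c" and f: "f \<in> into C c" and d: "d \<in> DD f"
  shows "curve c X f d \<in> carrier (sect_group (Dom C f))"
    and "inv\<^bsub>sect_group (Dom C f)\<^esub> (curve c X f d) = curve c X f (\<ominus>\<^bsub>RD f\<^esub> d)"
proof -
  have n: "\<ominus>\<^bsub>RD f\<^esub> d \<in> DD f" using f d by (intro neg_in_D) simp_all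
  interpret K: cring "RD f" using f by (intro cring_Rng) simp
  have u: "curve c X f e \<in> carrier (sect_group (Dom C f))" if e: "e \<in> DD f" for e
  proof -
    have "\<ominus>\<^bsub>RD f\<^esub> e \<in> DD f" using f e by (intro neg_in_D) simp_all
    then show ?thesis
      using curve_minus[OF X f e] curve_closed[OF X f e] curve_closed[OF X f, of "\<ominus>\<^bsub>RD f\<^esub> e"]
      by (auto simp: units_of_def Units_def)
  qed
  show "curve c X f d \<in> carrier (sect_group (Dom C f))" by (rule u[OF d])
  show "inv\<^bsub>sect_group (Dom C f)\<^esub> (curve c X f d) = curve c X f (\<ominus>\<^bsub>RD f\<^esub> d)"
    by (rule group.inv_equality[OF group_sect _ u[OF d] u[OF n]])
      (simp add: sect_group_simps curve_minus(1)[OF X f d])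
qed

lemma curve_Bisect:
  assumes X: "X \<in> \<Gamma> c" and f: "f \<in> into C c" and d: "d \<in> DD f"
  shows "curve c X f d \<in> Sec (Bisect C G) (Dom C f)"
  using f d by (intro Bisect_if_invertible[OF _ _ curve_minus(2,1)[OF X f d]] curve_closed[OF X f] neg_in_D) simp_all

lemma Bisect_maps_iff:
  "\<Phi> \<in> psh_maps c A (Bisect C G) \<longleftrightarrow>
    \<Phi> \<in> psh_maps c A (Sect C G) \<and>
    (\<forall>f\<in>into C c. \<forall>a\<in>Sec A (Dom C f). \<Phi> f a \<in> Sec (Bisect C G) (Dom C f))"
proof -
  have "Res (Bisect C G) = maps_res C" by (simp add: Bisect_def)
  then show ?thesis by (auto simp: maps_def PiE_iff Bisect_iff)
qed

text \<open>The definition imposes the condition at the identity arrow only; since 0 and the unit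
  section are stable under restriction, naturality carries it to every arrow.\<close>

lemma tangent_Bisect_iff:
  assumes c: "c \<in> Ob C"
  shows "\<tau> \<in> tangent_Bisect C R G c \<longleftrightarrow> \<tau> \<in> psh_maps c (inf_D R) (Bisect C G) \<and>
    (\<forall>f\<in>into C c. \<tau> f (zero_at f) = sunit (Dom C f))"
proof -
  interpret K: cring "Rng R c" by (rule cring_Rng[OF c])
  have D: "Dom C (Id C c) = c" by (rule Id_Dom[OF c])
  have "\<tau> f (zero_at f) = sunit (Dom C f)"
    if \<tau>: "\<tau> \<in> psh_maps c (inf_D R) (Bisect C G)"
      and 0: "\<tau> (Id C c) \<zero>\<^bsub>Rng R c\<^esub> = sunit c" and f: "f \<in> into C c" for f
  proof -
    have "\<tau> \<in> psh_maps c (inf_D R) (Sect C G)" using \<tau> by (simp add: Bisect_maps_iff)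
    from maps_natural[OF this into_Id[OF c], of f "\<zero>\<^bsub>Rng R c\<^esub>"]
    have "maps_res C f (\<tau> (Id C c) \<zero>\<^bsub>Rng R c\<^esub>) = \<tau> f (zero_at f)"
      using f by (simp add: D RRes_simps(5)[OF f])
    then show ?thesis using 0 sect_unit_res[OF f] by simp
  qed
  then show ?thesis
    using into_Id[OF c] D by (auto simp: tangent_Bisect_def exp_psh_def dest: bspec[where x = "Id C c"])
qed

lemma to_curve_bij:
  assumes c: "c \<in> Ob C"
  shows "bij_betw (to_curve C R G c) (\<Gamma> c) (tangent_Bisect C R G c)"
proof (rule bij_betwI[where g = "of_curve C R G c"])
  show "to_curve C R G c \<in> \<Gamma> c \<rightarrow> tangent_Bisect C R G c"
    using to_curve_in to_curve_0 curve_Bisect by (auto simp: tangent_Bisect_iff[OF c] Bisect_maps_iff)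
  show "of_curve C R G c \<in> tangent_Bisect C R G c \<rightarrow> \<Gamma> c"
    using of_curve_in by (auto simp: tangent_Bisect_iff[OF c] Bisect_maps_iff)
  show "of_curve C R G c (to_curve C R G c X) = X" if "X \<in> \<Gamma> c" for X
    by (rule of_to_curve[OF that])
  show "to_curve C R G c (of_curve C R G c \<tau>) = \<tau>" if "\<tau> \<in> tangent_Bisect C R G c" for \<tau>
    using that to_of_curve by (auto simp: tangent_Bisect_iff[OF c] Bisect_maps_iff)
qed

text \<open>The product \<open>X\<^sub>d * Y\<^sub>e\<close> has the right values on the axes, and
  these determine a map out of D(2). One equivalence thus yields existence, uniqueness and the value
  of the \<open>THE\<close> in the addition.\<close>

lemma is_plus_map_iff:
  assumes X: "X \<in> \<Gamma> c" and Y: "Y \<in> \<Gamma> c"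
  shows "is_plus_map C R G c X Y l \<longleftrightarrow> l = (\<lambda>f\<in>into C c. \<lambda>a\<in>Sec (inf_D2 R) (Dom C f).
      mul (Dom C f) (curve c X f (fst a)) (curve c Y f (snd a)))" (is "_ \<longleftrightarrow> l = ?l")
proof -
  have ax: "?l f (d, zero_at f) = curve c X f d \<and> ?l f (zero_at f, d) = curve c Y f d"
    if f: "f \<in> into C c" and d: "d \<in> DD f" for f d
    using D2_axes[OF into_Ob[OF f] d] f to_curve_0[OF X f] to_curve_0[OF Y f]
      curve_closed[OF X f d] curve_closed[OF Y f d] by (simp add: sect_unit_mult)
  have "?l f a \<in> Sec (Bisect C G) (Dom C f)" if f: "f \<in> into C c" and a: "a \<in> Sec (inf_D2 R) (Dom C f)" for f a
    using Bisect_mult[OF curve_Bisect[OF X f] curve_Bisect[OF Y f]] D2_projections[OF f a] f a by simp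
  then have "?l \<in> psh_maps c (inf_D2 R) (Bisect C G)"
    using D2_product_in(1)[OF X Y] unfolding Bisect_maps_iff by blast
  then have "is_plus_map C R G c X Y ?l"
    unfolding is_plus_map_def using ax by (simp add: exp_psh_def flow_eq_to_curve del: inf_D_simps restrict_apply)
  moreover have "l = ?l" if l: "is_plus_map C R G c X Y l"
  proof (rule inf_D2_sect_eqI[OF _ D2_product_in(1)[OF X Y]])
    show "l \<in> psh_maps c (inf_D2 R) (Sect C G)"
      using l by (simp add: is_plus_map_def exp_psh_def Bisect_maps_iff)
    fix f d assume f: "f \<in> into C c" and d: "d \<in> DD f"
    show "l f (d, zero_at f) = ?l f (d, zero_at f) \<and>
      l f (zero_at f, d) = ?l f (zero_at f, d)"
      using l ax[OF f d] f d unfolding is_plus_map_def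
      by (simp add: flow_eq_to_curve del: inf_D_simps restrict_apply)
  qed
  ultimately show ?thesis by blast
qed

section \<open>The module operations on curves\<close>

lemma of_curve_cong:
  assumes "\<And>f d. \<lbrakk>f \<in> into C c; d \<in> DD f\<rbrakk> \<Longrightarrow> \<tau> f d = \<tau>' f d"
  shows "of_curve C R G c \<tau> = of_curve C R G c \<tau>'"
  unfolding of_curve_def by (intro restrict_ext) (simp add: assms)

text \<open>The operations of \<open>Gamma_module\<close> hand unrestricted functions to
  \<open>of_curve\<close>, whereas maps are extensional; only the values on D matter.\<close>

lemma curve_of_curve:
  assumes "(\<lambda>f\<in>into C c. \<lambda>d\<in>DD f. \<tau> f d) \<in> psh_maps c (inf_D R) (Sect C G)"
    and 0: "\<And>f. f \<in> into C c \<Longrightarrow> \<tau> f (zero_at f) = sunit (Dom C f)"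
  shows "of_curve C R G c \<tau> \<in> \<Gamma> c"
    and "\<lbrakk>f \<in> into C c; d \<in> DD f\<rbrakk> \<Longrightarrow> curve c (of_curve C R G c \<tau>) f d = \<tau> f d"
proof -
  let ?\<tau> = "\<lambda>f\<in>into C c. \<lambda>d\<in>DD f. \<tau> f d"
  have eq: "of_curve C R G c \<tau> = of_curve C R G c ?\<tau>"
    by (rule of_curve_cong) (simp del: inf_D_simps)
  have 0: "?\<tau> f (zero_at f) = sunit (Dom C f)" if "f \<in> into C c" for f
    using that 0[OF that] zero_in_D[of "Dom C f"] by (simp del: inf_D_simps)
  show "of_curve C R G c \<tau> \<in> \<Gamma> c"
    unfolding eq by (rule of_curve_in[OF assms(1) 0])
  have to_of: "curve c (of_curve C R G c ?\<tau>) = ?\<tau>"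
    by (rule to_of_curve[OF assms(1) 0])
  show "curve c (of_curve C R G c \<tau>) f d = \<tau> f d"
    if "f \<in> into C c" "d \<in> DD f"
    unfolding eq to_of using that by (simp del: inf_D_simps)
qed

lemma Gamma_zero:
  shows "\<zero>\<^bsub>\<Gamma>M c\<^esub> \<in> \<Gamma> c"
    and "\<lbrakk>f \<in> into C c; d \<in> DD f\<rbrakk> \<Longrightarrow>
      curve c \<zero>\<^bsub>\<Gamma>M c\<^esub> f d = sunit (Dom C f)"
proof -
  have "(\<lambda>f\<in>into C c. \<lambda>d\<in>El (loc C (inf_D R)) f. sunit (Dom C f))
      \<in> psh_maps c (inf_D R) (Sect C G)"
  proof (rule maps_memI)
    fix f g d assume f: "f \<in> into C c" and g: "g \<in> over f" and d: "d \<in> El (loc C (inf_D R)) f"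
    show "Rs (loc C (inf_D R)) g d \<in> El (loc C (inf_D R)) (f \<cdot> g)"
      using inf_D_res[OF g, of d] d f g by simp
    show "Rs (loc C (Sect C G)) g (sunit (Dom C f)) = sunit (Dom C (f \<cdot> g))"
      using f g by (simp add: sect_unit_res)
  qed (simp add: sect_unit_in)
  then have "(\<lambda>f\<in>into C c. \<lambda>d\<in>DD f. sunit (Dom C f))
      \<in> psh_maps c (inf_D R) (Sect C G)" by simp
  note * = curve_of_curve[OF this]
  show "\<zero>\<^bsub>\<Gamma>M c\<^esub> \<in> \<Gamma> c"
    "\<lbrakk>f \<in> into C c; d \<in> DD f\<rbrakk> \<Longrightarrow>
      curve c \<zero>\<^bsub>\<Gamma>M c\<^esub> f d = sunit (Dom C f)"
    unfolding Gamma_module_def by (simp_all add: * del: inf_D_simps)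
qed

lemma Gamma_add:
  assumes X: "X \<in> \<Gamma> c" and Y: "Y \<in> \<Gamma> c"
  shows "X \<oplus>\<^bsub>\<Gamma>M c\<^esub> Y \<in> \<Gamma> c"
    and "\<lbrakk>f \<in> into C c; d \<in> DD f\<rbrakk> \<Longrightarrow>
      curve c (X \<oplus>\<^bsub>\<Gamma>M c\<^esub> Y) f d = mul (Dom C f) (curve c X f d) (curve c Y f d)"
proof -
  let ?\<tau> = "\<lambda>f d. mul (Dom C f) (curve c X f d) (curve c Y f d)"
  have "(THE l. is_plus_map C R G c X Y l) f (d, d) = ?\<tau> f d"
    if "f \<in> into C c" "d \<in> DD f" for f d
    unfolding is_plus_map_iff[OF X Y] the_eq_trivial
    using that D2_diagonal[of "Dom C f" d] by (simp del: inf_D_simps)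
  then have eq: "X \<oplus>\<^bsub>\<Gamma>M c\<^esub> Y = of_curve C R G c ?\<tau>"
    unfolding Gamma_module_def by (simp del: inf_D_simps) (rule of_curve_cong)
  have "(\<lambda>f\<in>into C c. \<lambda>d\<in>DD f. ?\<tau> f d) \<in> psh_maps c (inf_D R) (Sect C G)"
    by (rule sect_mult_maps_in[OF inf_D_presheaf]; rule curve_comp_in[OF inf_D_presheaf]) (simp_all add: X Y)
  note * = curve_of_curve[OF this]
  have "?\<tau> f (zero_at f) = sunit (Dom C f)" if "f \<in> into C c" for f
    using that by (simp add: to_curve_0[OF X] to_curve_0[OF Y] sect_unit_mult sect_unit_in)
  then show "X \<oplus>\<^bsub>\<Gamma>M c\<^esub> Y \<in> \<Gamma> c"
    "\<lbrakk>f \<in> into C c; d \<in> DD f\<rbrakk> \<Longrightarrow>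
      curve c (X \<oplus>\<^bsub>\<Gamma>M c\<^esub> Y) f d = mul (Dom C f) (curve c X f d) (curve c Y f d)"
    unfolding eq using * by blast+
qed

lemma Gamma_smult:
  assumes X: "X \<in> \<Gamma> c" and a: "a \<in> carrier (Rng R c)"
  shows "a \<odot>\<^bsub>\<Gamma>M c\<^esub> X \<in> \<Gamma> c"
    and "\<lbrakk>f \<in> into C c; d \<in> DD f\<rbrakk> \<Longrightarrow>
      curve c (a \<odot>\<^bsub>\<Gamma>M c\<^esub> X) f d = curve c X f (RRes R f a \<otimes>\<^bsub>RD f\<^esub> d)"
proof -
  let ?s = "\<lambda>f d. RRes R f a \<otimes>\<^bsub>RD f\<^esub> d"
  have s: "?s f d \<in> DD f" if "f \<in> into C c" "d \<in> DD f" for f d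
    using that a by (intro inf_D_mult RRes_simps(1)) simp_all
  have eq: "a \<odot>\<^bsub>\<Gamma>M c\<^esub> X = of_curve C R G c (\<lambda>f d. curve c X f (?s f d))"
    unfolding Gamma_module_def using s
    by (simp del: inf_D_simps) (rule of_curve_cong, simp add: flow_eq_to_curve del: inf_D_simps)
  have "(\<lambda>f\<in>into C c. \<lambda>d\<in>DD f. curve c X f (?s f d)) \<in> psh_maps c (inf_D R) (Sect C G)"
  proof (rule curve_comp_in[OF inf_D_presheaf X s])
    fix f g d assume f: "f \<in> into C c" and g: "g \<in> over f" and d: "d \<in> DD f"
    then show "RRes R g (?s f d) = ?s (f \<cdot> g) (Res (inf_D R) g d)"
      using RRes_simps(1)[OF f a] by (simp add: RRes_simps(2)[OF g] RRes_comp[OF f g a])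
  qed
  note * = curve_of_curve[OF this]
  have "curve c X f (?s f (zero_at f)) = sunit (Dom C f)" if f: "f \<in> into C c" for f
  proof -
    interpret K: cring "RD f" using f by (intro cring_Rng) simp
    show ?thesis using f RRes_simps(1)[OF f a] by (simp add: to_curve_0[OF X f])
  qed
  then show "a \<odot>\<^bsub>\<Gamma>M c\<^esub> X \<in> \<Gamma> c"
    "\<lbrakk>f \<in> into C c; d \<in> DD f\<rbrakk> \<Longrightarrow>
      curve c (a \<odot>\<^bsub>\<Gamma>M c\<^esub> X) f d = curve c X f (RRes R f a \<otimes>\<^bsub>RD f\<^esub> d)"
    unfolding eq using * by blast+
qed

lemma Gamma_carrier [simp]: "carrier (\<Gamma>M c) = \<Gamma> c"
  by (simp add: Gamma_module_def)

lemma sect_mult_assoc: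
  "\<lbrakk>\<sigma> \<in> SS c; \<rho> \<in> SS c; \<tau> \<in> SS c\<rbrakk> \<Longrightarrow>
    mul c (mul c \<sigma> \<rho>) \<tau> = mul c \<sigma> (mul c \<rho> \<tau>)"
  using monoid.m_assoc[OF monoid_sect, of \<sigma> c \<rho> \<tau>] by simp

lemma module_Gamma:
  assumes c: "c \<in> Ob C"
  shows "module (Rng R c) (\<Gamma>M c)"
proof (rule moduleI)
  show "cring (Rng R c)" by (rule cring_Rng[OF c])
  interpret R: cring "Rng R c" by (rule cring_Rng[OF c])
  let ?L = "\<Gamma>M c"
  show "abelian_group ?L"
  proof (rule abelian_groupI, simp_all only: Gamma_carrier)
    fix X Y Z assume X: "X \<in> \<Gamma> c" and Y: "Y \<in> \<Gamma> c"
      and Z: "Z \<in> \<Gamma> c"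
    show "X \<oplus>\<^bsub>?L\<^esub> Y \<oplus>\<^bsub>?L\<^esub> Z = X \<oplus>\<^bsub>?L\<^esub> (Y \<oplus>\<^bsub>?L\<^esub> Z)"
      by (rule curve_eqI[of _ c])
        (simp_all add: Gamma_add X Y Z sect_mult_assoc curve_closed del: inf_D_simps)
  next
    fix X Y assume X: "X \<in> \<Gamma> c" and Y: "Y \<in> \<Gamma> c"
    show "X \<oplus>\<^bsub>?L\<^esub> Y \<in> \<Gamma> c" by (rule Gamma_add(1)[OF X Y])
    show "X \<oplus>\<^bsub>?L\<^esub> Y = Y \<oplus>\<^bsub>?L\<^esub> X"
      by (rule curve_eqI[of _ c])
        (simp_all add: Gamma_add X Y curve_commute[OF X Y] D2_diagonal del: inf_D_simps)
  next
    show "\<zero>\<^bsub>?L\<^esub> \<in> \<Gamma> c" by (rule Gamma_zero)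
  next
    fix X assume X: "X \<in> \<Gamma> c"
    show "\<zero>\<^bsub>?L\<^esub> \<oplus>\<^bsub>?L\<^esub> X = X"
      by (rule curve_eqI[of _ c])
        (simp_all add: Gamma_add Gamma_zero X sect_unit_mult curve_closed del: inf_D_simps)
    \<comment> \<open>The additive inverse of X is (-1) X, whose curve is d \<mapsto>
      \<open>X\<^sub>-\<^sub>d\<close>.\<close>
    let ?Y = "(\<ominus>\<^bsub>Rng R c\<^esub> \<one>\<^bsub>Rng R c\<^esub>) \<odot>\<^bsub>?L\<^esub> X"
    have Y: "?Y \<in> \<Gamma> c" by (intro Gamma_smult X) simp
    have "?Y \<oplus>\<^bsub>?L\<^esub> X = \<zero>\<^bsub>?L\<^esub>"
    proof (rule curve_eqI[OF Gamma_add(1)[OF Y X] Gamma_zero(1)])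
      fix f d assume f: "f \<in> into C c" and d: "d \<in> DD f"
      interpret K: cring "RD f" using f by (intro cring_Rng) simp
      interpret r: cring_hom "Rng R c" "RD f" "RRes R f" by (rule cring_hom_RRes[OF f])
      have "RRes R f (\<ominus>\<^bsub>Rng R c\<^esub> \<one>\<^bsub>Rng R c\<^esub>) \<otimes>\<^bsub>RD f\<^esub> d = \<ominus>\<^bsub>RD f\<^esub> d"
        using d by (simp add: r.r_minus r.r_simps K.l_minus)
      then show "curve c (?Y \<oplus>\<^bsub>?L\<^esub> X) f d = curve c \<zero>\<^bsub>?L\<^esub> f d"
        by (simp add: Gamma_add(2)[OF Y X f d] Gamma_smult(2)[OF X _ f d] Gamma_zero(2)[OF f d]
            curve_minus(1)[OF X f d])
    qed
    then show "\<exists>Y\<in>\<Gamma> c. Y \<oplus>\<^bsub>?L\<^esub> X = \<zero>\<^bsub>?L\<^esub>" using Y by blast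
  qed
  fix a b X Y
  assume a: "a \<in> carrier (Rng R c)" and "X \<in> carrier ?L"
  then have X: "X \<in> \<Gamma> c" by simp
  show "a \<odot>\<^bsub>?L\<^esub> X \<in> carrier ?L" using Gamma_smult(1)[OF X a] by simp
  {
    assume b: "b \<in> carrier (Rng R c)"
    note ab = R.a_closed[OF a b] R.m_closed[OF a b]
    note aX = Gamma_smult(1)[OF X a] and bX = Gamma_smult(1)[OF X b]
    show "(a \<oplus>\<^bsub>Rng R c\<^esub> b) \<odot>\<^bsub>?L\<^esub> X = a \<odot>\<^bsub>?L\<^esub> X \<oplus>\<^bsub>?L\<^esub> b \<odot>\<^bsub>?L\<^esub> X"
    proof (rule curve_eqI[OF Gamma_smult(1)[OF X ab(1)] Gamma_add(1)[OF aX bX]])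
      fix f d assume f: "f \<in> into C c" and d: "d \<in> DD f"
      interpret K: cring "RD f" using f by (intro cring_Rng) simp
      note ra = RRes_simps(1)[OF f a] and rb = RRes_simps(1)[OF f b]
      have "d \<in> carrier (RD f)" using d by simp
      then have "RRes R f (a \<oplus>\<^bsub>Rng R c\<^esub> b) \<otimes>\<^bsub>RD f\<^esub> d =
          RRes R f a \<otimes>\<^bsub>RD f\<^esub> d \<oplus>\<^bsub>RD f\<^esub> RRes R f b \<otimes>\<^bsub>RD f\<^esub> d"
        using ra rb by (simp add: RRes_simps(3)[OF f a b] K.l_distr)
      then show "curve c ((a \<oplus>\<^bsub>Rng R c\<^esub> b) \<odot>\<^bsub>?L\<^esub> X) f d = curve c (a \<odot>\<^bsub>?L\<^esub> X \<oplus>\<^bsub>?L\<^esub> b \<odot>\<^bsub>?L\<^esub> X) f d"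
        using curve_add[OF X f pairs_in_D2[OF into_Ob[OF f] ra rb d]]
        by (simp add: Gamma_smult(2)[OF X ab(1) f d] Gamma_add(2)[OF aX bX f d]
            Gamma_smult(2)[OF X a f d] Gamma_smult(2)[OF X b f d])
    qed
    show "(a \<otimes>\<^bsub>Rng R c\<^esub> b) \<odot>\<^bsub>?L\<^esub> X = a \<odot>\<^bsub>?L\<^esub> (b \<odot>\<^bsub>?L\<^esub> X)"
    proof (rule curve_eqI[OF Gamma_smult(1)[OF X ab(2)] Gamma_smult(1)[OF bX a]])
      fix f d assume f: "f \<in> into C c" and d: "d \<in> DD f"
      interpret K: cring "RD f" using f by (intro cring_Rng) simp
      note ra = RRes_simps(1)[OF f a] and rb = RRes_simps(1)[OF f b]
      have "d \<in> carrier (RD f)" using d by simp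
      \<comment> \<open>Scaling acts on the parameter, so the two scalars arrive in reversed order;
        commutativity of the ring restores it.\<close>
      then have "RRes R f (a \<otimes>\<^bsub>Rng R c\<^esub> b) \<otimes>\<^bsub>RD f\<^esub> d =
          RRes R f b \<otimes>\<^bsub>RD f\<^esub> (RRes R f a \<otimes>\<^bsub>RD f\<^esub> d)"
        using ra rb by (simp add: RRes_simps(2)[OF f a b] K.m_ac)
      then show "curve c ((a \<otimes>\<^bsub>Rng R c\<^esub> b) \<odot>\<^bsub>?L\<^esub> X) f d = curve c (a \<odot>\<^bsub>?L\<^esub> (b \<odot>\<^bsub>?L\<^esub> X)) f d"
        using inf_D_mult[OF into_Ob[OF f] ra d]
        by (simp add: Gamma_smult(2)[OF X ab(2) f d] Gamma_smult(2)[OF bX a f d] Gamma_smult(2)[OF X b f] del: inf_D_simps)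
    qed
  }
  {
    assume "Y \<in> carrier ?L"
    then have Y: "Y \<in> \<Gamma> c" by simp
    show "a \<odot>\<^bsub>?L\<^esub> (X \<oplus>\<^bsub>?L\<^esub> Y) = a \<odot>\<^bsub>?L\<^esub> X \<oplus>\<^bsub>?L\<^esub> a \<odot>\<^bsub>?L\<^esub> Y"
      by (rule curve_eqI[of _ c])
        (simp_all add: Gamma_add Gamma_smult X Y a inf_D_mult RRes_simps(1) del: inf_D_simps)
  }
next
  interpret R: cring "Rng R c" by (rule cring_Rng[OF c])
  let ?L = "\<Gamma>M c"
  fix X assume "X \<in> carrier ?L"
  then have X: "X \<in> \<Gamma> c" by simp
  show "\<one>\<^bsub>Rng R c\<^esub> \<odot>\<^bsub>?L\<^esub> X = X"
  proof (rule curve_eqI[OF Gamma_smult(1)[OF X R.one_closed] X])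
    fix f d assume f: "f \<in> into C c" and d: "d \<in> DD f"
    interpret K: cring "RD f" using f by (intro cring_Rng) simp
    have "d \<in> carrier (RD f)" using d by simp
    then show "curve c (\<one>\<^bsub>Rng R c\<^esub> \<odot>\<^bsub>?L\<^esub> X) f d = curve c X f d"
      by (simp add: Gamma_smult(2)[OF X R.one_closed f d] RRes_simps(4)[OF f])
  qed
qed

end

section \<open>The bracket\<close>

context lie_setting
begin

lemma Res_Gamma [simp]: "Res (GammaAG C R G) = maps_res C"
  by (simp add: GammaAG_def)

lemma Gamma_res:
  assumes X: "X \<in> \<Gamma> c" and f: "f \<in> into C c"
  shows "maps_res C f X \<in> \<Gamma> (Dom C f)"
proof -
  have "maps_res C f X g x \<in> AG_at C R G (Dom C g) x"
    if g: "g \<in> over f" and x: "x \<in> MD g" for g x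
    using Gamma_AG[OF X into_comp[OF f g], of x] f g x by simp
  then show ?thesis
    using maps_res_in[OF _ f, of X "Base G" "AG C R G"] X by (simp add: Gamma_iff)
qed

lemma curve_res:
  assumes f: "f \<in> into C c" and g: "g \<in> over f" and d: "d \<in> DD g"
  shows "curve (Dom C f) (maps_res C f X) g d = curve c X (f \<cdot> g) d"
  using f g d by (simp add: to_curve_def maps_res_comp[OF f g] del: inf_D_simps)

text \<open>The curve of d X at t is that of X at d t. So d X and d Y agree at products of two,
  hence are equal, which gives agreement of X and Y at every product d e. As d lives at a later
  stage, X and Y are restricted to that stage.\<close>

lemma curve_triple_eqI:
  assumes X: "X \<in> \<Gamma> c" and Y: "Y \<in> \<Gamma> c"
    and eq: "\<And>f d1 d2 d3. \<lbrakk>f \<in> into C c; d1 \<in> DD f; d2 \<in> DD f;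
        d3 \<in> DD f\<rbrakk>
      \<Longrightarrow> curve c X f (d1 \<otimes>\<^bsub>RD f\<^esub> (d2 \<otimes>\<^bsub>RD f\<^esub> d3)) =
        curve c Y f (d1 \<otimes>\<^bsub>RD f\<^esub> (d2 \<otimes>\<^bsub>RD f\<^esub> d3))"
  shows "X = Y"
proof (rule curve_product_eqI[OF X Y])
  fix f d e assume f: "f \<in> into C c" and d: "d \<in> DD f" and e: "e \<in> DD f"
  note cf = into_Ob[OF f]
  have dc: "d \<in> carrier (RD f)" using d by simp
  note X' = Gamma_res[OF X f] and Y' = Gamma_res[OF Y f]
  let ?L = "\<Gamma>M (Dom C f)"
  have "d \<odot>\<^bsub>?L\<^esub> maps_res C f X = d \<odot>\<^bsub>?L\<^esub> maps_res C f Y"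
  proof (rule curve_product_eqI[OF Gamma_smult(1)[OF X' dc] Gamma_smult(1)[OF Y' dc]])
    fix g d2 d3 assume g: "g \<in> over f" and d23: "d2 \<in> DD g" "d3 \<in> DD g"
    note dg = inf_D_res[OF g d] and m = mult_in_D[OF into_Ob[OF g] d23]
    note m' = mult_in_D[OF into_Ob[OF g] dg m]
    have fg: "Dom C (f \<cdot> g) = Dom C g" using f g by simp
    show "curve (Dom C f) (d \<odot>\<^bsub>?L\<^esub> maps_res C f X) g (d2 \<otimes>\<^bsub>RD g\<^esub> d3) =
       curve (Dom C f) (d \<odot>\<^bsub>?L\<^esub> maps_res C f Y) g (d2 \<otimes>\<^bsub>RD g\<^esub> d3)"
      unfolding Gamma_smult(2)[OF X' dc g m] Gamma_smult(2)[OF Y' dc g m] curve_res[OF f g m']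
      by (rule eq[OF into_comp[OF f g], unfolded fg, OF dg d23])
  qed
  \<comment> \<open>The equation of the scaled elements is read at the identity arrow, with e as
    parameter.\<close>
  then have "curve (Dom C f) (d \<odot>\<^bsub>?L\<^esub> maps_res C f X) (Id C (Dom C f)) e =
      curve (Dom C f) (d \<odot>\<^bsub>?L\<^esub> maps_res C f Y) (Id C (Dom C f)) e" by simp
  moreover have I: "Id C (Dom C f) \<in> over f" and D: "Dom C (Id C (Dom C f)) = Dom C f"
    using cf by (simp_all add: Id_Dom)
  have "curve (Dom C f) (d \<odot>\<^bsub>?L\<^esub> maps_res C f Z) (Id C (Dom C f)) e =
      curve c Z f (d \<otimes>\<^bsub>RD f\<^esub> e)" if Z: "Z \<in> \<Gamma> c" for Z
    using Gamma_smult(2)[OF Gamma_res[OF Z f] dc I, unfolded D, OF e]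
      curve_res[OF f I, unfolded D, OF mult_in_D[OF cf d e]] f
    by (simp add: RRes_Id[OF cf dc])
  ultimately show "curve c X f (d \<otimes>\<^bsub>RD f\<^esub> e) = curve c Y f (d \<otimes>\<^bsub>RD f\<^esub> e)"
    using X Y by simp
qed

abbreviation gcomm where "gcomm c \<equiv> group.commutator (sect_group c)"

text \<open>\<open>X\<^sub>-\<^sub>d\<close> is the inverse of \<open>X\<^sub>d\<close>, so the
  fourfold product in the definition is a commutator in the group of units.\<close>

lemma is_bracket_iff:
  assumes X: "X \<in> \<Gamma> c" and Y: "Y \<in> \<Gamma> c"
  shows "is_bracket C R G c X Y Z \<longleftrightarrow> Z \<in> \<Gamma> c \<and>
    (\<forall>f\<in>into C c. \<forall>d1\<in>DD f. \<forall>d2\<in>DD f.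
      curve c Z f (d1 \<otimes>\<^bsub>RD f\<^esub> d2) = gcomm (Dom C f) (curve c X f d1) (curve c Y f d2))"
proof -
  have "gcomm (Dom C f) (curve c X f d1) (curve c Y f d2) =
      mul (Dom C f) (mul (Dom C f) (mul (Dom C f)
        (flow C R G (Dom C f) (maps_res C f Y) (\<ominus>\<^bsub>RD f\<^esub> d2))
        (flow C R G (Dom C f) (maps_res C f X) (\<ominus>\<^bsub>RD f\<^esub> d1)))
        (flow C R G (Dom C f) (maps_res C f Y) d2)) (flow C R G (Dom C f) (maps_res C f X) d1)"
    "flow C R G (Dom C f) (maps_res C f Z) (d1 \<otimes>\<^bsub>RD f\<^esub> d2) = curve c Z f (d1 \<otimes>\<^bsub>RD f\<^esub> d2)"
    if f: "f \<in> into C c" and d: "d1 \<in> DD f" "d2 \<in> DD f" for f d1 d2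
    using f d neg_in_D[OF into_Ob[OF f]] mult_in_D[OF into_Ob[OF f] d]
    by (simp_all add: group.commutator_def[OF group_sect] flow_eq_to_curve curve_unit(2)[OF X f]
        curve_unit(2)[OF Y f] sect_group_simps del: inf_D_simps)
  then show ?thesis unfolding is_bracket_def Let_def by (simp del: inf_D_simps)
qed

lemma D3_projections:
  assumes f: "f \<in> into C c" and a: "a \<in> Sec (inf_psh R 3) (Dom C f)"
  shows "fst a \<in> DD f" "snd a \<in> DD f"
    and "\<ominus>\<^bsub>RD f\<^esub> fst a \<in> DD f" "\<ominus>\<^bsub>RD f\<^esub> snd a \<in> DD f"
    and "g \<in> over f \<Longrightarrow> RRes R g (fst a) = fst (Res (inf_psh R 3) g a)"
    and "g \<in> over f \<Longrightarrow> RRes R g (snd a) = snd (Res (inf_psh R 3) g a)"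
    and "g \<in> over f \<Longrightarrow> RRes R g (\<ominus>\<^bsub>RD f\<^esub> fst a) = \<ominus>\<^bsub>RD (f \<cdot> g)\<^esub> fst (Res (inf_psh R 3) g a)"
    and "g \<in> over f \<Longrightarrow> RRes R g (\<ominus>\<^bsub>RD f\<^esub> snd a) = \<ominus>\<^bsub>RD (f \<cdot> g)\<^esub> snd (Res (inf_psh R 3) g a)"
proof -
  show d: "fst a \<in> DD f" "snd a \<in> DD f"
    using a by (auto simp: inf_points_def)
  show "\<ominus>\<^bsub>RD f\<^esub> fst a \<in> DD f" "\<ominus>\<^bsub>RD f\<^esub> snd a \<in> DD f"
    using neg_in_D[OF into_Ob[OF f]] d by blast+
  show "RRes R g (fst a) = fst (Res (inf_psh R 3) g a)" "RRes R g (snd a) = snd (Res (inf_psh R 3) g a)"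
    "RRes R g (\<ominus>\<^bsub>RD f\<^esub> fst a) = \<ominus>\<^bsub>RD (f \<cdot> g)\<^esub> fst (Res (inf_psh R 3) g a)"
    "RRes R g (\<ominus>\<^bsub>RD f\<^esub> snd a) = \<ominus>\<^bsub>RD (f \<cdot> g)\<^esub> snd (Res (inf_psh R 3) g a)"
    if g: "g \<in> over f"
    using d f g by (simp_all add: cring_hom.r_minus[OF cring_hom_RRes[OF g]])
qed

lemma bracket_ex1:
  assumes X: "X \<in> \<Gamma> c" and Y: "Y \<in> \<Gamma> c"
  shows "\<exists>!Z. is_bracket C R G c X Y Z"
proof -
  \<comment> \<open>Written as a product of reparametrized curves, for which naturality is
    available; that it is the commutator is shown afterwards.\<close>
  let ?\<Phi> = "\<lambda>f\<in>into C c. \<lambda>a\<in>Sec (inf_psh R 3) (Dom C f).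
    mul (Dom C f) (mul (Dom C f) (mul (Dom C f)
      (curve c Y f (\<ominus>\<^bsub>RD f\<^esub> snd a)) (curve c X f (\<ominus>\<^bsub>RD f\<^esub> fst a)))
      (curve c Y f (snd a))) (curve c X f (fst a))"
  have \<Phi>: "?\<Phi> \<in> psh_maps c (inf_psh R 3) (Sect C G)"
    by (intro sect_mult_maps_in inf_psh_presheaf curve_comp_in X Y; (rule D3_projections; assumption))
  have pt: "(d, e) \<in> Sec (inf_psh R 3) (Dom C f)"
    if "f \<in> into C c" "d \<in> DD f" "e \<in> DD f" for f d e
    using inf_points_D[of "Dom C f"] that by simp
  have \<Phi>c: "?\<Phi> f (d, e) = gcomm (Dom C f) (curve c X f d) (curve c Y f e)"
    if f: "f \<in> into C c" and d: "d \<in> DD f" "e \<in> DD f" for f d e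
    using f d pt[OF f d]
    by (simp add: group.commutator_def[OF group_sect] curve_unit(2)[OF X f] curve_unit(2)[OF Y f]
        sect_group_simps del: inf_D_simps inf_psh_simps)
  \<comment> \<open>On an axis one argument of the commutator is the unit, so the map is constant
    there, as the factorization through the multiplication requires.\<close>
  have ax: "?\<Phi> f (d, zero_at f) = sunit (Dom C f) \<and>
      ?\<Phi> f (zero_at f, d) = sunit (Dom C f)"
    if f: "f \<in> into C c" and d: "d \<in> DD f" for f d
  proof -
    interpret H: group "sect_group (Dom C f)" by (rule group_sect)
    have z: "zero_at f \<in> DD f" by (rule zero_in_D[OF into_Ob[OF f]])
    have "H.commutator a \<one>\<^bsub>sect_group (Dom C f)\<^esub> = \<one>\<^bsub>sect_group (Dom C f)\<^esub>"
      "H.commutator \<one>\<^bsub>sect_group (Dom C f)\<^esub> a = \<one>\<^bsub>sect_group (Dom C f)\<^esub>"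
      if "a \<in> carrier (sect_group (Dom C f))" for a
      using that by (simp_all add: H.commutator_def)
    note u = this[unfolded sect_group_simps]
    show ?thesis
      unfolding \<Phi>c[OF f d z] \<Phi>c[OF f z d] to_curve_0[OF X f] to_curve_0[OF Y f]
      by (intro conjI u curve_unit(1)[OF X f d] curve_unit(1)[OF Y f d])
  qed
  obtain Z where Z: "Z \<in> \<Gamma> c"
    "\<And>f d e. \<lbrakk>f \<in> into C c; d \<in> DD f; e \<in> DD f\<rbrakk>
      \<Longrightarrow> curve c Z f (d \<otimes>\<^bsub>RD f\<^esub> e) = ?\<Phi> f (d, e)"
    using Gamma_of_product[OF \<Phi> ax] by blast
  show ?thesis
  proof (rule ex1I)
    show "is_bracket C R G c X Y Z"
      unfolding is_bracket_iff[OF X Y] by (intro conjI ballI Z(1) trans[OF Z(2) \<Phi>c])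
    fix Z' assume "is_bracket C R G c X Y Z'"
    then have Z': "Z' \<in> \<Gamma> c"
      "\<forall>f\<in>into C c. \<forall>d1\<in>DD f. \<forall>d2\<in>DD f.
      curve c Z' f (d1 \<otimes>\<^bsub>RD f\<^esub> d2) = gcomm (Dom C f) (curve c X f d1) (curve c Y f d2)"
      unfolding is_bracket_iff[OF X Y] by blast+
    show "Z' = Z"
    proof (rule curve_product_eqI[OF Z'(1) Z(1)])
      fix f d e assume de: "f \<in> into C c" "d \<in> DD f" "e \<in> DD f"
      show "curve c Z' f (d \<otimes>\<^bsub>RD f\<^esub> e) = curve c Z f (d \<otimes>\<^bsub>RD f\<^esub> e)"
        using Z'(2) de unfolding Z(2)[OF de] \<Phi>c[OF de] by blast
    qed
  qed
qed

section \<open>The laws of the bracket\<close>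

lemma bracket_closed:
  assumes X: "X \<in> \<Gamma> c" and Y: "Y \<in> \<Gamma> c"
  shows "br c X Y \<in> \<Gamma> c"
  using theI'[OF bracket_ex1[OF X Y]] unfolding is_bracket_iff[OF X Y] bracket_def by blast

lemma curve_bracket:
  assumes X: "X \<in> \<Gamma> c" and Y: "Y \<in> \<Gamma> c"
    and "f \<in> into C c" "d \<in> DD f" "e \<in> DD f"
  shows "curve c (br c X Y) f (d \<otimes>\<^bsub>RD f\<^esub> e) =
    gcomm (Dom C f) (curve c X f d) (curve c Y f e)"
  using theI'[OF bracket_ex1[OF X Y]] assms(3-5) unfolding is_bracket_iff[OF X Y] bracket_def by blast

lemma bracket_eqI:
  assumes X: "X \<in> \<Gamma> c" and Y: "Y \<in> \<Gamma> c"
    and Z: "Z \<in> \<Gamma> c"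
    and "\<And>f d e. \<lbrakk>f \<in> into C c; d \<in> DD f; e \<in> DD f\<rbrakk>
      \<Longrightarrow> curve c Z f (d \<otimes>\<^bsub>RD f\<^esub> e) = gcomm (Dom C f) (curve c X f d) (curve c Y f e)"
  shows "br c X Y = Z"
  using Z assms(4) by (intro curve_product_eqI[OF bracket_closed[OF X Y] Z]) (simp add: curve_bracket[OF X Y] del: inf_D_simps)

text \<open>(a d) d contains d d = 0. Consequently the bracket at d e commutes with every curve at
  e.\<close>

lemma D2_multiple:
  assumes "c \<in> Ob C" "a \<in> Sec (inf_D R) c" "d \<in> Sec (inf_D R) c"
  shows "(a \<otimes>\<^bsub>Rng R c\<^esub> d, d) \<in> Sec (inf_D2 R) c"
proof -
  interpret K: cring "Rng R c" using assms by (intro cring_Rng)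
  show ?thesis using mult_in_D[OF assms] assms by (simp add: D2_iff K.m_assoc)
qed

text \<open>Swapping its arguments inverts the commutator and leaves the parameter d e
  unchanged.\<close>

lemma bracket_antisym:
  assumes c: "c \<in> Ob C" and X: "X \<in> \<Gamma> c" and Y: "Y \<in> \<Gamma> c"
  shows "br c X Y = \<ominus>\<^bsub>\<Gamma>M c\<^esub> br c Y X"
proof -
  interpret M: module "Rng R c" "\<Gamma>M c" by (rule module_Gamma[OF c])
  let ?XY = "br c X Y" and ?YX = "br c Y X"
  note cl = bracket_closed[OF X Y] bracket_closed[OF Y X]
  have "?XY \<oplus>\<^bsub>\<Gamma>M c\<^esub> ?YX = \<zero>\<^bsub>\<Gamma>M c\<^esub>"
  proof (rule curve_product_eqI[OF Gamma_add(1)[OF cl] Gamma_zero(1)])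
    fix f d e assume f: "f \<in> into C c" and d: "d \<in> DD f" and e: "e \<in> DD f"
    interpret K: cring "RD f" using f by (intro cring_Rng) simp
    interpret H: group "sect_group (Dom C f)" by (rule group_sect)
    note de = mult_in_D[OF into_Ob[OF f] d e]
    note x = curve_unit(1)[OF X f d] and y = curve_unit(1)[OF Y f e]
    have "d \<otimes>\<^bsub>RD f\<^esub> e = e \<otimes>\<^bsub>RD f\<^esub> d" using d e by (intro K.m_comm) simp_all
    then have yx: "curve c ?YX f (d \<otimes>\<^bsub>RD f\<^esub> e) = inv\<^bsub>sect_group (Dom C f)\<^esub> gcomm (Dom C f) (curve c X f d) (curve c Y f e)"
      using curve_bracket[OF Y X f e d] H.inv_commutator[OF x y] by simp
    show "curve c (?XY \<oplus>\<^bsub>\<Gamma>M c\<^esub> ?YX) f (d \<otimes>\<^bsub>RD f\<^esub> e) =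
        curve c \<zero>\<^bsub>\<Gamma>M c\<^esub> f (d \<otimes>\<^bsub>RD f\<^esub> e)"
      unfolding Gamma_add(2)[OF cl f de] Gamma_zero(2)[OF f de] curve_bracket[OF X Y f d e] yx
      by (rule H.r_inv[OF H.commutator_closed[OF x y], unfolded sect_group_simps])
  qed
  then have "\<ominus>\<^bsub>\<Gamma>M c\<^esub> ?YX = ?XY" using cl by (intro M.minus_equality) simp_all
  then show ?thesis ..
qed

lemma bracket_add_right:
  assumes X: "X \<in> \<Gamma> c" and Y: "Y \<in> \<Gamma> c" and Z: "Z \<in> \<Gamma> c"
  shows "br c X (Y \<oplus>\<^bsub>\<Gamma>M c\<^esub> Z) =
    br c X Y \<oplus>\<^bsub>\<Gamma>M c\<^esub> br c X Z"
proof (rule bracket_eqI[OF X Gamma_add(1)[OF Y Z] Gamma_add(1)[OF bracket_closed[OF X Y] bracket_closed[OF X Z]]])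
  fix f d e assume f: "f \<in> into C c" and d: "d \<in> DD f" and e: "e \<in> DD f"
  interpret H: group "sect_group (Dom C f)" by (rule group_sect)
  note de = mult_in_D[OF into_Ob[OF f] d e]
  note x = curve_unit(1)[OF X f d] and y = curve_unit(1)[OF Y f e] and z = curve_unit(1)[OF Z f e]
  \<comment> \<open>The commutator with a product leaves a conjugation by Z at e, which is trivial
    on the bracket of X and Y at d e.\<close>
  have comm: "gcomm (Dom C f) (curve c X f d) (curve c Y f e) \<otimes>\<^bsub>sect_group (Dom C f)\<^esub> curve c Z f e =
      curve c Z f e \<otimes>\<^bsub>sect_group (Dom C f)\<^esub> gcomm (Dom C f) (curve c X f d) (curve c Y f e)"
    using curve_commute[OF bracket_closed[OF X Y] Z f D2_multiple[OF into_Ob[OF f] d e]]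
    by (simp add: curve_bracket[OF X Y f d e] sect_group_simps)
  show "curve c (br c X Y \<oplus>\<^bsub>\<Gamma>M c\<^esub> br c X Z) f (d \<otimes>\<^bsub>RD f\<^esub> e) =
      gcomm (Dom C f) (curve c X f d) (curve c (Y \<oplus>\<^bsub>\<Gamma>M c\<^esub> Z) f e)"
    unfolding Gamma_add(2)[OF bracket_closed[OF X Y] bracket_closed[OF X Z] f de] Gamma_add(2)[OF Y Z f e]
      curve_bracket[OF X Y f d e] curve_bracket[OF X Z f d e]
    by (rule H.commutator_mult_right[OF x y z comm, symmetric, unfolded sect_group_simps])
qed

text \<open>The scalar is absorbed by the first parameter: a (d e) = (a d) e.\<close>

lemma bracket_smult_left:
  assumes a: "a \<in> carrier (Rng R c)" and X: "X \<in> \<Gamma> c" and Y: "Y \<in> \<Gamma> c"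
  shows "br c (a \<odot>\<^bsub>\<Gamma>M c\<^esub> X) Y = a \<odot>\<^bsub>\<Gamma>M c\<^esub> br c X Y"
proof (rule bracket_eqI[OF Gamma_smult(1)[OF X a] Y Gamma_smult(1)[OF bracket_closed[OF X Y] a]])
  fix f d e assume f: "f \<in> into C c" and d: "d \<in> DD f" and e: "e \<in> DD f"
  interpret K: cring "RD f" using f by (intro cring_Rng) simp
  note ra = RRes_simps(1)[OF f a]
  have "RRes R f a \<otimes>\<^bsub>RD f\<^esub> (d \<otimes>\<^bsub>RD f\<^esub> e) = RRes R f a \<otimes>\<^bsub>RD f\<^esub> d \<otimes>\<^bsub>RD f\<^esub> e"
    using d e ra by (simp add: K.m_assoc)
  then show "curve c (a \<odot>\<^bsub>\<Gamma>M c\<^esub> br c X Y) f (d \<otimes>\<^bsub>RD f\<^esub> e) =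
      gcomm (Dom C f) (curve c (a \<odot>\<^bsub>\<Gamma>M c\<^esub> X) f d) (curve c Y f e)"
    unfolding Gamma_smult(2)[OF X a f d]
      Gamma_smult(2)[OF bracket_closed[OF X Y] a f mult_in_D[OF into_Ob[OF f] d e]]
    using curve_bracket[OF X Y f inf_D_mult[OF into_Ob[OF f] ra d] e] by simp
qed

text \<open>
  By the Hall-Witt identity at \<open>X\<^sub>d\<^sub>1\<close>, \<open>Y\<^sub>d\<^sub>2\<close>, \<open>Z\<^sub>d\<^sub>3\<close>: the outer conjugations act trivially,
  because \<open>W\<^sub>d\<^sub>e\<close> and \<open>Y\<^sub>e\<close> commute for all \<open>W\<close> and \<open>Y\<close> (as \<open>(d e, e) \<in> D(2)\<close>).
\<close>

lemma bracket_jacobi: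
  assumes X: "X \<in> \<Gamma> c" and Y: "Y \<in> \<Gamma> c" and Z: "Z \<in> \<Gamma> c"
  shows "br c X (br c Y Z) \<oplus>\<^bsub>\<Gamma>M c\<^esub>
    br c Y (br c Z X) \<oplus>\<^bsub>\<Gamma>M c\<^esub>
    br c Z (br c X Y) = \<zero>\<^bsub>\<Gamma>M c\<^esub>"
proof -
  let ?b = "br c" and ?L = "\<Gamma>M c"
  note XY = bracket_closed[OF X Y] and YZ = bracket_closed[OF Y Z] and ZX = bracket_closed[OF Z X]
  note W1 = bracket_closed[OF X YZ] and W2 = bracket_closed[OF Y ZX] and W3 = bracket_closed[OF Z XY]
  note W12 = Gamma_add(1)[OF W1 W2]
  show ?thesis
  proof (rule curve_triple_eqI[OF Gamma_add(1)[OF W12 W3] Gamma_zero(1)])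
    fix f d1 d2 d3
    assume f: "f \<in> into C c" and d1: "d1 \<in> DD f" and d2: "d2 \<in> DD f"
      and d3: "d3 \<in> DD f"
    note cf = into_Ob[OF f]
    interpret K: cring "RD f" using f by (intro cring_Rng) simp
    interpret H: group "sect_group (Dom C f)" by (rule group_sect)
    let ?H = "sect_group (Dom C f)"
    let ?m = "\<lambda>a b. a \<otimes>\<^bsub>RD f\<^esub> b"
    let ?D = "?m d1 (?m d2 d3)"
    define x where "x = curve c X f d1"
    define y where "y = curve c Y f d2"
    define z where "z = curve c Z f d3"
    note xyz = x_def y_def z_def
    have xc: "x \<in> carrier ?H" and yc: "y \<in> carrier ?H" and zc: "z \<in> carrier ?H"
      unfolding xyz by (intro curve_unit X Y Z f d1 d2 d3)+
    have dc: "d1 \<in> carrier (RD f)" "d2 \<in> carrier (RD f)" "d3 \<in> carrier (RD f)"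
      using d1 d2 d3 by simp_all
    \<comment> \<open>The triple product is regrouped so that each of the three iterated brackets
      can be evaluated at it.\<close>
    have D: "?D = ?m d2 (?m d3 d1)" "?D = ?m d3 (?m d1 d2)" using dc by (simp_all add: K.m_ac)
    note Din = mult_in_D[OF cf d1 mult_in_D[OF cf d2 d3]]
    \<comment> \<open>This removes the inverses from the Hall-Witt identity: negating d negates the
      parameter d e of the bracket, which inverts the commutator and so swaps its arguments.\<close>
    have flip: "H.commutator (inv\<^bsub>?H\<^esub> curve c V f d) (curve c U f e) = H.commutator (curve c U f e) (curve c V f d)"
      if U: "U \<in> \<Gamma> c" and V: "V \<in> \<Gamma> c"
        and d: "d \<in> DD f" and e: "e \<in> DD f" for U V d e
    proof -
      have "H.commutator (inv\<^bsub>?H\<^esub> curve c V f d) (curve c U f e) = curve c (?b V U) f (?m (\<ominus>\<^bsub>RD f\<^esub> d) e)"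
        unfolding curve_unit(2)[OF V f d] curve_bracket[OF V U f neg_in_D[OF cf d] e] ..
      also have "?m (\<ominus>\<^bsub>RD f\<^esub> d) e = \<ominus>\<^bsub>RD f\<^esub> ?m d e"
        using d e by (intro K.l_minus) simp_all
      also have "curve c (?b V U) f (\<ominus>\<^bsub>RD f\<^esub> ?m d e) = inv\<^bsub>?H\<^esub> (curve c (?b V U) f (?m d e))"
        by (rule curve_unit(2)[OF bracket_closed[OF V U] f mult_in_D[OF cf d e], symmetric])
      also have "\<dots> = H.commutator (curve c U f e) (curve c V f d)"
        unfolding curve_bracket[OF V U f d e]
        by (rule H.inv_commutator[OF curve_unit(1)[OF V f d] curve_unit(1)[OF U f e]])
      finally show ?thesis .
    qed
    let ?w1 = "H.commutator x (H.commutator y z)" and ?w2 = "H.commutator y (H.commutator z x)"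
      and ?w3 = "H.commutator z (H.commutator x y)"
    have w1: "curve c (?b X (?b Y Z)) f ?D = ?w1"
      unfolding curve_bracket[OF X YZ f d1 mult_in_D[OF cf d2 d3]] curve_bracket[OF Y Z f d2 d3] xyz ..
    have w2: "curve c (?b Y (?b Z X)) f ?D = ?w2"
      unfolding D(1) curve_bracket[OF Y ZX f d2 mult_in_D[OF cf d3 d1]] curve_bracket[OF Z X f d3 d1] xyz ..
    have w3: "curve c (?b Z (?b X Y)) f ?D = ?w3"
      unfolding D(2) curve_bracket[OF Z XY f d3 mult_in_D[OF cf d1 d2]] curve_bracket[OF X Y f d1 d2] xyz ..
    have conj: "inv\<^bsub>?H\<^esub> curve c V f d \<otimes>\<^bsub>?H\<^esub> curve c W f ?D \<otimes>\<^bsub>?H\<^esub> curve c V f d = curve c W f ?D"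
      if V: "V \<in> \<Gamma> c" and W: "W \<in> \<Gamma> c"
        and d: "d \<in> DD f" and e: "e \<in> DD f" "?D = ?m e d" for V W d e
    proof -
      have "curve c W f ?D \<otimes>\<^bsub>?H\<^esub> curve c V f d = curve c V f d \<otimes>\<^bsub>?H\<^esub> curve c W f ?D"
        using curve_commute[OF W V f D2_multiple[OF cf e(1) d]] by (simp add: sect_group_simps e(2))
      then show ?thesis
        using curve_unit(1)[OF V f d] curve_unit(1)[OF W f Din] by (simp add: H.m_assoc H.cancel_inv)
    qed
    \<comment> \<open>Regrouped as (d1 d3) d2, the common parameter is a multiple of the one at
      which the conjugating curve is taken; similarly in the next two claims.\<close>
    have c3: "inv\<^bsub>?H\<^esub> y \<otimes>\<^bsub>?H\<^esub> ?w3 \<otimes>\<^bsub>?H\<^esub> y = ?w3"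
      using conj[OF Y W3 d2 mult_in_D[OF cf d1 d3]] dc unfolding w3 y_def by (simp add: K.m_ac)
    have c1: "inv\<^bsub>?H\<^esub> z \<otimes>\<^bsub>?H\<^esub> ?w1 \<otimes>\<^bsub>?H\<^esub> z = ?w1"
      using conj[OF Z W1 d3 mult_in_D[OF cf d1 d2]] dc unfolding w1 z_def by (simp add: K.m_ac)
    have c2: "inv\<^bsub>?H\<^esub> x \<otimes>\<^bsub>?H\<^esub> ?w2 \<otimes>\<^bsub>?H\<^esub> x = ?w2"
      using conj[OF X W2 d1 mult_in_D[OF cf d2 d3]] dc unfolding w2 x_def by (simp add: K.m_ac)
    have "?w3 \<otimes>\<^bsub>?H\<^esub> ?w1 \<otimes>\<^bsub>?H\<^esub> ?w2 = \<one>\<^bsub>?H\<^esub>"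
      using H.hall_witt[OF xc yc zc]
      unfolding flip[OF X Y d2 d1, folded xyz] flip[OF Y Z d3 d2, folded xyz] flip[OF Z X d1 d3, folded xyz] c1 c2 c3 .
    \<comment> \<open>The Hall-Witt identity gives the three factors in another cyclic order; a
      product equal to the unit may be rotated.\<close>
    then have "?w1 \<otimes>\<^bsub>?H\<^esub> ?w2 \<otimes>\<^bsub>?H\<^esub> ?w3 = \<one>\<^bsub>?H\<^esub>"
      using H.inv_comm[of ?w3 "?w1 \<otimes>\<^bsub>?H\<^esub> ?w2"] xc yc zc by (simp add: H.m_assoc)
    then show "curve c (?b X (?b Y Z) \<oplus>\<^bsub>?L\<^esub> ?b Y (?b Z X) \<oplus>\<^bsub>?L\<^esub> ?b Z (?b X Y)) f ?D = curve c \<zero>\<^bsub>?L\<^esub> f ?D"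
      unfolding Gamma_add(2)[OF W12 W3 f Din] Gamma_add(2)[OF W1 W2 f Din] Gamma_zero(2)[OF f Din] w1 w2 w3
      by (simp add: sect_group_simps)
  qed
qed

text \<open>Antisymmetry transfers additivity from the right argument to the left and homogeneity
  from the left argument to the right.\<close>

lemma lie_algebra_Gamma:
  assumes c: "c \<in> Ob C"
  shows "lie_algebra (Rng R c) (\<Gamma>M c) (br c)"
proof -
  interpret M: module "Rng R c" "\<Gamma>M c" by (rule module_Gamma[OF c])
  show ?thesis
  proof (intro lie_algebra.intro lie_algebra_axioms.intro M.module_axioms, simp_all only: Gamma_carrier)
    fix X Y assume X: "X \<in> \<Gamma> c" and Y: "Y \<in> \<Gamma> c"
    show "br c X Y \<in> \<Gamma> c" by (rule bracket_closed[OF X Y])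
    show "br c X Y = \<ominus>\<^bsub>\<Gamma>M c\<^esub> br c Y X" by (rule bracket_antisym[OF c X Y])
    fix a assume a: "a \<in> carrier (Rng R c)"
    show "br c (a \<odot>\<^bsub>\<Gamma>M c\<^esub> X) Y = a \<odot>\<^bsub>\<Gamma>M c\<^esub> br c X Y"
      by (rule bracket_smult_left[OF a X Y])
    show "br c X (a \<odot>\<^bsub>\<Gamma>M c\<^esub> Y) = a \<odot>\<^bsub>\<Gamma>M c\<^esub> br c X Y"
      unfolding bracket_antisym[OF c X Gamma_smult(1)[OF Y a]] bracket_smult_left[OF a Y X] bracket_antisym[OF c X Y]
      using a bracket_closed[OF Y X] by (simp add: M.smult_r_minus)
  next
    fix X Y Z assume X: "X \<in> \<Gamma> c" and Y: "Y \<in> \<Gamma> c"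
      and Z: "Z \<in> \<Gamma> c"
    show "br c X (Y \<oplus>\<^bsub>\<Gamma>M c\<^esub> Z) =
      br c X Y \<oplus>\<^bsub>\<Gamma>M c\<^esub> br c X Z"
      by (rule bracket_add_right[OF X Y Z])
    show "br c (X \<oplus>\<^bsub>\<Gamma>M c\<^esub> Y) Z =
      br c X Z \<oplus>\<^bsub>\<Gamma>M c\<^esub> br c Y Z"
      unfolding bracket_antisym[OF c Gamma_add(1)[OF X Y] Z] bracket_add_right[OF Z X Y]
        bracket_antisym[OF c X Z] bracket_antisym[OF c Y Z]
      using bracket_closed[OF Z X] bracket_closed[OF Z Y] by (simp add: M.minus_add)
    show "br c X (br c Y Z) \<oplus>\<^bsub>\<Gamma>M c\<^esub>
      br c Y (br c Z X) \<oplus>\<^bsub>\<Gamma>M c\<^esub>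
      br c Z (br c X Y) = \<zero>\<^bsub>\<Gamma>M c\<^esub>"
      by (rule bracket_jacobi[OF X Y Z])
  qed
qed

section \<open>Compatibility of the operations with restriction\<close>

lemma Gamma_add_res:
  assumes f: "f \<in> into C c" and X: "X \<in> \<Gamma> c" and Y: "Y \<in> \<Gamma> c"
  shows "maps_res C f (X \<oplus>\<^bsub>\<Gamma>M c\<^esub> Y) =
    maps_res C f X \<oplus>\<^bsub>\<Gamma>M (Dom C f)\<^esub> maps_res C f Y"
proof (rule curve_eqI[OF Gamma_res[OF Gamma_add(1)[OF X Y] f] Gamma_add(1)[OF Gamma_res[OF X f] Gamma_res[OF Y f]]])
  fix g d assume g: "g \<in> over f" and d: "d \<in> DD g"
  have fg: "Dom C (f \<cdot> g) = Dom C g" using f g by simp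
  show "curve (Dom C f) (maps_res C f (X \<oplus>\<^bsub>\<Gamma>M c\<^esub> Y)) g d =
      curve (Dom C f) (maps_res C f X \<oplus>\<^bsub>\<Gamma>M (Dom C f)\<^esub> maps_res C f Y) g d"
    unfolding Gamma_add(2)[OF Gamma_res[OF X f] Gamma_res[OF Y f] g d] curve_res[OF f g d]
      Gamma_add(2)[OF X Y into_comp[OF f g], unfolded fg, OF d] ..
qed

lemma Gamma_smult_res:
  assumes f: "f \<in> into C c" and a: "a \<in> carrier (Rng R c)" and X: "X \<in> \<Gamma> c"
  shows "maps_res C f (a \<odot>\<^bsub>\<Gamma>M c\<^esub> X) =
    RRes R f a \<odot>\<^bsub>\<Gamma>M (Dom C f)\<^esub> maps_res C f X"
proof (rule curve_eqI[OF Gamma_res[OF Gamma_smult(1)[OF X a] f] Gamma_smult(1)[OF Gamma_res[OF X f] RRes_simps(1)[OF f a]]])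
  fix g d assume g: "g \<in> over f" and d: "d \<in> DD g"
  have fg: "Dom C (f \<cdot> g) = Dom C g" using f g by simp
  note fa = RRes_simps(1)[OF f a]
  note ad = inf_D_mult[OF into_Ob[OF g] RRes_simps(1)[OF g fa] d]
  show "curve (Dom C f) (maps_res C f (a \<odot>\<^bsub>\<Gamma>M c\<^esub> X)) g d =
      curve (Dom C f) (RRes R f a \<odot>\<^bsub>\<Gamma>M (Dom C f)\<^esub> maps_res C f X) g d"
    unfolding Gamma_smult(2)[OF Gamma_res[OF X f] fa g d] curve_res[OF f g d] curve_res[OF f g ad]
      Gamma_smult(2)[OF X a into_comp[OF f g], unfolded fg, OF d] RRes_comp[OF f g a] ..
qed

text \<open>The restricted bracket satisfies the equation that characterizes the bracket at the new
  stage, so uniqueness applies.\<close>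

lemma bracket_res:
  assumes f: "f \<in> into C c" and X: "X \<in> \<Gamma> c" and Y: "Y \<in> \<Gamma> c"
  shows "maps_res C f (br c X Y) = br (Dom C f) (maps_res C f X) (maps_res C f Y)"
proof (rule bracket_eqI[OF Gamma_res[OF X f] Gamma_res[OF Y f] Gamma_res[OF bracket_closed[OF X Y] f], symmetric])
  fix g d e assume g: "g \<in> over f" and d: "d \<in> DD g" and e: "e \<in> DD g"
  have fg: "Dom C (f \<cdot> g) = Dom C g" using f g by simp
  show "curve (Dom C f) (maps_res C f (br c X Y)) g (d \<otimes>\<^bsub>RD g\<^esub> e) =
      gcomm (Dom C g) (curve (Dom C f) (maps_res C f X) g d) (curve (Dom C f) (maps_res C f Y) g e)"
    unfolding curve_res[OF f g d] curve_res[OF f g e] curve_res[OF f g mult_in_D[OF into_Ob[OF g] d e]]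
    by (rule curve_bracket[OF X Y into_comp[OF f g], unfolded fg, OF d e])
qed

lemma internal_lie_algebra_Gamma:
  "internal_lie_algebra C R (\<Gamma>M) (Res (GammaAG C R G)) (br)"
  unfolding internal_lie_algebra_def Gamma_carrier Res_Gamma
proof (intro conjI ballI)
  show "lie_algebra (Rng R c) (\<Gamma>M c) (br c)" if "c \<in> Ob C" for c
    by (rule lie_algebra_Gamma[OF that])
  show "presheaf C \<lparr>Sec = \<Gamma>, Res = maps_res C\<rparr>"
  proof (unfold_locales, simp_all)
    fix f X assume "f \<in> Arr C" "X \<in> \<Gamma> (Cod C f)"
    then show "maps_res C f X \<in> \<Gamma> (Dom C f)"
      by (intro Gamma_res[of X "Cod C f"]) (simp_all add: into_def)
  next
    fix c X assume "c \<in> Ob C" "X \<in> \<Gamma> c"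
    then show "maps_res C (Id C c) X = X" by (auto simp: Gamma_iff intro: maps_res_Id)
  next
    fix f g X assume "f \<in> Arr C" "g \<in> Arr C" "Dom C f = Cod C g"
    then show "maps_res C (f \<cdot> g) X = maps_res C g (maps_res C f X)"
      by (intro maps_res_comp[of f "Cod C f"]) (simp_all add: into_def)
  qed
  fix f X assume "f \<in> Arr C" and X: "X \<in> \<Gamma> (Cod C f)"
  then have f: "f \<in> into C (Cod C f)" by (simp add: into_def)
  show "maps_res C f (X \<oplus>\<^bsub>\<Gamma>M (Cod C f)\<^esub> Y) =
      maps_res C f X \<oplus>\<^bsub>\<Gamma>M (Dom C f)\<^esub> maps_res C f Y"
    "maps_res C f (br (Cod C f) X Y) = br (Dom C f) (maps_res C f X) (maps_res C f Y)"
    if Y: "Y \<in> \<Gamma> (Cod C f)" for Y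
    by (rule Gamma_add_res[OF f X Y], rule bracket_res[OF f X Y])
  show "maps_res C f (a \<odot>\<^bsub>\<Gamma>M (Cod C f)\<^esub> X) =
      RRes R f a \<odot>\<^bsub>\<Gamma>M (Dom C f)\<^esub> maps_res C f X" if a: "a \<in> carrier (Rng R (Cod C f))" for a
    by (rule Gamma_smult_res[OF f a X])
qed

end

theorem theorem8:
  fixes C :: "('o, 'm) cat" and J :: "'o \<Rightarrow> 'm set set"
    and R :: "('o, 'm, 'r) rng_psh" and G :: "('o, 'm, 'x, 'g) gpd"
  assumes "grothendieck_site C J"
    and "cring_sheaf C J R"
    and "kock_lawvere C R"
    and "microlinear C R (line R)"
    and "groupoid_sheaf C J G"
    and "microlinear C R (Base G)"
    and "microlinear C R (Tot G)"
  shows "(\<forall>c\<in>Ob C. bij_betw (to_curve C R G c) (Sec (GammaAG C R G) c) (tangent_Bisect C R G c)) \<and>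
    (\<forall>c\<in>Ob C. \<forall>X\<in>Sec (GammaAG C R G) c. \<forall>Y\<in>Sec (GammaAG C R G) c.
       (\<exists>!l. is_plus_map C R G c X Y l) \<and> (\<exists>!Z. is_bracket C R G c X Y Z)) \<and>
    internal_lie_algebra C R (Gamma_module C R G) (Res (GammaAG C R G)) (bracket C R G)"
proof -
  interpret lie_setting C J R G
    using assms
    by (intro lie_setting.intro kl_line.intro kl_line_axioms.intro lie_setting_axioms.intro)
  show ?thesis
    \<comment> \<open>\<open>is_plus_map_iff\<close> equates the plus map with one explicit term,
      which is unique existence.\<close>
    using to_curve_bij is_plus_map_iff bracket_ex1 internal_lie_algebra_Gamma by simp
qed

end
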